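(* Let $M$ be a compact oriented manifold of dimension $n\geq 3$ and let $k\geq 2$. Suppose the Riemannian metric $h$ and the trace-free Codazzi tensor $\omega\in\Gamma(S^k_0(T^*M))$ solve the coupled projectively flat equations with constants $c<0$ and $\kappa\in\mathbb{R}$. Then $$0\geq \int_M|\omega|^2\left(\frac{n+k-2}{n(n-1)}\kappa + c\,\Lambda_{n,k}|\omega|^2\right)d\mathrm{vol}_h.$$
   Context: Let $h$ be a metric with Levi-Civita connection $D$; indices are raised and lowered with $h$. $S^k_0(T^*M)$ is the bundle of completely symmetric covariant $k$-tensors that are $h$-trace-free. Norms of tensors are given by complete contraction: $|\omega|^2=\omega^{i_1\dots i_k}\omega_{i_1\dots i_k}$. The curvature is defined by $D_iD_j\alpha_k-D_jD_i\alpha_k=-R_{ijk}{}^p\alpha_p$ for one-forms $\alpha$, and $\mathrm{Riem}_{ijkl}=R_{ijk}{}^ph_{pl}$. For a symmetric $k$-tensor $\omega$, $k\geq2$, $(\omega\circledast\omega)_{ijkl}=\omega_{ki}{}^{A}\omega_{jlA}-\omega_{kj}{}^A\omega_{ilA}$, where $A=a_1\dots a_{k-2}$ is a contracted multi-index, and $(h\circledast h)_{ijkl}=h_{ki}h_{jl}-h_{kj}h_{il}$. For a tensor $Y_{ijkl}$ with the symmetries of a metric curvature tensor, $\rho(Y)_{ij}=Y_{pij}{}^p$; thus for trace-free $\omega$, $\rho(\omega\circledast\omega)_{ij}=\omega_{ia_1\dots a_{k-1}}\omega_j{}^{a_1\dots a_{k-1}}$. A trace-free Codazzi tensor is $\omega\in\Gamma(S^k_0(T^*M))$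 with $D_i\omega_{ji_1\dots i_{k-1}}=D_j\omega_{ii_1\dots i_{k-1}}$. The pair $(h,\omega)$ solves the coupled projectively flat equations with constants $c,\kappa$ if $\omega$ is a trace-free Codazzi tensor and $\mathrm{Riem}-c(\omega\circledast\omega)=-\frac{\kappa}{n(n-1)}h\circledast h$. For an $n$-dimensional Euclidean vector space $(V,h)$ define $$\Lambda_{n,k}=\max\left\{\tfrac{k-1}{2}|\omega\circledast\omega|^2+|\rho(\omega\circledast\omega)|^2:\ \omega\in S^k_0V^*,\ |\omega|^2=1\right\},$$ where $S^k_0V^*$ is the space of $h$-trace-free symmetric $k$-tensors on $V$. *)

theory Defs
  imports "HOL-Analysis.Analysis"
begin

section \<open>Smooth functions on open subsets of coordinate space\<close>

definition pd :: "'n \<Rightarrow> (real^'n \<Rightarrow> real) \<Rightarrow> real^'n \<Rightarrow> real" where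
  "pd i f x = frechet_derivative f (at x) (axis i 1)"

text \<open>For open \<open>S\<close> this is \<open>C\<^sup>\<infinity>\<close>: every iterated partial derivative (the list may be empty) is
  differentiable, hence continuous, on \<open>S\<close>.\<close>

definition smooth_fun_on :: "(real^'n) set \<Rightarrow> (real^'n \<Rightarrow> real) \<Rightarrow> bool" where
  "smooth_fun_on S f \<longleftrightarrow> (\<forall>is. fold pd is f differentiable_on S)"


section \<open>Tensors in components\<close>

text \<open>A covariant \<open>r\<close>-tensor on \<open>\<real>\<^sup>n\<close> is given by its components with respect to the coordinate basis,
  indexed by lists of length \<open>r\<close>; values at lists of other lengths are irrelevant.
  The argument \<open>H\<close> below is the Gram matrix of the inner product, so \<open>matrix_inv H\<close> raises indices.\<close>

type_synonym 'n tensor = "'n list \<Rightarrow> real"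

definition multi_idx :: "nat \<Rightarrow> 'n list set" where
  "multi_idx r = {I. length I = r}"

definition idx_weight :: "real^'n^'n \<Rightarrow> 'n::finite list \<Rightarrow> 'n list \<Rightarrow> real" where
  "idx_weight H I J = (\<Prod>a<length I. matrix_inv H $ (I ! a) $ (J ! a))"

definition norm_sq :: "real^'n^'n \<Rightarrow> nat \<Rightarrow> 'n::finite tensor \<Rightarrow> real" where
  "norm_sq H r w = (\<Sum>I\<in>multi_idx r. \<Sum>J\<in>multi_idx r. idx_weight H I J * w I * w J)"

definition symmetric_tensor :: "nat \<Rightarrow> 'n tensor \<Rightarrow> bool" where
  "symmetric_tensor k w \<longleftrightarrow> (\<forall>I\<in>multi_idx k. \<forall>J\<in>multi_idx k. mset I = mset J \<longrightarrow> w I = w J)"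

text \<open>For a symmetric tensor of rank \<open>k \<ge> 2\<close> the trace in the first two indices is the only one.\<close>

definition trace_free :: "real^'n^'n \<Rightarrow> nat \<Rightarrow> 'n::finite tensor \<Rightarrow> bool" where
  "trace_free H k w \<longleftrightarrow>
     (\<forall>A\<in>multi_idx (k - 2). (\<Sum>i\<in>UNIV. \<Sum>j\<in>UNIV. matrix_inv H $ i $ j * w (i # j # A)) = 0)"

text \<open>\<open>(\<omega> \<circledast> \<omega>)\<^sub>i\<^sub>j\<^sub>p\<^sub>q = \<omega>\<^sub>p\<^sub>i\<^sup>A \<omega>\<^sub>j\<^sub>q\<^sub>A - \<omega>\<^sub>p\<^sub>j\<^sup>A \<omega>\<^sub>i\<^sub>q\<^sub>A\<close> for a symmetric \<open>k\<close>-tensor, \<open>k \<ge> 2\<close>.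
  For \<open>k = 2\<close> and \<open>\<omega> = h\<close> it is \<open>h \<circledast> h\<close>.\<close>

definition circledast :: "real^'n^'n \<Rightarrow> nat \<Rightarrow> 'n::finite tensor \<Rightarrow> 'n tensor" where
  "circledast H k w L = (case L of
     [i, j, p, q] \<Rightarrow> \<Sum>A\<in>multi_idx (k - 2). \<Sum>B\<in>multi_idx (k - 2). idx_weight H A B *
        (w (p # i # A) * w (j # q # B) - w (p # j # A) * w (i # q # B))
   | _ \<Rightarrow> 0)"

text \<open>\<open>\<rho>(Y)\<^sub>i\<^sub>j = Y\<^sub>p\<^sub>i\<^sub>j\<^sup>p\<close>\<close>

definition rho :: "real^'n^'n \<Rightarrow> 'n::finite tensor \<Rightarrow> 'n tensor" where
  "rho H Y L = (case L of
     [i, j] \<Rightarrow> \<Sum>p\<in>UNIV. \<Sum>q\<in>UNIV. matrix_inv H $ p $ q * Y [p, i, j, q]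
   | _ \<Rightarrow> 0)"

text \<open>The constant \<open>\<Lambda>\<^sub>n\<^sub>,\<^sub>k\<close> computed in the Euclidean space with Gram matrix \<open>H\<close>. The value depends only on
  \<open>n\<close> and \<open>k\<close>, as all Euclidean spaces of dimension \<open>n\<close> are isometric. For \<open>n \<ge> 2\<close> the supremum is a
  maximum: the unit sphere of \<open>S\<^sup>k\<^sub>0V\<^sup>*\<close> is nonempty and compact and the function is continuous.\<close>

definition Lambda :: "real^'n^'n \<Rightarrow> nat \<Rightarrow> real" where
  "Lambda H k = Sup {(real k - 1) / 2 * norm_sq H 4 (circledast H k w)
                       + norm_sq H 2 (rho H (circledast H k w)) | w :: 'n::finite tensor.
                     symmetric_tensor k w \<and> trace_free H k w \<and> norm_sq H k w = 1}"


section \<open>Oriented smooth manifolds\<close>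

type_synonym ('m, 'n) chart = "'m set \<times> ('m \<Rightarrow> real^'n)"

abbreviation chart_range :: "('m, 'n) chart \<Rightarrow> (real^'n) set" where
  "chart_range c \<equiv> snd c ` fst c"

definition transition :: "('m, 'n) chart \<Rightarrow> ('m, 'n) chart \<Rightarrow> real^'n \<Rightarrow> real^'n" where
  "transition c d = snd d \<circ> inv_into (fst c) (snd c)"

abbreviation overlap :: "('m, 'n) chart \<Rightarrow> ('m, 'n) chart \<Rightarrow> (real^'n) set" where
  "overlap c d \<equiv> snd c ` (fst c \<inter> fst d)"

text \<open>Second countability is not required, since it is automatic for compact \<open>M\<close>.\<close>

definition oriented_smooth_manifold :: "'m topology \<Rightarrow> ('m, 'n::finite) chart set \<Rightarrow> bool" where
  "oriented_smooth_manifold M \<A> \<longleftrightarrow>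
     Hausdorff_space M \<and>
     (\<Union>c\<in>\<A>. fst c) = topspace M \<and>
     (\<forall>c\<in>\<A>. openin M (fst c) \<and> open (chart_range c) \<and>
        homeomorphic_map (subtopology M (fst c)) (top_of_set (chart_range c)) (snd c)) \<and>
     (\<forall>c\<in>\<A>. \<forall>d\<in>\<A>.
        (\<forall>i. smooth_fun_on (overlap c d) (\<lambda>x. transition c d x $ i)) \<and>
        (\<forall>x\<in>overlap c d. det (jacobian (transition c d) (at x)) > 0))"

text \<open>A tensor field is a family of components \<open>T c x I\<close>, one for each chart \<open>c\<close>, as a function of the
  coordinates \<open>x\<close> in the range of \<open>c\<close>; on overlaps the families are related by the covariant
  transformation law.\<close>

type_synonym ('m, 'n) tensor_field = "('m, 'n) chart \<Rightarrow> real^'n \<Rightarrow> 'n tensor"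

definition smooth_tensor_field ::
    "('m, 'n::finite) chart set \<Rightarrow> nat \<Rightarrow> ('m, 'n) tensor_field \<Rightarrow> bool" where
  "smooth_tensor_field \<A> r T \<longleftrightarrow>
     (\<forall>c\<in>\<A>. \<forall>I\<in>multi_idx r. smooth_fun_on (chart_range c) (\<lambda>x. T c x I)) \<and>
     (\<forall>c\<in>\<A>. \<forall>d\<in>\<A>. \<forall>x\<in>overlap c d. \<forall>I\<in>multi_idx r.
        T c x I = (\<Sum>J\<in>multi_idx r.
          (\<Prod>a<r. jacobian (transition c d) (at x) $ (J ! a) $ (I ! a)) * T d (transition c d x) J))"

definition gram :: "'n tensor \<Rightarrow> real^'n^'n" where
  "gram h = (\<chi> i j. h [i, j])"

definition riemannian_metric ::
    "('m, 'n::finite) chart set \<Rightarrow> ('m, 'n) tensor_field \<Rightarrow> bool" where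
  "riemannian_metric \<A> h \<longleftrightarrow>
     smooth_tensor_field \<A> 2 h \<and>
     (\<forall>c\<in>\<A>. \<forall>x\<in>chart_range c. symmetric_tensor 2 (h c x) \<and>
        (\<forall>v. v \<noteq> 0 \<longrightarrow> v \<bullet> (gram (h c x) *v v) > 0))"


section \<open>Levi-Civita connection and curvature in a chart\<close>

text \<open>Here \<open>h\<close> and \<open>T\<close> are the component functions in one fixed chart.
  \<open>christoffel h x i j p\<close> is \<open>\<Gamma>\<^sub>i\<^sub>j\<^sup>p\<close>.\<close>

definition christoffel :: "(real^'n \<Rightarrow> 'n tensor) \<Rightarrow> real^'n \<Rightarrow> 'n \<Rightarrow> 'n \<Rightarrow> 'n::finite \<Rightarrow> real" where
  "christoffel h x i j p = (\<Sum>q\<in>UNIV. matrix_inv (gram (h x)) $ p $ q *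
     (pd i (\<lambda>y. h y [j, q]) x + pd j (\<lambda>y. h y [i, q]) x - pd q (\<lambda>y. h y [i, j]) x)) / 2"

text \<open>\<open>cov_deriv h T x (i # I)\<close> is \<open>D\<^sub>i T\<^sub>I\<close> : the index of differentiation comes first.\<close>

definition cov_deriv ::
    "(real^'n \<Rightarrow> 'n tensor) \<Rightarrow> (real^'n \<Rightarrow> 'n tensor) \<Rightarrow> real^'n \<Rightarrow> 'n::finite tensor" where
  "cov_deriv h T x L = (case L of
     i # I \<Rightarrow> pd i (\<lambda>y. T y I) x
              - (\<Sum>a<length I. \<Sum>p\<in>UNIV. christoffel h x i (I ! a) p * T x (I[a := p]))
   | [] \<Rightarrow> 0)"

definition coord_form :: "'n \<Rightarrow> real^'n \<Rightarrow> 'n tensor" where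
  "coord_form p x I = (if I = [p] then 1 else 0)"

text \<open>\<open>R\<^sub>i\<^sub>j\<^sub>k\<^sup>p\<close> is read off from \<open>D\<^sub>iD\<^sub>j\<alpha>\<^sub>k - D\<^sub>jD\<^sub>i\<alpha>\<^sub>k = - R\<^sub>i\<^sub>j\<^sub>k\<^sup>q\<alpha>\<^sub>q\<close> by taking \<open>\<alpha> = dx\<^sup>p\<close>; the left side is
  tensorial in \<open>\<alpha>\<close>, so the identity then holds for every one-form.\<close>

definition curvature :: "(real^'n \<Rightarrow> 'n tensor) \<Rightarrow> real^'n \<Rightarrow> 'n \<Rightarrow> 'n \<Rightarrow> 'n \<Rightarrow> 'n::finite \<Rightarrow> real" where
  "curvature h x i j k p =
     - (cov_deriv h (cov_deriv h (coord_form p)) x [i, j, k]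
        - cov_deriv h (cov_deriv h (coord_form p)) x [j, i, k])"

definition Riem :: "(real^'n \<Rightarrow> 'n tensor) \<Rightarrow> real^'n \<Rightarrow> 'n::finite tensor" where
  "Riem h x L = (case L of
     [i, j, k, l] \<Rightarrow> \<Sum>p\<in>UNIV. curvature h x i j k p * h x [p, l]
   | _ \<Rightarrow> 0)"


section \<open>Trace-free Codazzi tensors and the coupled equations\<close>

definition trace_free_codazzi ::
    "('m, 'n::finite) chart set \<Rightarrow> ('m, 'n) tensor_field \<Rightarrow> nat \<Rightarrow> ('m, 'n) tensor_field \<Rightarrow> bool" where
  "trace_free_codazzi \<A> h k \<omega> \<longleftrightarrow>
     smooth_tensor_field \<A> k \<omega> \<and>
     (\<forall>c\<in>\<A>. \<forall>x\<in>chart_range c.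
        symmetric_tensor k (\<omega> c x) \<and> trace_free (gram (h c x)) k (\<omega> c x) \<and>
        (\<forall>i j. \<forall>I\<in>multi_idx (k - 1).
           cov_deriv (h c) (\<omega> c) x (i # j # I) = cov_deriv (h c) (\<omega> c) x (j # i # I)))"

definition coupled_projectively_flat ::
    "('m, 'n::finite) chart set \<Rightarrow> ('m, 'n) tensor_field \<Rightarrow> nat \<Rightarrow> ('m, 'n) tensor_field
       \<Rightarrow> real \<Rightarrow> real \<Rightarrow> bool" where
  "coupled_projectively_flat \<A> h k \<omega> c \<kappa> \<longleftrightarrow>
     trace_free_codazzi \<A> h k \<omega> \<and>
     (\<forall>d\<in>\<A>. \<forall>x\<in>chart_range d. \<forall>L\<in>multi_idx 4.
        Riem (h d) x L - c * circledast (gram (h d x)) k (\<omega> d x) L =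
        - (\<kappa> / (real CARD('n) * (real CARD('n) - 1))) * circledast (gram (h d x)) 2 (h d x) L)"


section \<open>Integration\<close>

text \<open>\<open>dvol\<^sub>h\<close> is the Borel measure on \<open>M\<close> which in every (oriented) chart is
  \<open>\<surd>(det h) dx\<^sup>1\<dots>dx\<^sup>n\<close>.\<close>

definition riemannian_volume ::
    "'m topology \<Rightarrow> ('m, 'n::finite) chart set \<Rightarrow> ('m, 'n) tensor_field \<Rightarrow> 'm measure" where
  "riemannian_volume M \<A> h = (THE \<mu>.
     space \<mu> = topspace M \<and> sets \<mu> = sigma_sets (topspace M) {U. openin M U} \<and>
     (\<forall>c\<in>\<A>. \<forall>B\<in>sets \<mu>. B \<subseteq> fst c \<longrightarrow>
        emeasure \<mu> B = (\<integral>\<^sup>+x\<in>snd c ` B. ennreal (sqrt (det (gram (h c x)))) \<partial>lborel)))"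

text \<open>The function \<open>|\<omega>|\<^sup>2\<close> on \<open>M\<close>; the transformation laws make its value at a point the same in every
  chart around the point.\<close>

definition norm_sq_at ::
    "('m, 'n::finite) chart set \<Rightarrow> ('m, 'n) tensor_field \<Rightarrow> nat \<Rightarrow> ('m, 'n) tensor_field \<Rightarrow> 'm \<Rightarrow> real" where
  "norm_sq_at \<A> h k \<omega> p = (THE s. \<forall>c\<in>\<A>. p \<in> fst c \<longrightarrow>
     s = norm_sq (gram (h c (snd c p))) k (\<omega> c (snd c p)))"

end

theory Submission
  imports Defs
begin

text \<open>
  The theorem is an instance of the Bochner method. Write \<open>\<phi> = |\<omega>|\<^sup>2\<close>. Since \<open>\<omega>\<close> is a trace-free Codazzi
  tensor, \<open>D\<omega>\<close> is symmetric and trace-free in all indices; in particular \<open>\<omega>\<close> is divergence-free, and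
  \<open>D\<^sup>pD\<^sub>p\<omega>\<^sub>i\<^sub>A = D\<^sup>pD\<^sub>i\<omega>\<^sub>p\<^sub>A\<close> equals the commutator of the two derivatives applied to \<open>\<omega>\<close>, which is
  algebraic in the curvature (\<open>ricci_identity\<close>). Inserting
  \<open>Riem = c (\<omega> \<circledast> \<omega>) - \<kappa> / (n (n - 1)) h \<circledast> h\<close> and contracting with \<open>\<omega>\<close> (\<open>bochner_identity\<close>) yields

  \<open>1/2 \<Delta>\<phi> = |D\<omega>|\<^sup>2 + (n + k - 2) / (n (n - 1)) \<kappa> \<phi> + c ((k - 1)/2 |\<omega> \<circledast> \<omega>|\<^sup>2 + |\<rho>(\<omega> \<circledast> \<omega>)|\<^sup>2)\<close>.

  The last bracket is homogeneous of degree four in \<open>\<omega>\<close>, so it is at most \<open>\<Lambda>\<^sub>n\<^sub>,\<^sub>k \<phi>\<^sup>2\<close>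
  (\<open>Lambda_form_le\<close>). As \<open>c < 0\<close> and \<open>|D\<omega>|\<^sup>2 \<ge> 0\<close>, the integrand of the theorem is at most \<open>1/2 \<Delta>\<phi>\<close>
  (\<open>bochner_inequality\<close>), and the Laplacian of a function on a closed manifold has integral zero.

  Two analytic points remain. The volume measure is introduced by a definite description, so it has to
  be constructed: a finite atlas is cut into disjoint Borel pieces, each piece is measured in its own
  chart, and the substitution rule shows that the result is the same in all charts
  (\<open>chart_measure_overlap\<close>, \<open>is_volume_exists_unique\<close>). The divergence theorem is proved with a partition
  of unity \<open>\<psi>\<^sub>t\<close>: in the chart of \<open>\<psi>\<^sub>t\<close>, integration by parts replaces \<open>\<integral> \<psi>\<^sub>t 1/2 \<Delta>\<phi>\<close> by
  \<open>- 1/2 \<integral> \<langle>d\<psi>\<^sub>t, d\<phi>\<rangle>\<close> (\<open>local_integral_inequality\<close>). The pairing of differentials is the same in all charts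
  (\<open>grad_pairing_transform\<close>), so the sum over \<open>t\<close> may be taken pointwise, where it vanishes because
  \<open>\<Sum>\<^sub>t \<psi>\<^sub>t = 1\<close>. In this way only first derivatives are ever compared between two charts.
\<close>

section \<open>Calculus of smooth functions\<close>

lemma pd_has_derivative:
  assumes "(f has_derivative f') (at x)"
  shows "pd i f x = f' (axis i 1)"
  using frechet_derivative_at[OF assms] by (simp add: pd_def)

lemma differentiable_has_derivative: "f differentiable (at x) \<Longrightarrow> (f has_derivative frechet_derivative f (at x)) (at x)"
  by (simp add: frechet_derivative_works)

lemma pd_const [simp]: "pd i (\<lambda>x. c) x = 0"
  by (simp add: pd_def)

lemma pd_add:
  assumes "f differentiable (at x)" "g differentiable (at x)"
  shows "pd i (\<lambda>x. f x + g x) x = pd i f x + pd i g x"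
  using pd_has_derivative[OF has_derivative_add[OF differentiable_has_derivative[OF assms(1)] differentiable_has_derivative[OF assms(2)]]]
  by (simp add: pd_def)

lemma pd_diff:
  assumes "f differentiable (at x)" "g differentiable (at x)"
  shows "pd i (\<lambda>x. f x - g x) x = pd i f x - pd i g x"
  using pd_has_derivative[OF has_derivative_diff[OF differentiable_has_derivative[OF assms(1)] differentiable_has_derivative[OF assms(2)]]]
  by (simp add: pd_def)

lemma pd_minus:
  assumes "f differentiable (at x)"
  shows "pd i (\<lambda>x. - f x) x = - pd i f x"
  using pd_has_derivative[OF has_derivative_minus[OF differentiable_has_derivative[OF assms(1)]]]
  by (simp add: pd_def)

lemma pd_mult:
  assumes "f differentiable (at x)" "g differentiable (at x)"
  shows "pd i (\<lambda>x. f x * g x) x = pd i f x * g x + f x * pd i g x"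
  using pd_has_derivative[OF has_derivative_mult[OF differentiable_has_derivative[OF assms(1)] differentiable_has_derivative[OF assms(2)]]]
  by (simp add: pd_def)

lemma pd_cmult:
  assumes "f differentiable (at x)"
  shows "pd i (\<lambda>x. c * f x) x = c * pd i f x"
  using pd_mult[of "\<lambda>x. c" x f] assms by simp

lemma pd_sum:
  assumes "\<And>a. a \<in> A \<Longrightarrow> f a differentiable (at x)"
  shows "pd i (\<lambda>x. \<Sum>a\<in>A. f a x) x = (\<Sum>a\<in>A. pd i (f a) x)"
  using pd_has_derivative[OF has_derivative_sum[OF differentiable_has_derivative[OF assms]]]
  by (simp add: pd_def)

lemma pd_prod:
  assumes "\<And>a. a \<in> A \<Longrightarrow> f a differentiable (at x)"
  shows "pd i (\<lambda>x. \<Prod>a\<in>A. f a x) x = (\<Sum>a\<in>A. pd i (f a) x * (\<Prod>b\<in>A - {a}. f b x))"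
  using pd_has_derivative[OF has_derivative_prod[OF differentiable_has_derivative[OF assms]]]
  by (simp add: pd_def)

lemma pd_chain_rule_real:
  assumes "f differentiable (at x)" "(u has_real_derivative u') (at (f x))"
  shows "(\<lambda>x. u (f x)) differentiable (at x)" "pd i (\<lambda>x. u (f x)) x = u' * pd i f x"
proof -
  have "((\<lambda>x. u (f x)) has_derivative (\<lambda>v. u' * frechet_derivative f (at x) v)) (at x)"
    using has_derivative_compose[OF differentiable_has_derivative[OF assms(1)] assms(2)[unfolded has_field_derivative_def]]
    by simp
  then show "(\<lambda>x. u (f x)) differentiable (at x)" "pd i (\<lambda>x. u (f x)) x = u' * pd i f x"
    by (auto simp: differentiable_def pd_has_derivative) (simp add: pd_def)
qed

lemma pd_cong:
  assumes "open S" "x \<in> S" "\<And>y. y \<in> S \<Longrightarrow> f y = g y"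
  shows "pd i f x = pd i g x"
proof -
  have eq: "(f has_derivative D) (at x) \<longleftrightarrow> (g has_derivative D) (at x)" for D
    using has_derivative_transform_within_open[OF _ assms(1,2)] assms(3) by metis
  show ?thesis unfolding pd_def frechet_derivative_def eq ..
qed

lemma differentiable_cong_open:
  assumes "open S" "x \<in> S" "\<And>y. y \<in> S \<Longrightarrow> f y = g y"
  shows "f differentiable (at x) \<longleftrightarrow> g differentiable (at x)"
  using has_derivative_transform_within_open[OF _ assms(1,2)] assms(3)
  unfolding differentiable_def by metis

lemma pd_chain_rule:
  fixes f :: "real^'n \<Rightarrow> real" and g :: "real^'m \<Rightarrow> real^'n"
  assumes "f differentiable (at (g x))" "g differentiable (at x)"
  shows "(\<lambda>x. f (g x)) differentiable (at x)"
    and "pd i (\<lambda>x. f (g x)) x = (\<Sum>m\<in>UNIV. jacobian g (at x) $ m $ i * pd m f (g x))"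
proof -
  have g: "(g has_derivative (\<lambda>v. jacobian g (at x) *v v)) (at x)"
    using assms(2) by (simp add: jacobian_works)
  have c: "((\<lambda>x. f (g x)) has_derivative (\<lambda>v. frechet_derivative f (at (g x)) (jacobian g (at x) *v v))) (at x)"
    using has_derivative_compose[OF g differentiable_has_derivative[OF assms(1)]] .
  then show "(\<lambda>x. f (g x)) differentiable (at x)" by (auto simp: differentiable_def)
  have lin: "linear (frechet_derivative f (at (g x)))"
    using linear_frechet_derivative[OF assms(1)] .
  have "jacobian g (at x) *v axis i 1 = (\<Sum>m\<in>UNIV. jacobian g (at x) $ m $ i *\<^sub>R axis m 1)"
    by (simp add: vec_eq_iff matrix_vector_mult_def axis_def if_distrib[of "\<lambda>u. _ * u"] cong: if_cong)
  then show "pd i (\<lambda>x. f (g x)) x = (\<Sum>m\<in>UNIV. jacobian g (at x) $ m $ i * pd m f (g x))"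
    unfolding pd_has_derivative[OF c] by (simp add: linear_sum[OF lin] linear_cmul[OF lin] pd_def)
qed

text \<open>Closure properties of smooth functions are proved by induction on the order of differentiability,
  for which a notion of finite order is needed. The case of order one is also used on its own, since the
  cut-off functions below are only once continuously differentiable.\<close>

primrec Ck :: "nat \<Rightarrow> (real^'n) set \<Rightarrow> (real^'n \<Rightarrow> real) \<Rightarrow> bool" where
  "Ck 0 S f \<longleftrightarrow> continuous_on S f"
| "Ck (Suc n) S f \<longleftrightarrow> f differentiable_on S \<and> (\<forall>i. Ck n S (pd i f))"

lemma Ck_continuous: "Ck n S f \<Longrightarrow> continuous_on S f"
  by (cases n) (auto simp: differentiable_imp_continuous_on)

lemma Ck_Suc_imp: "Ck (Suc n) S f \<Longrightarrow> Ck n S f"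
proof (induction n arbitrary: f)
  case 0
  then show ?case by (auto simp: differentiable_imp_continuous_on)
next
  case (Suc n)
  then show ?case by auto
qed

lemma Ck_cong:
  assumes "open S" "\<And>x. x \<in> S \<Longrightarrow> f x = g x"
  shows "Ck n S f \<longleftrightarrow> Ck n S g"
  using assms(2)
proof (induction n arbitrary: f g)
  case 0
  then show ?case using continuous_on_cong by (metis Ck.simps(1))
next
  case (Suc n)
  have 1: "f differentiable_on S \<longleftrightarrow> g differentiable_on S"
    using Suc.prems differentiable_cong_open[OF assms(1), of _ f g]
    by (simp add: differentiable_on_eq_differentiable_at[OF assms(1)])
  have "Ck n S (pd i f) \<longleftrightarrow> Ck n S (pd i g)" for i
    by (rule Suc.IH) (rule pd_cong[OF assms(1)], auto simp: Suc.prems)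
  with 1 show ?case by simp
qed

lemma Ck_const [simp]: "Ck n S (\<lambda>x. c)"
proof (induction n arbitrary: c)
  case (Suc n)
  have "pd i (\<lambda>x. c) = (\<lambda>x. 0)" for i :: 'a by auto
  with Suc show ?case by simp
qed simp

lemma Ck_add:
  assumes "open S"
  shows "Ck n S f \<Longrightarrow> Ck n S g \<Longrightarrow> Ck n S (\<lambda>x. f x + g x)"
proof (induction n arbitrary: f g)
  case (Suc n)
  have "Ck n S (\<lambda>x. pd i f x + pd i g x)" for i using Suc by auto
  moreover have "pd i (\<lambda>x. f x + g x) x = pd i f x + pd i g x" if "x \<in> S" for i x
    using that Suc.prems by (intro pd_add) (auto simp: differentiable_on_eq_differentiable_at[OF assms])
  ultimately have "Ck n S (pd i (\<lambda>x. f x + g x))" for i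
    by (subst Ck_cong[OF assms]) auto
  with Suc.prems show ?case by auto
qed (auto intro: continuous_intros)

lemma Ck_mult:
  assumes "open S"
  shows "Ck n S f \<Longrightarrow> Ck n S g \<Longrightarrow> Ck n S (\<lambda>x. f x * g x)"
proof (induction n arbitrary: f g)
  case (Suc n)
  have "Ck n S (\<lambda>x. pd i f x * g x + f x * pd i g x)" for i
    using Suc Suc.prems[THEN Ck_Suc_imp] by (intro Ck_add assms Suc.IH) auto
  moreover have "pd i (\<lambda>x. f x * g x) x = pd i f x * g x + f x * pd i g x" if "x \<in> S" for i x
    using that Suc.prems by (intro pd_mult) (auto simp: differentiable_on_eq_differentiable_at[OF assms])
  ultimately have "Ck n S (pd i (\<lambda>x. f x * g x))" for i
    by (subst Ck_cong[OF assms]) auto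
  with Suc.prems show ?case by auto
qed (auto intro: continuous_intros)

lemma Ck_inverse:
  assumes "open S" "\<And>x. x \<in> S \<Longrightarrow> f x \<noteq> 0"
  shows "Ck n S f \<Longrightarrow> Ck n S (\<lambda>x. inverse (f x))"
proof (induction n)
  case (Suc n)
  have "Ck n S (\<lambda>x. (- 1) * (inverse (f x) * (inverse (f x) * pd i f x)))" for i
    using Suc Suc.prems[THEN Ck_Suc_imp] by (intro Ck_mult assms Suc.IH Ck_const) auto
  moreover have "(\<lambda>x. inverse (f x)) differentiable (at x)"
      "pd i (\<lambda>x. inverse (f x)) x = (- 1) * (inverse (f x) * (inverse (f x) * pd i f x))" if "x \<in> S" for i x
    using that Suc.prems assms
      pd_chain_rule_real[of f x inverse "- (inverse (f x) * inverse (f x))"]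
      DERIV_inverse[of "f x" UNIV]
    by (auto simp: differentiable_on_eq_differentiable_at[OF assms(1)] power2_eq_square)
  ultimately show ?case
    by (auto simp: differentiable_on_eq_differentiable_at[OF assms(1)])
       (subst Ck_cong[OF assms(1)], auto)
qed (use assms in \<open>auto intro!: continuous_intros\<close>)

lemma Ck_sqrt:
  assumes "open S" "\<And>x. x \<in> S \<Longrightarrow> f x > 0"
  shows "Ck n S f \<Longrightarrow> Ck n S (\<lambda>x. sqrt (f x))"
proof (induction n)
  case (Suc n)
  have "Ck n S (\<lambda>x. inverse (sqrt (f x)) * ((1/2) * pd i f x))" for i
    using Suc Suc.prems[THEN Ck_Suc_imp] assms
    by (intro Ck_mult Ck_inverse assms Suc.IH Ck_const) (auto simp: less_imp_neq[symmetric] dest!: assms(2))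
  moreover have d: "(\<lambda>x. sqrt (f x)) differentiable (at x)"
      "pd i (\<lambda>x. sqrt (f x)) x = inverse (sqrt (f x)) * ((1/2) * pd i f x)" if "x \<in> S" for i x
    using that Suc.prems
      pd_chain_rule_real[of f x sqrt "inverse (sqrt (f x)) / 2", OF _ DERIV_real_sqrt[OF assms(2)[OF that]]]
    by (auto simp: differentiable_on_eq_differentiable_at[OF assms(1)] power2_eq_square)
  ultimately have "Ck n S (pd i (\<lambda>x. sqrt (f x)))" for i
    using d(2) Ck_cong[OF assms(1), of "pd i (\<lambda>x. sqrt (f x))" "\<lambda>x. inverse (sqrt (f x)) * ((1/2) * pd i f x)" n] by simp
  with d(1) show ?case
    by (auto simp: differentiable_on_eq_differentiable_at[OF assms(1)])
qed (auto intro!: continuous_intros)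

lemma smooth_fun_on_pd: "smooth_fun_on S f \<Longrightarrow> smooth_fun_on S (pd i f)"
  unfolding smooth_fun_on_def by (metis fold_Cons comp_apply)

lemma smooth_fun_on_differentiable: "smooth_fun_on S f \<Longrightarrow> f differentiable_on S"
  unfolding smooth_fun_on_def using fold_simps(1) by metis

lemma smooth_iff_Ck: "smooth_fun_on S f \<longleftrightarrow> (\<forall>n. Ck n S f)"
proof
  assume "smooth_fun_on S f"
  then have "Ck n S f" for n
    by (induction n arbitrary: f)
       (auto simp: smooth_fun_on_pd smooth_fun_on_differentiable differentiable_imp_continuous_on)
  then show "\<forall>n. Ck n S f" ..
next
  assume f: "\<forall>n. Ck n S f"
  have "Ck (Suc (length is)) S f \<Longrightarrow> fold pd is f differentiable_on S" for "is"
    by (induction "is" arbitrary: f) auto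
  with f show "smooth_fun_on S f" unfolding smooth_fun_on_def by blast
qed

lemma smooth_differentiable_at:
  "smooth_fun_on S f \<Longrightarrow> open S \<Longrightarrow> x \<in> S \<Longrightarrow> f differentiable (at x)"
  using smooth_fun_on_differentiable differentiable_on_eq_differentiable_at by blast

lemma smooth_continuous_on: "smooth_fun_on S f \<Longrightarrow> continuous_on S f"
  using smooth_fun_on_differentiable differentiable_imp_continuous_on by blast

lemma smooth_const [simp]: "smooth_fun_on S (\<lambda>x. c)"
  by (simp add: smooth_iff_Ck)

lemma smooth_cong:
  "open S \<Longrightarrow> (\<And>x. x \<in> S \<Longrightarrow> f x = g x) \<Longrightarrow> smooth_fun_on S f \<longleftrightarrow> smooth_fun_on S g"
  unfolding smooth_iff_Ck using Ck_cong by metis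

lemma smooth_add: "open S \<Longrightarrow> smooth_fun_on S f \<Longrightarrow> smooth_fun_on S g \<Longrightarrow> smooth_fun_on S (\<lambda>x. f x + g x)"
  by (simp add: smooth_iff_Ck Ck_add)

lemma smooth_mult: "open S \<Longrightarrow> smooth_fun_on S f \<Longrightarrow> smooth_fun_on S g \<Longrightarrow> smooth_fun_on S (\<lambda>x. f x * g x)"
  by (simp add: smooth_iff_Ck Ck_mult)

lemma smooth_inverse:
  "open S \<Longrightarrow> smooth_fun_on S f \<Longrightarrow> (\<And>x. x \<in> S \<Longrightarrow> f x \<noteq> 0) \<Longrightarrow> smooth_fun_on S (\<lambda>x. inverse (f x))"
  by (simp add: smooth_iff_Ck Ck_inverse)

lemma smooth_sqrt:
  "open S \<Longrightarrow> smooth_fun_on S f \<Longrightarrow> (\<And>x. x \<in> S \<Longrightarrow> f x > 0) \<Longrightarrow> smooth_fun_on S (\<lambda>x. sqrt (f x))"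
  by (simp add: smooth_iff_Ck Ck_sqrt)

lemma smooth_diff:
  assumes "open S" "smooth_fun_on S f" "smooth_fun_on S g"
  shows "smooth_fun_on S (\<lambda>x. f x - g x)"
  using smooth_add[OF assms(1,2) smooth_mult[OF assms(1) smooth_const[of S "-1"] assms(3)]] by simp

lemma smooth_divide:
  assumes "open S" "smooth_fun_on S f" "smooth_fun_on S g" "\<And>x. x \<in> S \<Longrightarrow> g x \<noteq> 0"
  shows "smooth_fun_on S (\<lambda>x. f x / g x)"
  using smooth_mult[OF assms(1,2) smooth_inverse[OF assms(1,3,4)]] by (simp add: divide_inverse)

lemma smooth_sum:
  assumes "open S" "\<And>a. a \<in> A \<Longrightarrow> smooth_fun_on S (f a)"
  shows "smooth_fun_on S (\<lambda>x. \<Sum>a\<in>A. f a x)"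
  using assms(2) by (induction A rule: infinite_finite_induct) (auto intro!: smooth_add assms(1))

lemma smooth_prod:
  assumes "open S" "\<And>a. a \<in> A \<Longrightarrow> smooth_fun_on S (f a)"
  shows "smooth_fun_on S (\<lambda>x. \<Prod>a\<in>A. f a x)"
  using assms(2) by (induction A rule: infinite_finite_induct) (auto intro!: smooth_mult assms(1))

lemma smooth_det:
  assumes "open S" "\<And>i j. smooth_fun_on S (\<lambda>x. A x $ i $ j)"
  shows "smooth_fun_on S (\<lambda>x. det (A x :: real^'k::finite^'k))"
  unfolding det_def by (intro smooth_sum smooth_mult smooth_prod smooth_const assms)

text \<open>Schwarz: both mixed partial derivatives are limits of the same second difference
  quotient, by the mean value theorem in each of the two orders.\<close>

lemma second_difference_mean_value:
  fixes f :: "real^'n \<Rightarrow> real"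
  assumes S: "open S" "smooth_fun_on S f" and t: "t > 0"
    and box: "\<And>a b. a \<in> {0..t} \<Longrightarrow> b \<in> {0..t} \<Longrightarrow> x + a *\<^sub>R axis i 1 + b *\<^sub>R axis j 1 \<in> S"
  shows "\<exists>a\<in>{0..t}. \<exists>b\<in>{0..t}.
     f (x + t *\<^sub>R axis i 1 + t *\<^sub>R axis j 1) - f (x + t *\<^sub>R axis i 1) - f (x + t *\<^sub>R axis j 1) + f x
       = t * t * pd j (pd i f) (x + a *\<^sub>R axis i 1 + b *\<^sub>R axis j 1)"
proof -
  let ?p = "\<lambda>a b. x + a *\<^sub>R axis i (1::real) + b *\<^sub>R axis j (1::real)"
  define u where "u a = f (?p a t) - f (?p a 0)" for a
  have line1: "((\<lambda>a. g (?p a b)) has_real_derivative pd i g (?p a b)) (at a)"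
    if "g differentiable (at (?p a b))" for g a b
  proof -
    have "((\<lambda>a. ?p a b) has_derivative (\<lambda>h. h *\<^sub>R axis i 1)) (at a)"
      by (auto intro!: derivative_eq_intros)
    from has_derivative_compose[OF this differentiable_has_derivative[OF that]]
    show ?thesis
      using linear_cmul[OF linear_frechet_derivative[OF that]]
      by (simp add: has_field_derivative_def pd_def mult_commute_abs)
  qed
  have line2: "((\<lambda>b. g (?p a b)) has_real_derivative pd j g (?p a b)) (at b)"
    if "g differentiable (at (?p a b))" for g a b
  proof -
    have "((\<lambda>b. ?p a b) has_derivative (\<lambda>h. h *\<^sub>R axis j 1)) (at b)"
      by (auto intro!: derivative_eq_intros)
    from has_derivative_compose[OF this differentiable_has_derivative[OF that]]
    show ?thesis
      using linear_cmul[OF linear_frechet_derivative[OF that]]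
      by (simp add: has_field_derivative_def pd_def mult_commute_abs)
  qed
  have "\<exists>a. 0 < a \<and> a < t \<and> u t - u 0 = (t - 0) * (pd i f (?p a t) - pd i f (?p a 0))"
    unfolding u_def using t
    by (intro MVT2 DERIV_diff line1 smooth_differentiable_at[OF S(2,1)] box) auto
  then obtain a where a: "0 < a" "a < t" "u t - u 0 = t * (pd i f (?p a t) - pd i f (?p a 0))" by auto
  have "\<exists>b. 0 < b \<and> b < t \<and> pd i f (?p a t) - pd i f (?p a 0) = (t - 0) * pd j (pd i f) (?p a b)"
    using t a by (intro MVT2 line2 smooth_differentiable_at[OF smooth_fun_on_pd[OF S(2)] S(1)] box) auto
  then obtain b where b: "0 < b" "b < t" "pd i f (?p a t) - pd i f (?p a 0) = t * pd j (pd i f) (?p a b)" by auto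
  have "u t - u 0 = t * t * pd j (pd i f) (?p a b)" using a b by simp
  moreover have "u t - u 0 = f (?p t t) - f (x + t *\<^sub>R axis i 1) - f (x + t *\<^sub>R axis j 1) + f x"
    by (simp add: u_def)
  ultimately show ?thesis using a b by force
qed

lemma pd_commute:
  fixes f :: "real^'n \<Rightarrow> real"
  assumes S: "open S" "smooth_fun_on S f" "x \<in> S"
  shows "pd i (pd j f) x = pd j (pd i f) x"
proof -
  obtain e where e: "e > 0" "ball x e \<subseteq> S" using S openE by blast
  let ?p = "\<lambda>a b i j. x + a *\<^sub>R axis i (1::real) + b *\<^sub>R axis j (1::real)"
  have dp: "dist (?p a b i j) x \<le> 2 * t" if "a \<in> {0..t}" "b \<in> {0..t}" for a b t i j
  proof -
    have "norm (a *\<^sub>R axis i (1::real) + b *\<^sub>R axis j (1::real)) \<le> \<bar>a\<bar> + \<bar>b\<bar>"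
      by (rule order_trans[OF norm_triangle_ineq]) simp
    then show ?thesis using that by (simp add: dist_norm add.assoc)
  qed
  \<comment> \<open>The square with side \<open>t n\<close> stays in the ball, because its points have distance at most \<open>2 t n < e\<close> from \<open>x\<close>.\<close>
  define t where "t n = e / (4 * real (Suc n))" for n
  have t0: "t n > 0" for n using e by (simp add: t_def)
  have t2: "2 * t n < e" for n using e by (simp add: t_def field_simps)
      (smt (verit) mult_less_cancel_left1 of_nat_0_le_iff mult_nonneg_nonneg)
  have tl: "t \<longlonglongrightarrow> 0"
  proof -
    have "(\<lambda>n. (e/4) * inverse (real (Suc n))) \<longlonglongrightarrow> (e/4) * 0"
      by (intro tendsto_mult tendsto_const LIMSEQ_inverse_real_of_nat)
    then show ?thesis by (simp add: t_def[abs_def] field_simps)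
  qed
  have box: "?p a b i j \<in> S" if "a \<in> {0..t n}" "b \<in> {0..t n}" for a b n i j
    using dp[OF that, of i j] t2[of n] e(2) by (metis dist_commute le_less_trans mem_ball subsetD)
  \<comment> \<open>The second difference is symmetric in \<open>i\<close> and \<open>j\<close>, so both orders of differentiation are limits of it.\<close>
  define Q where "Q n = (f (x + t n *\<^sub>R axis i 1 + t n *\<^sub>R axis j 1) - f (x + t n *\<^sub>R axis i 1) - f (x + t n *\<^sub>R axis j 1) + f x) / (t n * t n)" for n
  have lim: "Q' \<longlonglongrightarrow> pd j (pd i f) x"
    if Q': "\<And>n. \<exists>a\<in>{0..t n}. \<exists>b\<in>{0..t n}. Q' n = pd j (pd i f) (?p a b i j)" for i j and Q' :: "nat \<Rightarrow> real"
  proof -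
    obtain a b where ab: "\<And>n. a n \<in> {0..t n}" "\<And>n. b n \<in> {0..t n}" "\<And>n. Q' n = pd j (pd i f) (?p (a n) (b n) i j)"
      using Q' by metis
    have "(\<lambda>n. ?p (a n) (b n) i j) \<longlonglongrightarrow> x"
    proof (rule Lim_null_comparison[THEN LIM_zero_cancel])
      show "\<forall>\<^sub>F n in sequentially. norm (?p (a n) (b n) i j - x) \<le> 2 * t n"
        using dp[OF ab(1,2)] by (simp add: dist_norm)
      show "(\<lambda>n. 2 * t n) \<longlonglongrightarrow> 0" using tendsto_mult[OF tendsto_const tl, of 2] by simp
    qed
    moreover have "isCont (pd j (pd i f)) x"
      using smooth_continuous_on[OF smooth_fun_on_pd[OF smooth_fun_on_pd[OF S(2)]]] S
      by (simp add: continuous_on_eq_continuous_at)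
    ultimately show ?thesis unfolding ab(3) by (rule isCont_tendsto_compose[rotated])
  qed
  have "Q \<longlonglongrightarrow> pd j (pd i f) x"
  proof (rule lim)
    fix n
    show "\<exists>a\<in>{0..t n}. \<exists>b\<in>{0..t n}. Q n = pd j (pd i f) (?p a b i j)"
      using second_difference_mean_value[OF S(1,2) t0[of n], of x i j, OF box] t0[of n]
      unfolding Q_def by (force simp: field_simps)
  qed
  moreover have "Q \<longlonglongrightarrow> pd i (pd j f) x"
  proof (rule lim)
    fix n
    show "\<exists>a\<in>{0..t n}. \<exists>b\<in>{0..t n}. Q n = pd i (pd j f) (?p a b j i)"
      using second_difference_mean_value[OF S(1,2) t0[of n], of x j i, OF box] t0[of n]
      unfolding Q_def by (force simp: field_simps)
  qed
  ultimately show ?thesis by (rule LIMSEQ_unique[symmetric])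
qed

section \<open>Change of variables for an arbitrary finite index type\<close>

text \<open>A finite index type need not be ordered, while the substitution theorem
  \<open>has_absolute_integral_change_of_variables\<close> asks for a well-ordered one. The copy \<open>'a wo\<close> of a
  finite type carries the order pulled back along an injection into the natural numbers. Renaming the
  coordinates along this copy changes neither Lebesgue measure nor determinants, so the theorem can be
  carried over.\<close>

typedef 'a wo = "UNIV :: 'a set" morphisms of_wo to_wo ..

lemmas of_to_wo [simp] = to_wo_inverse[OF UNIV_I]
lemmas to_of_wo [simp] = of_wo_inverse

definition wo_code :: "'a::finite \<Rightarrow> nat" where
  "wo_code = (SOME f. inj f)"

lemma inj_wo_code: "inj (wo_code :: 'a::finite \<Rightarrow> nat)"
proof -
  obtain f :: "'a \<Rightarrow> nat" where "inj f"
    using finite_imp_inj_to_nat_seg[of "UNIV :: 'a set"] by auto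
  then show ?thesis unfolding wo_code_def by (rule someI[where P=inj])
qed

instantiation wo :: (finite) wellorder
begin
definition "x \<le> y \<longleftrightarrow> wo_code (of_wo x) \<le> wo_code (of_wo y)"
definition "x < y \<longleftrightarrow> wo_code (of_wo x) < wo_code (of_wo y)"
instance
proof
  fix x y z :: "'a wo"
  show "x < y \<longleftrightarrow> x \<le> y \<and> \<not> y \<le> x" "x \<le> x" "x \<le> y \<Longrightarrow> y \<le> z \<Longrightarrow> x \<le> z" "x \<le> y \<or> y \<le> x"
    by (auto simp: less_eq_wo_def less_wo_def)
  show "x \<le> y \<Longrightarrow> y \<le> x \<Longrightarrow> x = y"
    by (auto simp: less_eq_wo_def of_wo_inject dest: injD[OF inj_wo_code])
next
  fix P :: "'a wo \<Rightarrow> bool" and a :: "'a wo"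
  assume *: "\<And>x. (\<And>y. y < x \<Longrightarrow> P y) \<Longrightarrow> P x"
  show "P a"
    by (induction "wo_code (of_wo a)" arbitrary: a rule: less_induct) (auto intro: * simp: less_wo_def)
qed
end

instance wo :: (finite) finite
proof
  have "x \<in> range to_wo" for x :: "'a wo" using to_of_wo[of x, symmetric] by (rule range_eqI)
  then have "(UNIV :: 'a wo set) \<subseteq> range to_wo" by blast
  then show "finite (UNIV :: 'a wo set)" by (rule finite_subset) simp
qed

lemma bij_of_wo: "bij of_wo"
  by (rule o_bij[of to_wo]) (auto simp: fun_eq_iff)

lemma bij_to_wo: "bij to_wo"
  by (rule o_bij[of of_wo]) (auto simp: fun_eq_iff)

lemma all_wo: "(\<forall>i. P i) \<longleftrightarrow> (\<forall>j. P (to_wo j))"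
  using to_of_wo by metis

definition vec_wo :: "'b^'n \<Rightarrow> 'b^'n wo" where "vec_wo x = (\<chi> i. x $ of_wo i)"
definition wo_vec :: "'b^'n wo \<Rightarrow> 'b^'n" where "wo_vec x = (\<chi> i. x $ to_wo i)"

lemma vec_wo_nth [simp]: "vec_wo x $ i = x $ of_wo i" by (simp add: vec_wo_def)
lemma wo_vec_nth [simp]: "wo_vec x $ i = x $ to_wo i" by (simp add: wo_vec_def)
lemma wo_vec_wo [simp]: "wo_vec (vec_wo x) = x" by (simp add: vec_eq_iff)
lemma vec_wo_vec [simp]: "vec_wo (wo_vec x) = x" by (simp add: vec_eq_iff)

lemma mem_vec_wo_image [simp]: "y \<in> vec_wo ` A \<longleftrightarrow> wo_vec y \<in> A"
proof
  assume "wo_vec y \<in> A"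
  then have "vec_wo (wo_vec y) \<in> vec_wo ` A" by (rule imageI)
  then show "y \<in> vec_wo ` A" by simp
qed auto

lemma vec_wo_inject [simp]: "vec_wo x = vec_wo y \<longleftrightarrow> x = y"
proof
  assume "vec_wo x = vec_wo y"
  then have "wo_vec (vec_wo x) = wo_vec (vec_wo y)" by simp
  then show "x = y" by simp
qed simp

lemma linear_vec_wo: "linear (vec_wo :: real^'n::finite \<Rightarrow> _)"
  by (auto intro!: linearI simp: vec_eq_iff)

lemma linear_wo_vec: "linear (wo_vec :: real^'n::finite wo \<Rightarrow> _)"
  by (auto intro!: linearI simp: vec_eq_iff)

lemma measurable_vec_wo [measurable]: "(vec_wo :: real^'n::finite \<Rightarrow> _) \<in> borel_measurable borel"
  using linear_continuous_on linear_vec_wo linear_conv_bounded_linear borel_measurable_continuous_onI by blast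

lemma measurable_wo_vec [measurable]: "(wo_vec :: real^'n::finite wo \<Rightarrow> _) \<in> borel_measurable borel"
  using linear_continuous_on linear_wo_vec linear_conv_bounded_linear borel_measurable_continuous_onI by blast

lemma Basis_vec_prod: "(\<Prod>b\<in>(Basis :: (real^'n::finite) set). f b) = (\<Prod>i\<in>UNIV. f (axis i 1))"
proof -
  have B: "(Basis :: (real^'n) set) = range (\<lambda>i. axis i 1)" by (auto simp: Basis_vec_def)
  have inj: "inj (\<lambda>i::'n. axis i (1::real))" by (auto simp: inj_def axis_eq_axis)
  show ?thesis unfolding B prod.reindex[OF inj] by (simp add: comp_def)
qed

lemma mem_box_vec: "x \<in> box l u \<longleftrightarrow> (\<forall>i. l $ i < x $ i \<and> x $ i < u $ i)" for x :: "real^'n::finite"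
  by (simp add: mem_box_cart)

lemma lborel_vec_wo: "distr lborel borel (vec_wo :: real^'n::finite \<Rightarrow> real^'n wo) = lborel"
proof (rule lborel_eqI[symmetric])
  fix l u :: "real^'n wo"
  assume lu: "\<And>b. b \<in> Basis \<Longrightarrow> l \<bullet> b \<le> u \<bullet> b"
  have le: "l $ i \<le> u $ i" for i
    using lu[of "axis i 1"] by (simp add: inner_axis)
  have le': "wo_vec l \<bullet> b \<le> wo_vec u \<bullet> b" if b: "b \<in> Basis" for b :: "real^'n"
    using b le by (auto simp: Basis_vec_def inner_axis)
  have "vec_wo -` box l u = box (wo_vec l) (wo_vec u :: real^'n)"
    unfolding set_eq_iff vimage_eq mem_box_vec by (subst all_wo) simp
  then have "emeasure (distr lborel borel (vec_wo :: real^'n \<Rightarrow> _)) (box l u) = (\<Prod>i\<in>UNIV. (u - l) $ to_wo i)"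
    using le' by (simp add: emeasure_distr emeasure_lborel_box Basis_vec_prod inner_axis)
  also have "\<dots> = (\<Prod>i\<in>UNIV. (u - l) $ i)"
    by (rule arg_cong[where f=ennreal], rule prod.reindex_bij_witness[of _ of_wo to_wo]) auto
  finally show "emeasure (distr lborel borel (vec_wo :: real^'n \<Rightarrow> _)) (box l u) = (\<Prod>b\<in>Basis. (u - l) \<bullet> b)"
    by (simp add: Basis_vec_prod inner_axis)
qed simp

text \<open>Conjugation with the renaming is a bijection of the permutations that preserves signs.\<close>

lemma det_wo:
  fixes A :: "real^'n::finite^'n"
  shows "det (vec_wo (\<chi> i. vec_wo (A $ i)) :: real^'n wo^'n wo) = det A"
proof -
  let ?o = "map_permutation UNIV of_wo :: ('n wo \<Rightarrow> 'n wo) \<Rightarrow> _"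
  let ?t = "map_permutation UNIV to_wo :: ('n \<Rightarrow> 'n) \<Rightarrow> _"
  have inj: "inj (of_wo :: 'n wo \<Rightarrow> 'n)" "inj (to_wo :: 'n \<Rightarrow> 'n wo)"
    using bij_of_wo bij_to_wo by (auto simp: bij_def)
  have o: "?o p (of_wo i) = of_wo (p i)" for p i
    using map_permutation_apply[OF inj(1)] by simp
  show ?thesis
    unfolding det_def
  proof (rule sum.reindex_bij_witness[of _ ?t ?o])
    fix p :: "'n wo \<Rightarrow> 'n wo" assume "p \<in> {p. p permutes UNIV}"
    then have p: "p permutes UNIV" by simp
    show "?t (?o p) = p"
      by (rule map_permutation_compose_inv[OF bij_of_wo p]) simp_all
    show "?o p \<in> {p. p permutes UNIV}"
      using map_permutation_permutes[OF bij_of_wo p] by simp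
    have "(\<Prod>i\<in>UNIV. A $ i $ ?o p i) = (\<Prod>i\<in>UNIV. A $ of_wo i $ of_wo (p i))"
      by (rule prod.reindex_bij_witness[of _ of_wo to_wo]) (auto simp flip: o)
    then show "of_int (sign (?o p)) * (\<Prod>i\<in>UNIV. A $ i $ ?o p i) =
         of_int (sign p) * (\<Prod>i\<in>UNIV. vec_wo (\<chi> i. vec_wo (A $ i)) $ i $ p i)"
      using sign_map_permutation[OF inj(1) p] by simp
  next
    fix p :: "'n \<Rightarrow> 'n" assume "p \<in> {p. p permutes UNIV}"
    then have p: "p permutes UNIV" by simp
    show "?o (?t p) = p"
      by (rule map_permutation_compose_inv[OF bij_to_wo p]) simp_all
    show "?t p \<in> {p. p permutes UNIV}"
      using map_permutation_permutes[OF bij_to_wo p] by simp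
  qed
qed

text \<open>The substitution theorem speaks of absolute Henstock-Kurzweil integrability, measures are described
  by Lebesgue integrals of nonnegative functions with values in the extended reals.\<close>

lemma nn_integral_eq_HK:
  fixes f :: "real^'n::finite \<Rightarrow> real"
  assumes "(\<lambda>x. indicator S x * f x) \<in> borel_measurable borel" "\<And>x. x \<in> S \<Longrightarrow> 0 \<le> f x"
  shows "(\<integral>\<^sup>+x\<in>S. ennreal (f x) \<partial>lborel) = (if f absolutely_integrable_on S then ennreal (integral S f) else \<infinity>)"
proof -
  let ?f = "\<lambda>x. indicator S x * f x"
  have nn: "(\<integral>\<^sup>+x\<in>S. ennreal (f x) \<partial>lborel) = (\<integral>\<^sup>+x. ennreal (?f x) \<partial>lborel)"
    by (intro nn_integral_cong) (auto simp: indicator_def)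
  have pos: "0 \<le> ?f x" for x using assms(2) by (auto simp: indicator_def)
  have ai: "f absolutely_integrable_on S \<longleftrightarrow> integrable lborel ?f"
    unfolding set_integrable_def using assms(1) by (simp add: integrable_completion)
  show ?thesis
  proof (cases "integrable lborel ?f")
    case True
    have "integral S f = (LINT x:S|lebesgue. f x)"
      using True ai by (intro set_lebesgue_integral_eq_integral(2)[symmetric]) auto
    also have "\<dots> = (LINT x|lborel. ?f x)"
      unfolding set_lebesgue_integral_def using assms(1) by (simp add: integral_completion)
    finally have "integral S f = (LINT x|lborel. ?f x)" .
    then show ?thesis
      unfolding nn using True ai nn_integral_eq_integral[OF True] pos by simp
  next
    case False
    then have "\<not> (\<integral>\<^sup>+x. ennreal (?f x) \<partial>lborel) < \<infinity>"
      using assms(1) pos by (simp add: integrable_iff_bounded)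
    then have "(\<integral>\<^sup>+x. ennreal (?f x) \<partial>lborel) = \<infinity>"
      by (metis infinity_ennreal_def less_top)
    then show ?thesis unfolding nn using False ai by simp
  qed
qed

lemma nn_integral_change_of_variables_wo:
  fixes g :: "real^'n::{finite,wellorder} \<Rightarrow> real^'n::_"
  assumes S: "S \<in> sets borel"
    and der: "\<And>x. x \<in> S \<Longrightarrow> (g has_derivative g' x) (at x within S)"
    and inj: "inj_on g S"
    and f: "(\<lambda>x. indicator (g ` S) x * f x) \<in> borel_measurable borel" "\<And>x. x \<in> g ` S \<Longrightarrow> 0 \<le> f x"
    and fg: "(\<lambda>x. indicator S x * (\<bar>det (matrix (g' x))\<bar> * f (g x))) \<in> borel_measurable borel"
  shows "(\<integral>\<^sup>+x\<in>g ` S. ennreal (f x) \<partial>lborel) = (\<integral>\<^sup>+x\<in>S. ennreal (\<bar>det (matrix (g' x))\<bar> * f (g x)) \<partial>lborel)"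
proof -
  let ?v = "\<lambda>x. vec (f x) :: real^1"
  have eq: "(\<lambda>x. \<bar>det (matrix (g' x))\<bar> * f (g x)) absolutely_integrable_on S \<and>
           integral S (\<lambda>x. \<bar>det (matrix (g' x))\<bar> * f (g x)) = b
     \<longleftrightarrow> f absolutely_integrable_on (g ` S) \<and> integral (g ` S) f = b" for b
    using has_absolute_integral_change_of_variables[OF _ der inj, of ?v "vec b"] S
    unfolding absolutely_integrable_on_1_iff integral_on_1_eq by (simp add: vec_eq_iff)
  have "integral S (\<lambda>x. \<bar>det (matrix (g' x))\<bar> * f (g x)) = integral (g ` S) f"
      if "f absolutely_integrable_on (g ` S)"
    using eq[of "integral (g ` S) f"] that by blast
  moreover have "(\<lambda>x. \<bar>det (matrix (g' x))\<bar> * f (g x)) absolutely_integrable_on S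
      \<longleftrightarrow> f absolutely_integrable_on (g ` S)"
    using eq by blast
  ultimately show ?thesis
    using nn_integral_eq_HK[OF f] nn_integral_eq_HK[OF fg] f(2) by auto
qed

lemma nn_integral_change_of_variables:
  fixes g :: "real^'n::finite \<Rightarrow> real^'n"
  assumes S: "S \<in> sets borel"
    and der: "\<And>x. x \<in> S \<Longrightarrow> (g has_derivative (\<lambda>v. J x *v v)) (at x)"
    and inj: "inj_on g S"
    and f: "(\<lambda>x. indicator (g ` S) x * f x) \<in> borel_measurable borel" "\<And>x. x \<in> g ` S \<Longrightarrow> 0 \<le> f x"
    and fg: "(\<lambda>x. indicator S x * (\<bar>det (J x)\<bar> * f (g x))) \<in> borel_measurable borel"
  shows "(\<integral>\<^sup>+x\<in>g ` S. ennreal (f x) \<partial>lborel) = (\<integral>\<^sup>+x\<in>S. ennreal (\<bar>det (J x)\<bar> * f (g x)) \<partial>lborel)"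
proof -
  let ?g = "\<lambda>y. vec_wo (g (wo_vec y)) :: real^'n wo"
  let ?S = "vec_wo ` S"
  let ?J = "\<lambda>x. vec_wo (\<chi> i. vec_wo (J x $ i)) :: real^'n wo^'n wo"
  have S_eq: "?S = wo_vec -` S \<inter> space borel"
    by auto
  have ind: "indicator (vec_wo ` A) y = (indicator A (wo_vec y) :: 'z::zero_neq_one)"
    for y :: "real^'n wo" and A
    by (simp add: indicator_def)
  have gS: "?g ` ?S = vec_wo ` g ` S" by (simp add: image_image)
  have shift: "(\<integral>\<^sup>+x\<in>A. F x \<partial>lborel) = (\<integral>\<^sup>+y\<in>vec_wo ` A. F (wo_vec y) \<partial>lborel)"
    if [measurable]: "(\<lambda>x. F x * indicator A x) \<in> borel_measurable borel" for F :: "real^'n \<Rightarrow> ennreal" and A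
  proof -
    have "(\<lambda>y. F (wo_vec y) * indicator (vec_wo ` A) y) = (\<lambda>x. F x * indicator A x) \<circ> wo_vec"
      by (simp add: fun_eq_iff ind)
    moreover have "\<dots> \<in> borel_measurable borel" by (intro measurable_comp[OF measurable_wo_vec that])
    ultimately show ?thesis
      by (subst lborel_vec_wo[symmetric], subst nn_integral_distr) (auto simp: ind)
  qed
  have mat: "?J x *v v = vec_wo (J x *v wo_vec v)" for x v
    unfolding vec_eq_iff matrix_vector_mult_def
    by (auto intro!: sum.reindex_bij_witness[of _ to_wo of_wo])
  have der': "(?g has_derivative (\<lambda>v. ?J (wo_vec y) *v v)) (at y within ?S)" if "y \<in> ?S" for y
  proof -
    have "wo_vec y \<in> S" using that by auto
    note d = der[OF this]
    have 1: "(wo_vec has_derivative wo_vec) (at y)" "(vec_wo has_derivative vec_wo) (at (g (wo_vec y)))"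
      using linear_imp_has_derivative[OF linear_wo_vec] linear_imp_has_derivative[OF linear_vec_wo] by auto
    show ?thesis
      unfolding mat using has_derivative_compose[OF has_derivative_compose[OF 1(1) d] 1(2)]
      by (rule has_derivative_at_withinI)
  qed
  have "(\<integral>\<^sup>+y\<in>?g ` ?S. ennreal (f (wo_vec y)) \<partial>lborel) =
    (\<integral>\<^sup>+y\<in>?S. ennreal (\<bar>det (matrix (\<lambda>v. ?J (wo_vec y) *v v))\<bar> * f (wo_vec (?g y))) \<partial>lborel)"
  proof (rule nn_integral_change_of_variables_wo[OF _ der'])
    show "?S \<in> sets borel" unfolding S_eq using measurable_sets[OF measurable_wo_vec S] by simp
    show "inj_on ?g ?S" using inj by (auto simp: inj_on_def)
    have "(\<lambda>y. indicator (?g ` ?S) y * f (wo_vec y)) = (\<lambda>x. indicator (g ` S) x * f x) \<circ> wo_vec"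
      unfolding gS by (simp add: fun_eq_iff ind)
    then show "(\<lambda>y. indicator (?g ` ?S) y * f (wo_vec y)) \<in> borel_measurable borel"
      using measurable_comp[OF measurable_wo_vec f(1)] by simp
    have "(\<lambda>y. indicator ?S y * (\<bar>det (matrix (\<lambda>v. ?J (wo_vec y) *v v))\<bar> * f (wo_vec (?g y)))) =
        (\<lambda>x. indicator S x * (\<bar>det (J x)\<bar> * f (g x))) \<circ> wo_vec"
      by (simp add: fun_eq_iff ind det_wo matrix_of_matrix_vector_mul)
    then show "(\<lambda>y. indicator ?S y * (\<bar>det (matrix (\<lambda>v. ?J (wo_vec y) *v v))\<bar> * f (wo_vec (?g y)))) \<in> borel_measurable borel"
      using measurable_comp[OF measurable_wo_vec fg] by simp
  qed (use f in auto)
  moreover have "(\<lambda>x. ennreal (f x) * indicator (g ` S) x) \<in> borel_measurable borel"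
  proof -
    have "(\<lambda>x. ennreal (f x) * indicator (g ` S) x) = (\<lambda>x. ennreal (indicator (g ` S) x * f x))"
      by (auto simp: indicator_def)
    then show ?thesis using f(1) by simp
  qed
  moreover have "(\<lambda>x. ennreal (\<bar>det (J x)\<bar> * f (g x)) * indicator S x) \<in> borel_measurable borel"
  proof -
    have "(\<lambda>x. ennreal (\<bar>det (J x)\<bar> * f (g x)) * indicator S x) = (\<lambda>x. ennreal (indicator S x * (\<bar>det (J x)\<bar> * f (g x))))"
      by (auto simp: indicator_def)
    then show ?thesis using fg by simp
  qed
  ultimately show ?thesis
    by (simp add: shift gS matrix_of_matrix_vector_mul det_wo)
qed

section \<open>Sums over multi-indices\<close>

lemma multi_idx_0 [simp]: "multi_idx 0 = {[]}"
  by (auto simp: multi_idx_def)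

lemma multi_idx_Suc: "multi_idx (Suc r) = (\<lambda>(i, I). i # I) ` (UNIV \<times> multi_idx r)"
  by (auto simp: multi_idx_def length_Suc_conv image_iff)

lemma finite_multi_idx [simp]: "finite (multi_idx r :: 'n::finite list set)"
  by (induction r) (auto simp: multi_idx_Suc)

lemma sum_multi_idx_Suc:
  "(\<Sum>I\<in>multi_idx (Suc r). f I) = (\<Sum>i\<in>UNIV. \<Sum>I\<in>multi_idx r. f (i # I))" for f :: "'n::finite list \<Rightarrow> real"
proof -
  have inj: "inj_on (\<lambda>(i, I). i # I) (UNIV \<times> (multi_idx r :: 'n list set))" by (auto simp: inj_on_def)
  show ?thesis
    unfolding multi_idx_Suc sum.reindex[OF inj] sum.cartesian_product
    by (intro sum.cong) auto
qed

lemma Cons_in_multi_idx [simp]: "i # I \<in> multi_idx (Suc r) \<longleftrightarrow> I \<in> multi_idx r"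
  by (auto simp: multi_idx_def)

lemma length_multi_idx: "I \<in> multi_idx r \<Longrightarrow> length I = r"
  by (simp add: multi_idx_def)

section \<open>Charts and the metric in coordinates\<close>

text \<open>The parts of the definition of a manifold, stated for one pair of charts.\<close>

lemma chart_properties:
  assumes "oriented_smooth_manifold M \<A>" "c \<in> \<A>" "d \<in> \<A>"
  shows "openin M (fst c)" "open (chart_range c)" "inj_on (snd c) (fst c)"
    "homeomorphic_map (subtopology M (fst c)) (top_of_set (chart_range c)) (snd c)"
    "fst c \<subseteq> topspace M"
    "\<And>i. smooth_fun_on (overlap c d) (\<lambda>x. transition c d x $ i)"
    "\<And>x. x \<in> overlap c d \<Longrightarrow> det (jacobian (transition c d) (at x)) > 0"
proof -
  show 1: "openin M (fst c)" and "open (chart_range c)"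
    and hm: "homeomorphic_map (subtopology M (fst c)) (top_of_set (chart_range c)) (snd c)"
    and "\<And>i. smooth_fun_on (overlap c d) (\<lambda>x. transition c d x $ i)"
    and "\<And>x. x \<in> overlap c d \<Longrightarrow> det (jacobian (transition c d) (at x)) > 0"
    using assms unfolding oriented_smooth_manifold_def by blast+
  show 2: "fst c \<subseteq> topspace M" using 1 openin_subset by blast
  show "inj_on (snd c) (fst c)" using homeomorphic_imp_injective_map[OF hm] 2 by (simp add: Int_absorb1)
qed

lemma chart_image_open:
  assumes "oriented_smooth_manifold M \<A>" "c \<in> \<A>" "openin M U"
  shows "open (snd c ` (U \<inter> fst c))"
proof -
  note ch = chart_properties[OF assms(1,2,2)]
  have "openin (subtopology M (fst c)) (U \<inter> fst c)"
    using assms(3) openin_subtopology by blast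
  then have "openin (top_of_set (chart_range c)) (snd c ` (U \<inter> fst c))"
    using homeomorphic_imp_open_map[OF ch(4)] open_map_def by blast
  then show ?thesis using ch(2) openin_open_trans by blast
qed

lemma chart_vimage_open:
  assumes "oriented_smooth_manifold M \<A>" "c \<in> \<A>" "open U"
  shows "openin M {p \<in> fst c. snd c p \<in> U}"
proof -
  note ch = chart_properties[OF assms(1,2,2)]
  have "openin (top_of_set (chart_range c)) (chart_range c \<inter> U)"
    using assms(3) by (metis openin_open_Int)
  then have "openin (subtopology M (fst c)) {p \<in> topspace (subtopology M (fst c)). snd c p \<in> chart_range c \<inter> U}"
    using homeomorphic_imp_continuous_map[OF ch(4)] unfolding continuous_map_def by blast
  moreover have "{p \<in> topspace (subtopology M (fst c)). snd c p \<in> chart_range c \<inter> U} = {p \<in> fst c. snd c p \<in> U}"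
    using ch(5) by auto
  ultimately show ?thesis using ch(1) openin_trans_full by metis
qed

lemma transition_apply:
  assumes "inj_on (snd c) (fst c)" "p \<in> fst c"
  shows "transition c d (snd c p) = snd d p"
  using assms by (simp add: transition_def)

lemma transition_has_derivative:
  assumes "oriented_smooth_manifold M \<A>" "c \<in> \<A>" "d \<in> \<A>" "x \<in> overlap c d"
  shows "(transition c d has_derivative (\<lambda>v. jacobian (transition c d) (at x) *v v)) (at x)"
    and "open (overlap c d)"
proof -
  note ch = chart_properties[OF assms(1,2,3)]
  show op: "open (overlap c d)"
    using chart_image_open[OF assms(1,2) chart_properties(1)[OF assms(1,3,3)]] by (simp add: Int_commute)
  have "transition c d differentiable (at x)"
    by (rule iffD2[OF differentiable_componentwise_within])
       (use smooth_differentiable_at[OF ch(6) op assms(4)] in \<open>auto simp: Basis_vec_def inner_axis\<close>)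
  then show "(transition c d has_derivative (\<lambda>v. jacobian (transition c d) (at x) *v v)) (at x)"
    by (simp add: jacobian_works)
qed

definition vol_weight :: "('m, 'n::finite) tensor_field \<Rightarrow> ('m, 'n) chart \<Rightarrow> real^'n \<Rightarrow> real" where
  "vol_weight h c x = sqrt (det (gram (h c x)))"

definition chart_measure :: "('m, 'n::finite) tensor_field \<Rightarrow> ('m, 'n) chart \<Rightarrow> (real^'n) measure" where
  "chart_measure h c = density lborel (\<lambda>x. ennreal (indicator (chart_range c) x * vol_weight h c x))"

lemma sum_multi_idx_2: "(\<Sum>I\<in>multi_idx 2. f I) = (\<Sum>i\<in>UNIV. \<Sum>j\<in>UNIV. f [i, j])" for f :: "'n::finite list \<Rightarrow> real"
  by (simp add: sum_multi_idx_Suc numeral_2_eq_2)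

lemma gram_transform:
  assumes "smooth_tensor_field \<A> 2 h" "c \<in> \<A>" "d \<in> \<A>" "x \<in> overlap c d"
  defines "J \<equiv> jacobian (transition c d) (at x)"
  shows "gram (h c x) = transpose J ** gram (h d (transition c d x)) ** J"
proof -
  have "h c x [i, j] = (\<Sum>a\<in>UNIV. \<Sum>b\<in>UNIV. J $ a $ i * J $ b $ j * h d (transition c d x) [a, b])" for i j
  proof -
    have "[i, j] \<in> multi_idx 2" by (simp add: multi_idx_def)
    then have "h c x [i, j] = (\<Sum>K\<in>multi_idx 2. (\<Prod>a<2. J $ (K ! a) $ ([i, j] ! a)) * h d (transition c d x) K)"
      using assms unfolding smooth_tensor_field_def by blast
    then show ?thesis unfolding sum_multi_idx_2 by (simp add: numeral_2_eq_2 lessThan_Suc mult_ac)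
  qed
  then show ?thesis
    by (simp add: gram_def vec_eq_iff matrix_matrix_mult_def transpose_def sum_distrib_right sum_distrib_left)
       (subst sum.swap, simp add: mult_ac)
qed

lemma gram_pos_def:
  assumes "riemannian_metric \<A> h" "c \<in> \<A>" "x \<in> chart_range c"
  shows "v \<noteq> 0 \<Longrightarrow> v \<bullet> (gram (h c x) *v v) > 0" "transpose (gram (h c x)) = gram (h c x)"
proof -
  show "v \<noteq> 0 \<Longrightarrow> v \<bullet> (gram (h c x) *v v) > 0" using assms unfolding riemannian_metric_def by blast
  have "symmetric_tensor 2 (h c x)" using assms unfolding riemannian_metric_def by blast
  then have "h c x [i, j] = h c x [j, i]" for i j
    unfolding symmetric_tensor_def multi_idx_def by (auto simp: add_mset_commute)
  then show "transpose (gram (h c x)) = gram (h c x)"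
    by (simp add: gram_def transpose_def vec_eq_iff)
qed

text \<open>Gram-Schmidt in the form of an extension argument: as long as an orthonormal family has fewer than
  \<open>n\<close> members, some nonzero vector is orthogonal to all of them.\<close>

lemma orthonormal_frame:
  fixes H :: "real^'n::finite^'n"
  assumes pos: "\<And>v. v \<noteq> 0 \<Longrightarrow> v \<bullet> (H *v v) > 0" and sym: "transpose H = H"
  obtains E :: "real^'n^'n" where "transpose E ** H ** E = mat 1"
proof -
  have sym': "u \<bullet> (H *v v) = v \<bullet> (H *v u)" for u v
    by (metis dot_lmul_matrix inner_commute sym transpose_matrix_vector)
  have "m \<le> CARD('n) \<Longrightarrow> \<exists>B. finite B \<and> card B = m \<and> (\<forall>u\<in>B. \<forall>v\<in>B. u \<bullet> (H *v v) = (if u = v then 1 else 0))" for m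
  proof (induction m)
    case 0
    then show ?case by (intro exI[of _ "{}"]) simp
  next
    case (Suc m)
    then obtain B where B: "finite B" "card B = m" "\<forall>u\<in>B. \<forall>v\<in>B. u \<bullet> (H *v v) = (if u = v then 1 else 0)" by auto
    \<comment> \<open>Orthogonality to \<open>u\<close> with respect to \<open>H\<close> is ordinary orthogonality to \<open>H u\<close>, so a dimension count applies.\<close>
    have "dim ((*v) H ` B) \<le> card ((*v) H ` B)" using B(1) by (simp add: dim_le_card')
    also have "\<dots> \<le> m" using card_image_le[OF B(1)] B(2) by metis
    also have "\<dots> < DIM(real^'n)" using Suc.prems by simp
    finally obtain x where x: "x \<noteq> 0" "\<And>y. y \<in> span ((*v) H ` B) \<Longrightarrow> orthogonal x y"
      using orthogonal_to_subspace_exists by metis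
    define y where "y = (1 / sqrt (x \<bullet> (H *v x))) *\<^sub>R x"
    have p: "x \<bullet> (H *v x) > 0" using pos x(1) by blast
    have yy: "y \<bullet> (H *v y) = 1" using p by (simp add: y_def matrix_vector_mult_scaleR)
    have yB: "y \<bullet> (H *v b) = 0" if "b \<in> B" for b
      using x(2)[of "H *v b"] that span_base[of "H *v b" "(*v) H ` B"] by (simp add: y_def orthogonal_def)
    have "y \<notin> B" using yy yB by force
    then show ?case using B yy yB sym'
      by (intro exI[of _ "insert y B"]) auto
  qed
  then obtain B where B: "finite B" "card B = CARD('n)" "\<forall>u\<in>B. \<forall>v\<in>B. u \<bullet> (H *v v) = (if u = v then 1 else 0)" by blast
  then obtain e where e: "bij_betw e (UNIV :: 'n set) B" by (metis finite finite_same_card_bij)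
  define E :: "real^'n^'n" where "E = (\<chi> i j. e j $ i)"
  have "(transpose E ** H ** E) $ i $ j = e i \<bullet> (H *v e j)" for i j
    by (simp add: matrix_matrix_mult_def transpose_def E_def inner_vec_def matrix_vector_mult_def
         sum_distrib_left sum_distrib_right mult_ac) (rule sum.swap)
  moreover have "e i \<bullet> (H *v e j) = (if i = j then 1 else 0)" for i j
    using B(3) e by (auto simp: bij_betw_def inj_on_def)
  ultimately have "transpose E ** H ** E = mat 1" by (simp add: vec_eq_iff mat_def)
  then show ?thesis by (rule that)
qed

text \<open>In an orthonormal frame \<open>E\<close> one has \<open>(det E)\<^sup>2 det H = 1\<close>.\<close>

lemma pos_def_det_pos:
  fixes H :: "real^'n::finite^'n"
  assumes pos: "\<And>v. v \<noteq> 0 \<Longrightarrow> v \<bullet> (H *v v) > 0" and sym: "transpose H = H"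
  shows "det H > 0"
proof -
  obtain E :: "real^'n^'n" where "transpose E ** H ** E = mat 1" using orthonormal_frame[OF assms] .
  then have "det (transpose E ** H ** E) = 1" by simp
  then have "det H * (det E)\<^sup>2 = 1" by (simp add: det_mul det_transpose power2_eq_square mult_ac)
  then show ?thesis by (metis mult_le_0_iff not_less not_one_le_zero zero_le_power2)
qed

lemma det_gram_pos:
  assumes "riemannian_metric \<A> h" "c \<in> \<A>" "x \<in> chart_range c"
  shows "det (gram (h c x)) > 0"
  using pos_def_det_pos gram_pos_def[OF assms] by blast

lemma vol_weight_pos:
  assumes "riemannian_metric \<A> h" "c \<in> \<A>" "x \<in> chart_range c"
  shows "vol_weight h c x > 0"
  using det_gram_pos[OF assms] by (simp add: vol_weight_def)

lemma gram_smooth: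
  assumes "riemannian_metric \<A> h" "c \<in> \<A>"
  shows "smooth_fun_on (chart_range c) (\<lambda>x. gram (h c x) $ i $ j)"
  using assms unfolding riemannian_metric_def smooth_tensor_field_def by (simp add: gram_def multi_idx_def)

lemma vol_weight_smooth:
  assumes "riemannian_metric \<A> h" "c \<in> \<A>" "open (chart_range c)"
  shows "smooth_fun_on (chart_range c) (vol_weight h c)"
  unfolding vol_weight_def[abs_def] using assms
  by (intro smooth_sqrt smooth_det gram_smooth[OF assms(1,2)] det_gram_pos[OF assms(1,2)])

lemma borel_measurable_extend:
  fixes f :: "real^'n::finite \<Rightarrow> real"
  assumes "open S" "continuous_on S f"
  shows "(\<lambda>x. indicator S x * f x) \<in> borel_measurable borel"
  using borel_measurable_continuous_on_indicator[OF _ assms(2)] assms(1) by auto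

lemma chart_weight_measurable [measurable]:
  assumes "riemannian_metric \<A> h" "c \<in> \<A>" "open (chart_range c)"
  shows "(\<lambda>x. indicator (chart_range c) x * vol_weight h c x) \<in> borel_measurable borel"
  by (intro borel_measurable_extend smooth_continuous_on vol_weight_smooth[OF assms] assms(3))

lemma emeasure_chart_measure:
  assumes "riemannian_metric \<A> h" "c \<in> \<A>" "open (chart_range c)" "T \<in> sets borel" "T \<subseteq> chart_range c"
  shows "emeasure (chart_measure h c) T = (\<integral>\<^sup>+x\<in>T. ennreal (vol_weight h c x) \<partial>lborel)"
proof -
  have "(\<lambda>x. ennreal (indicator (chart_range c) x * vol_weight h c x)) \<in> borel_measurable lborel"
    using chart_weight_measurable[OF assms(1-3)] by simp
  then show ?thesis unfolding chart_measure_def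
    using assms(4,5) by (subst emeasure_density) (auto intro!: nn_integral_cong simp: indicator_def)
qed

text \<open>The Gram matrix transforms by congruence with the Jacobian matrix, so its determinant picks up the
  square of the Jacobian determinant.\<close>

lemma vol_weight_transform:
  assumes mf: "oriented_smooth_manifold M \<A>" and h: "riemannian_metric \<A> h" and cd: "c \<in> \<A>" "d \<in> \<A>"
    and x: "x \<in> overlap c d"
  shows "vol_weight h c x = \<bar>det (jacobian (transition c d) (at x))\<bar> * vol_weight h d (transition c d x)"
proof -
  have "smooth_tensor_field \<A> 2 h" using h unfolding riemannian_metric_def by blast
  from gram_transform[OF this cd x] show ?thesis
    by (simp add: vol_weight_def det_mul det_transpose real_sqrt_mult)
qed

section \<open>The Riemannian volume measure\<close>

abbreviation "borel_of_top M \<equiv> sigma_sets (topspace M) {U. openin M U}"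

lemma borel_of_top_subset: "B \<in> borel_of_top M \<Longrightarrow> B \<subseteq> topspace M"
  by (rule sigma_sets_into_sp[of "{U. openin M U}"]) (auto dest: openin_subset)

lemma borel_of_top_Int: "A \<in> borel_of_top M \<Longrightarrow> B \<in> borel_of_top M \<Longrightarrow> A \<inter> B \<in> borel_of_top M"
  and borel_of_top_Diff: "A \<in> borel_of_top M \<Longrightarrow> B \<in> borel_of_top M \<Longrightarrow> A - B \<in> borel_of_top M"
  and borel_of_top_open: "openin M U \<Longrightarrow> U \<in> borel_of_top M"
proof -
  interpret sigma_algebra "topspace M" "borel_of_top M"
    by (rule sigma_algebra_sigma_sets) (auto dest: openin_subset)
  show "A \<in> borel_of_top M \<Longrightarrow> B \<in> borel_of_top M \<Longrightarrow> A \<inter> B \<in> borel_of_top M"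
    "A \<in> borel_of_top M \<Longrightarrow> B \<in> borel_of_top M \<Longrightarrow> A - B \<in> borel_of_top M" by auto
  show "openin M U \<Longrightarrow> U \<in> borel_of_top M" by (simp add: sigma_sets.Basic)
qed

lemma chart_image_borel:
  assumes mf: "oriented_smooth_manifold M \<A>" and c: "c \<in> \<A>" and B: "B \<in> borel_of_top M"
  shows "snd c ` (B \<inter> fst c) \<in> sets borel"
  using B
proof (induction rule: sigma_sets.induct)
  case (Basic U)
  then show ?case using chart_image_open[OF mf c] by simp
next
  case (Compl B)
  note ch = chart_properties[OF mf c c]
  have "snd c ` ((topspace M - B) \<inter> fst c) = chart_range c - snd c ` (B \<inter> fst c)"
    using ch(3,5) by (auto simp: inj_on_def)
  then show ?case using Compl ch(2) by simp
next
  case (Union B)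
  have "snd c ` ((\<Union>i. B i) \<inter> fst c) = (\<Union>i. snd c ` (B i \<inter> fst c))" by auto
  then show ?case using Union by (simp add: sets.countable_UN)
qed simp

lemma chart_vimage_borel:
  assumes mf: "oriented_smooth_manifold M \<A>" and c: "c \<in> \<A>" and B: "B \<in> sets borel"
  shows "{p \<in> fst c. snd c p \<in> B} \<in> borel_of_top M"
proof -
  note ch = chart_properties[OF mf c c]
  have "B \<in> sigma_sets UNIV {U. open U}" using B by (simp add: borel_def)
  then show ?thesis
  proof (induction rule: sigma_sets.induct)
    case (Basic U)
    then show ?case using chart_vimage_open[OF mf c] by (simp add: borel_of_top_open)
  next
    case (Compl B)
    have eq: "{p \<in> fst c. snd c p \<in> UNIV - B} = fst c - {p \<in> fst c. snd c p \<in> B}" by auto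
    show ?case unfolding eq by (rule borel_of_top_Diff[OF borel_of_top_open[OF ch(1)] Compl.IH])
  next
    case (Union B)
    have "{p \<in> fst c. snd c p \<in> (\<Union>i. B i)} = (\<Union>i. {p \<in> fst c. snd c p \<in> B i})" by auto
    then show ?case using Union by (simp add: sigma_sets.Union)
  qed (simp add: sigma_sets.Empty)
qed

text \<open>The factor by which the densities differ is exactly the Jacobian factor of the substitution rule.\<close>

lemma chart_measure_overlap:
  assumes mf: "oriented_smooth_manifold M \<A>" and h: "riemannian_metric \<A> h" and cd: "c \<in> \<A>" "d \<in> \<A>"
    and B: "B \<in> borel_of_top M" "B \<subseteq> fst c \<inter> fst d"
  shows "emeasure (chart_measure h c) (snd c ` B) = emeasure (chart_measure h d) (snd d ` B)"
proof -
  note chc = chart_properties[OF mf cd] and chd = chart_properties[OF mf cd(2,1)]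
  let ?g = "transition c d" and ?J = "\<lambda>x. jacobian (transition c d) (at x)"
  have im: "?g ` snd c ` B = snd d ` B"
    unfolding image_image by (intro image_cong refl transition_apply[OF chc(3)]) (use B in auto)
  have Bc: "snd c ` B \<in> sets borel" "snd d ` B \<in> sets borel"
    using chart_image_borel[OF mf cd(1) B(1)] chart_image_borel[OF mf cd(2) B(1)] B(2)
    using B(2) by (simp_all add: Int_absorb2)
  have sub: "snd c ` B \<subseteq> overlap c d" "snd c ` B \<subseteq> chart_range c" "snd d ` B \<subseteq> chart_range d" using B(2) by auto
  have w: "vol_weight h c x = \<bar>det (?J x)\<bar> * vol_weight h d (?g x)" if "x \<in> snd c ` B" for x
    using vol_weight_transform[OF mf h cd] that sub(1) by blast
  have mc: "(\<lambda>x. indicator (snd c ` B) x * vol_weight h c x) \<in> borel_measurable borel"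
  proof -
    have "(\<lambda>x. indicator (snd c ` B) x * (indicator (chart_range c) x * vol_weight h c x)) \<in> borel_measurable borel"
      using chart_weight_measurable[OF h cd(1) chc(2)] Bc by measurable
    moreover have "indicator (snd c ` B) x * (indicator (chart_range c) x * vol_weight h c x) = indicator (snd c ` B) x * vol_weight h c x" for x
      using sub(2) by (auto simp: indicator_def)
    ultimately show ?thesis by simp
  qed
  have md: "(\<lambda>x. indicator (snd d ` B) x * vol_weight h d x) \<in> borel_measurable borel"
  proof -
    have "(\<lambda>x. indicator (snd d ` B) x * (indicator (chart_range d) x * vol_weight h d x)) \<in> borel_measurable borel"
      using chart_weight_measurable[OF h cd(2) chd(2)] Bc by measurable
    moreover have "indicator (snd d ` B) x * (indicator (chart_range d) x * vol_weight h d x) = indicator (snd d ` B) x * vol_weight h d x" for x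
      using sub(3) by (auto simp: indicator_def)
    ultimately show ?thesis by simp
  qed
  have "(\<integral>\<^sup>+x\<in>?g ` snd c ` B. ennreal (vol_weight h d x) \<partial>lborel) =
      (\<integral>\<^sup>+x\<in>snd c ` B. ennreal (\<bar>det (?J x)\<bar> * vol_weight h d (?g x)) \<partial>lborel)"
  proof (rule nn_integral_change_of_variables)
    show "(?g has_derivative (\<lambda>v. ?J x *v v)) (at x)" if "x \<in> snd c ` B" for x
      using transition_has_derivative(1)[OF mf cd] that sub by blast
    show "inj_on ?g (snd c ` B)"
    proof (rule inj_onI)
      fix x y assume "x \<in> snd c ` B" "y \<in> snd c ` B" and eq: "?g x = ?g y"
      then obtain p q where pq: "p \<in> B" "q \<in> B" "x = snd c p" "y = snd c q" by blast
      then have "p \<in> fst c" "q \<in> fst c" "p \<in> fst d" "q \<in> fst d" using B(2) by auto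
      moreover from this have "snd d p = snd d q" using eq pq transition_apply[OF chc(3)] by simp
      ultimately show "x = y" using chd(3) pq by (auto dest: inj_onD)
    qed
    show "(\<lambda>x. indicator (snd c ` B) x * (\<bar>det (?J x)\<bar> * vol_weight h d (?g x))) \<in> borel_measurable borel"
      using mc w by (subst measurable_cong[where g="\<lambda>x. indicator (snd c ` B) x * vol_weight h c x"]) (auto simp: indicator_def)
    show "0 \<le> vol_weight h d x" if "x \<in> ?g ` snd c ` B" for x
      using vol_weight_pos[OF h cd(2), of x] that sub(3) im by auto
  qed (use Bc md im in simp_all)
  also have "\<dots> = (\<integral>\<^sup>+x\<in>snd c ` B. ennreal (vol_weight h c x) \<partial>lborel)"
    by (intro nn_integral_cong) (auto simp: indicator_def w)
  finally show ?thesis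
    using emeasure_chart_measure[OF h cd(1) chc(2) Bc(1) sub(2)] emeasure_chart_measure[OF h cd(2) chd(2) Bc(2) sub(3)] im
    by simp
qed

lemma finite_chart_cover:
  assumes "oriented_smooth_manifold M \<A>" "compact_space M"
  obtains C :: "nat \<Rightarrow> ('m, 'n::finite) chart" and m where "\<And>i. i < m \<Longrightarrow> C i \<in> \<A>" "topspace M = (\<Union>i<m. fst (C i))"
proof -
  have "\<forall>U\<in>fst ` \<A>. openin M U" "topspace M \<subseteq> \<Union>(fst ` \<A>)"
    using assms(1) unfolding oriented_smooth_manifold_def by auto
  then have "\<exists>\<F>. finite \<F> \<and> \<F> \<subseteq> fst ` \<A> \<and> topspace M \<subseteq> \<Union>\<F>"
    using spec[OF conjunct2[OF assms(2)[unfolded compact_space_def compactin_def]], of "fst ` \<A>"] by auto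
  then obtain \<F> where \<F>: "finite \<F>" "\<F> \<subseteq> fst ` \<A>" "topspace M \<subseteq> \<Union>\<F>" by auto
  then obtain A where A: "finite A" "A \<subseteq> \<A>" "\<F> = fst ` A" by (metis finite_subset_image)
  obtain C m where C: "A = C ` {i. i < (m::nat)}"
    using finite_imp_nat_seg_image_inj_on[OF A(1)] by blast
  show ?thesis
  proof (rule that)
    show "\<And>i. i < m \<Longrightarrow> C i \<in> \<A>" using C A by auto
    show "topspace M = (\<Union>i<m. fst (C i))"
    proof
      show "topspace M \<subseteq> (\<Union>i<m. fst (C i))" using \<F>(3) A(3) C by auto
      show "(\<Union>i<m. fst (C i)) \<subseteq> topspace M"
        using C A(2) chart_properties(5)[OF assms(1)] by blast
    qed
  qed
qed

text \<open>The property that defines the volume measure, with the density in each chart packed into a measure.\<close>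

definition is_volume :: "'m topology \<Rightarrow> ('m, 'n::finite) chart set \<Rightarrow> ('m, 'n) tensor_field \<Rightarrow> 'm measure \<Rightarrow> bool" where
  "is_volume M \<A> h \<mu> \<longleftrightarrow> space \<mu> = topspace M \<and> sets \<mu> = borel_of_top M \<and>
     (\<forall>c\<in>\<A>. \<forall>B\<in>sets \<mu>. B \<subseteq> fst c \<longrightarrow> emeasure \<mu> B = emeasure (chart_measure h c) (snd c ` B))"

lemma is_volume_iff:
  assumes mf: "oriented_smooth_manifold M \<A>" and h: "riemannian_metric \<A> h"
  shows "is_volume M \<A> h \<mu> \<longleftrightarrow> space \<mu> = topspace M \<and> sets \<mu> = borel_of_top M \<and>
     (\<forall>c\<in>\<A>. \<forall>B\<in>sets \<mu>. B \<subseteq> fst c \<longrightarrow>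
        emeasure \<mu> B = (\<integral>\<^sup>+x\<in>snd c ` B. ennreal (sqrt (det (gram (h c x)))) \<partial>lborel))"
proof -
  have "emeasure (chart_measure h c) (snd c ` B) = (\<integral>\<^sup>+x\<in>snd c ` B. ennreal (sqrt (det (gram (h c x)))) \<partial>lborel)"
    if "c \<in> \<A>" "B \<in> borel_of_top M" "B \<subseteq> fst c" for c B
  proof -
    have "snd c ` B \<in> sets borel" using chart_image_borel[OF mf that(1,2)] that(3) by (simp add: Int_absorb2)
    then show ?thesis
      using emeasure_chart_measure[OF h that(1) chart_properties(2)[OF mf that(1,1)], of "snd c ` B"] that(3)
      by (simp add: vol_weight_def image_mono)
  qed
  then show ?thesis unfolding is_volume_def by (metis (no_types, lifting))
qed

lemma chart_measure_sums:
  assumes mf: "oriented_smooth_manifold M \<A>" and c: "c \<in> \<A>"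
    and B: "range B \<subseteq> borel_of_top M" "disjoint_family B" "\<And>i. B i \<subseteq> fst c"
  shows "(\<Sum>i. emeasure (chart_measure h c) (snd c ` B i)) = emeasure (chart_measure h c) (snd c ` (\<Union>i. B i))"
proof -
  note ch = chart_properties[OF mf c c]
  have "snd c ` B i \<in> sets borel" for i
    using chart_image_borel[OF mf c, of "B i"] B by (auto simp: Int_absorb2)
  moreover have "disjoint_family (\<lambda>i. snd c ` B i)"
    using B(2,3) ch(3) unfolding disjoint_family_on_def
    by (metis image_empty inj_on_image_Int)
  ultimately show ?thesis
    unfolding image_UN by (intro suminf_emeasure) (auto simp: chart_measure_def)
qed

text \<open>A finite atlas is cut into the disjoint pieces \<open>D i\<close>, and the measure of a set is the sum of the
  measures of its parts in these pieces, each taken in the chart of the piece. A set inside an arbitrary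
  chart \<open>d\<close> has the right measure because each part can be measured in \<open>d\<close> just as well. Uniqueness
  holds because the parts in the pieces determine a measure.\<close>

lemma is_volume_exists_unique:
  fixes h :: "('m, 'n::finite) tensor_field"
  assumes mf: "oriented_smooth_manifold M \<A>" and h: "riemannian_metric \<A> h" and cpt: "compact_space M"
  shows "\<exists>!\<mu>. is_volume M \<A> h \<mu>"
proof -
  obtain C :: "nat \<Rightarrow> ('m, 'n) chart" and m
    where C: "\<And>i. i < m \<Longrightarrow> C i \<in> \<A>" "topspace M = (\<Union>i<m. fst (C i))"
    by (rule finite_chart_cover[OF mf cpt]) (rule that)
  interpret sa: sigma_algebra "topspace M" "borel_of_top M"
    by (rule sigma_algebra_sigma_sets) (auto dest: openin_subset)
  \<comment> \<open>Each point is assigned to the first chart that contains it.\<close>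
  define D where "D i = fst (C i) - (\<Union>j<i. fst (C j))" for i
  have Dm: "D i \<in> borel_of_top M" if "i < m" for i
  proof -
    have op: "openin M (fst (C j))" if "j < m" for j
      using chart_properties(1)[OF mf C(1)[OF that] C(1)[OF that]] .
    have "openin M (\<Union>j<i. fst (C j))" using op \<open>i < m\<close> by (intro openin_Union) auto
    then show ?thesis unfolding D_def using op[OF \<open>i < m\<close>] by (intro borel_of_top_Diff borel_of_top_open)
  qed
  have Dsub: "D i \<subseteq> fst (C i)" for i by (auto simp: D_def)
  have Ddisj: "D i \<inter> D j = {}" if "i \<noteq> j" for i j
    using that by (cases "i < j") (auto simp: D_def)
  have Dcover: "topspace M = (\<Union>i<m. D i)"
  proof
    show "topspace M \<subseteq> (\<Union>i<m. D i)"
    proof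
      fix p assume "p \<in> topspace M"
      then obtain i where i: "i < m" "p \<in> fst (C i)" using C(2) by auto
      define k where "k = (LEAST i. p \<in> fst (C i))"
      have "p \<in> fst (C k)" "k \<le> i" "\<And>j. j < k \<Longrightarrow> p \<notin> fst (C j)"
        unfolding k_def using i(2) by (auto intro: LeastI Least_le dest: not_less_Least)
      then show "p \<in> (\<Union>i<m. D i)" using i(1) by (auto simp: D_def)
    qed
  qed (use C(2) Dsub in blast)
  have split: "B = (\<Union>i<m. B \<inter> D i)" if "B \<in> borel_of_top M" for B
    using borel_of_top_subset[OF that] Dcover by blast
  define V where "V B = (\<Sum>i<m. emeasure (chart_measure h (C i)) (snd (C i) ` (B \<inter> D i)))" for B
  define \<mu> where "\<mu> = measure_of (topspace M) (borel_of_top M) V"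
  have "countably_additive (borel_of_top M) V"
    unfolding countably_additive_def
  proof (intro allI impI)
    fix B :: "nat \<Rightarrow> _" assume B: "range B \<subseteq> borel_of_top M" "disjoint_family B"
    have "(\<Sum>n. V (B n)) = (\<Sum>i<m. \<Sum>n. emeasure (chart_measure h (C i)) (snd (C i) ` (B n \<inter> D i)))"
      unfolding V_def by (rule suminf_sum) simp
    also have "\<dots> = (\<Sum>i<m. emeasure (chart_measure h (C i)) (snd (C i) ` (\<Union>n. B n \<inter> D i)))"
    proof (intro sum.cong refl chart_measure_sums[OF mf])
      fix i assume i: "i \<in> {..<m}"
      show "C i \<in> \<A>" using i C by simp
      show "range (\<lambda>n. B n \<inter> D i) \<subseteq> borel_of_top M" using B(1) Dm i by (auto intro!: borel_of_top_Int)
      show "disjoint_family (\<lambda>n. B n \<inter> D i)" using B(2) by (auto simp: disjoint_family_on_def)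
      show "B n \<inter> D i \<subseteq> fst (C i)" for n using Dsub by blast
    qed
    also have "\<dots> = V (\<Union>n. B n)" by (simp add: V_def Int_UN_distrib2)
    finally show "(\<Sum>n. V (B n)) = V (\<Union>n. B n)" .
  qed
  moreover have "positive (borel_of_top M) V" by (simp add: positive_def V_def)
  ultimately have em: "emeasure \<mu> B = V B" if "B \<in> borel_of_top M" for B
    unfolding \<mu>_def using that by (intro emeasure_measure_of_sigma) (auto intro: sa.sigma_algebra_axioms)
  have sets: "sets \<mu> = borel_of_top M" "space \<mu> = topspace M"
    unfolding \<mu>_def using borel_of_top_subset by (auto simp: sigma_sets_sigma_sets_eq subset_eq dest: openin_subset)
  have "is_volume M \<A> h \<mu>"
    unfolding is_volume_def sets
  proof (intro conjI ballI impI refl)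
    fix d B assume d: "d \<in> \<A>" and B: "B \<in> borel_of_top M" "B \<subseteq> fst d"
    have "emeasure \<mu> B = (\<Sum>i<m. emeasure (chart_measure h d) (snd d ` (B \<inter> D i)))"
      unfolding em[OF B(1)] V_def
      by (intro sum.cong refl chart_measure_overlap[OF mf h]) (use C(1) d B Dm Dsub[THEN subsetD] in \<open>auto intro: borel_of_top_Int\<close>)
    also have "\<dots> = emeasure (chart_measure h d) (\<Union>i<m. snd d ` (B \<inter> D i))"
    proof (rule sum_emeasure)
      show "(\<lambda>i. snd d ` (B \<inter> D i)) ` {..<m} \<subseteq> sets (chart_measure h d)"
      proof
        fix T assume "T \<in> (\<lambda>i. snd d ` (B \<inter> D i)) ` {..<m}"
        then obtain i where i: "i < m" "T = snd d ` (B \<inter> D i)" by auto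
        then show "T \<in> sets (chart_measure h d)"
          using chart_image_borel[OF mf d borel_of_top_Int[OF B(1) Dm[OF i(1)]]] B(2)
          by (simp add: chart_measure_def Int_absorb2 le_infI1)
      qed
      show "disjoint_family_on (\<lambda>i. snd d ` (B \<inter> D i)) {..<m}"
      proof -
        have "inj_on (snd d) B" using chart_properties(3)[OF mf d d] B(2) inj_on_subset by blast
        then have "snd d ` (B \<inter> D i) \<inter> snd d ` (B \<inter> D j) = snd d ` ((B \<inter> D i) \<inter> (B \<inter> D j))" for i j
          by (intro inj_on_image_Int[symmetric]) auto
        moreover have "(B \<inter> D i) \<inter> (B \<inter> D j) = {}" if "i \<noteq> j" for i j using Ddisj[OF that] by blast
        ultimately show ?thesis by (auto simp: disjoint_family_on_def)
      qed
    qed simp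
    also have "(\<Union>i<m. snd d ` (B \<inter> D i)) = snd d ` B" using split[OF B(1)] by blast
    finally show "emeasure \<mu> B = emeasure (chart_measure h d) (snd d ` B)" .
  qed
  moreover have "\<nu> = \<mu>" if \<nu>: "is_volume M \<A> h \<nu>" for \<nu>
  proof (rule measure_eqI)
    show s: "sets \<nu> = sets \<mu>" using \<nu> sets by (simp add: is_volume_def)
    fix B assume "B \<in> sets \<nu>"
    then have B: "B \<in> borel_of_top M" using s sets by simp
    have "emeasure \<nu> (\<Union>i<m. B \<inter> D i) = (\<Sum>i<m. emeasure \<nu> (B \<inter> D i))"
    proof (rule sum_emeasure[symmetric])
      show "(\<lambda>i. B \<inter> D i) ` {..<m} \<subseteq> sets \<nu>" using s sets B Dm by (auto intro: borel_of_top_Int)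
      show "disjoint_family_on (\<lambda>i. B \<inter> D i) {..<m}"
        unfolding disjoint_family_on_def using Ddisj by blast
    qed simp
    also have "\<dots> = V B"
      unfolding V_def
    proof (intro sum.cong refl)
      fix i assume i: "i \<in> {..<m}"
      have "B \<inter> D i \<in> sets \<nu>" "B \<inter> D i \<subseteq> fst (C i)" using i B Dm s sets Dsub[THEN subsetD] by (auto intro: borel_of_top_Int)
      then show "emeasure \<nu> (B \<inter> D i) = emeasure (chart_measure h (C i)) (snd (C i) ` (B \<inter> D i))"
        using \<nu> C(1) i unfolding is_volume_def by simp
    qed
    finally show "emeasure \<nu> B = emeasure \<mu> B" using em[OF B] split[OF B] by simp
  qed
  ultimately show ?thesis by blast
qed

lemma is_volume_riemannian_volume:
  assumes mf: "oriented_smooth_manifold M \<A>" and h: "riemannian_metric \<A> h" and cpt: "compact_space M"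
  shows "is_volume M \<A> h (riemannian_volume M \<A> h)"
proof -
  have "riemannian_volume M \<A> h = (THE \<mu>. is_volume M \<A> h \<mu>)"
    unfolding riemannian_volume_def is_volume_iff[OF mf h] ..
  then show ?thesis using theI'[OF is_volume_exists_unique[OF assms]] by simp
qed

text \<open>Extension by zero of a function of the coordinates. It inherits the regularity of \<open>f\<close> when \<open>f\<close> has
  compact support in the range of the chart.\<close>

definition chart_fun :: "('m, 'n) chart \<Rightarrow> (real^'n \<Rightarrow> real) \<Rightarrow> 'm \<Rightarrow> real" where
  "chart_fun c f p = (if p \<in> fst c then f (snd c p) else 0)"

lemma integral_chart_fun:
  fixes h :: "('m, 'n::finite) tensor_field"
  assumes mf: "oriented_smooth_manifold M \<A>" and h: "riemannian_metric \<A> h" and cpt: "compact_space M"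
    and c: "c \<in> \<A>" and f: "f \<in> borel_measurable borel"
    and fi: "integrable lborel (\<lambda>x. indicator (chart_range c) x * (vol_weight h c x * f x))"
  shows "integrable (riemannian_volume M \<A> h) (chart_fun c f)"
    and "(LINT p|riemannian_volume M \<A> h. chart_fun c f p) =
      (LINT x|lborel. indicator (chart_range c) x * (vol_weight h c x * f x))"
proof -
  let ?V = "riemannian_volume M \<A> h"
  note ch = chart_properties[OF mf c c]
  have V: "space ?V = topspace M" "sets ?V = borel_of_top M"
    "\<And>B. B \<in> borel_of_top M \<Longrightarrow> B \<subseteq> fst c \<Longrightarrow> emeasure ?V B = emeasure (chart_measure h c) (snd c ` B)"
    using is_volume_riemannian_volume[OF mf h cpt] c unfolding is_volume_def by auto
  let ?R = "restrict_space ?V (fst c)"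
  have fc: "fst c \<in> sets ?V" using V(2) borel_of_top_open[OF ch(1)] by simp
  then have fc': "fst c \<inter> space ?V \<in> sets ?V" by simp
  have meas: "snd c \<in> ?R \<rightarrow>\<^sub>M borel"
  proof (rule measurableI)
    fix T :: "(real^'n) set" assume "T \<in> sets borel"
    then have "{p \<in> fst c. snd c p \<in> T} \<in> sets ?V" using chart_vimage_borel[OF mf c] V(2) by simp
    moreover have "snd c -` T \<inter> space ?R = {p \<in> fst c. snd c p \<in> T}"
      using V(1) ch(5) by (auto simp: space_restrict_space)
    ultimately show "snd c -` T \<inter> space ?R \<in> sets ?R"
      using fc' by (auto simp: sets_restrict_space_iff)
  qed simp
  \<comment> \<open>The chart carries the restricted volume measure to its measure in coordinates.\<close>
  have distr: "distr ?R borel (snd c) = chart_measure h c"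
  proof (rule measure_eqI)
    fix T assume "T \<in> sets (distr ?R borel (snd c))"
    then have T: "T \<in> sets borel" by simp
    have B: "{p \<in> fst c. snd c p \<in> T} \<in> borel_of_top M" by (rule chart_vimage_borel[OF mf c T])
    have eq: "snd c -` T \<inter> space ?R = {p \<in> fst c. snd c p \<in> T}"
      using V(1) ch(5) by (auto simp: space_restrict_space)
    have "emeasure (distr ?R borel (snd c)) T = emeasure ?V {p \<in> fst c. snd c p \<in> T}"
      using meas T eq fc' by (simp add: emeasure_distr emeasure_restrict_space)
    also have "\<dots> = emeasure (chart_measure h c) (snd c ` {p \<in> fst c. snd c p \<in> T})"
      by (rule V(3)[OF B]) auto
    also have "snd c ` {p \<in> fst c. snd c p \<in> T} = T \<inter> chart_range c" by auto
    also have "emeasure (chart_measure h c) (T \<inter> chart_range c) = emeasure (chart_measure h c) T"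
    proof -
      have w: "(\<lambda>x. ennreal (indicator (chart_range c) x * vol_weight h c x)) \<in> borel_measurable lborel"
        using chart_weight_measurable[OF h c ch(2)] by simp
      show ?thesis unfolding chart_measure_def
        using T ch(2) by (subst (1 2) emeasure_density[OF w]) (auto intro!: nn_integral_cong simp: indicator_def)
    qed
    finally show "emeasure (distr ?R borel (snd c)) T = emeasure (chart_measure h c) T" .
  qed (simp add: chart_measure_def)
  have w: "(\<lambda>x. indicator (chart_range c) x * vol_weight h c x) \<in> borel_measurable lborel"
    "AE x in lborel. 0 \<le> indicator (chart_range c) x * vol_weight h c x"
    using chart_weight_measurable[OF h c ch(2)] vol_weight_pos[OF h c] by (auto simp: indicator_def less_imp_le)
  have cf: "chart_fun c f = (\<lambda>p. indicator (fst c) p *\<^sub>R f (snd c p))"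
    by (auto simp: chart_fun_def)
  have "integrable (chart_measure h c) f"
    unfolding chart_measure_def using w f fi by (subst integrable_density) (auto simp: mult.assoc)
  then have "integrable ?R (\<lambda>p. f (snd c p))"
    unfolding distr[symmetric] using meas f by (simp add: integrable_distr_eq)
  then show "integrable ?V (chart_fun c f)"
    unfolding cf using fc' by (simp add: integrable_restrict_space)
  have "(LINT p|?V. chart_fun c f p) = (LINT p|?R. f (snd c p))"
    unfolding cf using fc' by (simp add: integral_restrict_space)
  also have "\<dots> = (LINT x|chart_measure h c. f x)"
    unfolding distr[symmetric] using meas f by (simp add: integral_distr)
  also have "\<dots> = (LINT x|lborel. indicator (chart_range c) x * (vol_weight h c x * f x))"
    unfolding chart_measure_def using w f by (subst integral_density) (auto simp: mult.assoc)
  finally show "(LINT p|?V. chart_fun c f p) = (LINT x|lborel. indicator (chart_range c) x * (vol_weight h c x * f x))" .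
qed

section \<open>Contractions and change of basis\<close>

text \<open>The inner product of tensors of rank \<open>r\<close> induced by \<open>H\<close>. Peeling off the first index with
  \<open>contr_Suc\<close> reduces most facts about it to an induction on the rank.\<close>

definition contr :: "real^'n^'n \<Rightarrow> nat \<Rightarrow> 'n::finite tensor \<Rightarrow> 'n tensor \<Rightarrow> real" where
  "contr H r v w = (\<Sum>I\<in>multi_idx r. \<Sum>J\<in>multi_idx r. idx_weight H I J * v I * w J)"

lemma norm_sq_contr: "norm_sq H r w = contr H r w w"
  by (simp add: norm_sq_def contr_def)

lemma idx_weight_Nil [simp]: "idx_weight H [] [] = 1"
  by (simp add: idx_weight_def)

lemma idx_weight_Cons [simp]: "idx_weight H (i # I) (j # J) = matrix_inv H $ i $ j * idx_weight H I J"
  by (simp add: idx_weight_def prod.lessThan_Suc_shift del: prod.lessThan_Suc)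

lemma contr_0 [simp]: "contr H 0 v w = v [] * w []"
  by (simp add: contr_def)

lemma contr_Suc:
  "contr H (Suc r) v w =
    (\<Sum>i\<in>UNIV. \<Sum>j\<in>UNIV. matrix_inv H $ i $ j * contr H r (\<lambda>I. v (i # I)) (\<lambda>J. w (j # J)))"
proof -
  have "contr H (Suc r) v w = (\<Sum>i\<in>UNIV. \<Sum>I\<in>multi_idx r. \<Sum>j\<in>UNIV. \<Sum>J\<in>multi_idx r.
      matrix_inv H $ i $ j * (idx_weight H I J * v (i # I) * w (j # J)))"
    by (simp add: contr_def sum_multi_idx_Suc mult_ac)
  also have "\<dots> = (\<Sum>i\<in>UNIV. \<Sum>j\<in>UNIV. \<Sum>I\<in>multi_idx r. \<Sum>J\<in>multi_idx r.
      matrix_inv H $ i $ j * (idx_weight H I J * v (i # I) * w (j # J)))"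
    by (intro sum.cong refl sum.swap)
  finally show ?thesis by (simp add: contr_def sum_distrib_left)
qed

lemma contr_cong:
  assumes "\<And>I. I \<in> multi_idx r \<Longrightarrow> v I = v' I" "\<And>I. I \<in> multi_idx r \<Longrightarrow> w I = w' I"
  shows "contr H r v w = contr H r v' w'"
  unfolding contr_def using assms by (intro sum.cong refl) simp

lemma contr_scale_left: "contr H r (\<lambda>I. a * v I) w = a * contr H r v w"
  by (simp add: contr_def sum_distrib_left mult_ac)

lemma contr_scale_right: "contr H r v (\<lambda>I. a * w I) = a * contr H r v w"
  by (simp add: contr_def sum_distrib_left mult_ac)

lemma contr_add_left: "contr H r (\<lambda>I. u I + v I) w = contr H r u w + contr H r v w"
  by (simp add: contr_def sum.distrib algebra_simps)

lemma contr_diff_left: "contr H r (\<lambda>I. u I - v I) w = contr H r u w - contr H r v w"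
  by (simp add: contr_def sum_subtractf algebra_simps)

lemma contr_diff_right: "contr H r w (\<lambda>I. u I - v I) = contr H r w u - contr H r w v"
  by (simp add: contr_def sum_subtractf algebra_simps)

lemma contr_zero_left: "contr H r (\<lambda>I. 0) w = 0"
  by (simp add: contr_def)

lemma contr_sum_left:
  "contr H r (\<lambda>I. \<Sum>k\<in>K. v k I) w = (\<Sum>k\<in>K. contr H r (v k) w)"
proof (induction K rule: infinite_finite_induct)
  case (insert x F)
  then show ?case by (simp add: contr_add_left)
qed (simp_all add: contr_zero_left)

lemma contr_sum_right:
  "contr H r w (\<lambda>I. \<Sum>k\<in>K. v k I) = (\<Sum>k\<in>K. contr H r w (v k))"
proof -
  have "contr H r w (\<lambda>I. u I + v I) = contr H r w u + contr H r w v" for u v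
    by (simp add: contr_def sum.distrib algebra_simps)
  moreover have "contr H r w (\<lambda>I. 0) = 0" by (simp add: contr_def)
  ultimately show ?thesis by (induction K rule: infinite_finite_induct) simp_all
qed

lemma contr_commute:
  assumes "transpose (matrix_inv H) = matrix_inv H"
  shows "contr H r v w = contr H r w v"
proof -
  have s: "matrix_inv H $ i $ j = matrix_inv H $ j $ i" for i j
    using arg_cong[OF assms, of "\<lambda>A. A $ j $ i"] by (simp add: transpose_def)
  have "idx_weight H I J = idx_weight H J I" if "length I = length J" for I J
    unfolding idx_weight_def that by (intro prod.cong refl s)
  then show ?thesis
    unfolding contr_def by (subst sum.swap) (auto simp: multi_idx_def mult_ac intro!: sum.cong)
qed

text \<open>The transformation law of covariant tensors, for a change of basis with matrix \<open>P\<close>. With the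
  Jacobian matrix of a transition it compares two charts, with an orthonormal frame it reduces an inner
  product to the standard one.\<close>

definition change_basis :: "real^'n^'n \<Rightarrow> nat \<Rightarrow> 'n::finite tensor \<Rightarrow> 'n tensor" where
  "change_basis P r w I = (\<Sum>J\<in>multi_idx r. (\<Prod>a<r. P $ (J ! a) $ (I ! a)) * w J)"

lemma change_basis_0 [simp]: "change_basis P 0 w I = w []"
  by (simp add: change_basis_def)

lemma change_basis_Suc:
  "change_basis P (Suc r) w (i # I) = (\<Sum>j\<in>UNIV. P $ j $ i * change_basis P r (\<lambda>J. w (j # J)) I)"
  by (simp add: change_basis_def sum_multi_idx_Suc prod.lessThan_Suc_shift sum_distrib_left mult_ac
      del: prod.lessThan_Suc)

lemma matrix_inv_eqI:
  fixes A :: "real^'n::finite^'n"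
  assumes "A ** B = mat 1"
  shows "matrix_inv A = B" "invertible A"
proof -
  have BA: "B ** A = mat 1" using assms matrix_left_right_inverse by blast
  show "invertible A" unfolding invertible_def using assms BA by blast
  have "matrix_inv A ** A = mat 1"
    unfolding matrix_inv_def using someI[of "\<lambda>A'. A ** A' = mat 1 \<and> A' ** A = mat 1" B] assms BA by blast
  then have "matrix_inv A ** (A ** B) = B" by (simp add: matrix_mul_assoc)
  then show "matrix_inv A = B" by (simp add: assms)
qed

lemma matrix_inv_mult:
  fixes A :: "real^'n::finite^'n"
  assumes "invertible A"
  shows "A ** matrix_inv A = mat 1" "matrix_inv A ** A = mat 1"
proof -
  obtain B where "A ** B = mat 1" "B ** A = mat 1" using assms unfolding invertible_def by blast
  then show "A ** matrix_inv A = mat 1" "matrix_inv A ** A = mat 1" using matrix_inv_eqI(1)[of A B] by auto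
qed

lemma matrix_inv_symmetric:
  fixes H :: "real^'n::finite^'n"
  assumes "invertible H" "transpose H = H"
  shows "transpose (matrix_inv H) = matrix_inv H"
proof -
  have "transpose (matrix_inv H ** H) = mat 1" using matrix_inv_mult[OF assms(1)] by (simp add: transpose_mat)
  then have "H ** transpose (matrix_inv H) = mat 1" using assms by (simp add: matrix_transpose_mul)
  then show ?thesis using matrix_inv_eqI(1) by metis
qed

text \<open>The inverse of \<open>P\<^sup>T H P\<close> is \<open>P\<^sup>-\<^sup>1 H\<^sup>-\<^sup>1 P\<^sup>-\<^sup>T\<close>, so the factors \<open>P\<close> cancel.\<close>

lemma matrix_inv_congruent:
  fixes H P :: "real^'n::finite^'n"
  assumes "invertible H" "invertible P"
  shows "(\<Sum>i\<in>UNIV. \<Sum>j\<in>UNIV. P $ k $ i * matrix_inv (transpose P ** H ** P) $ i $ j * P $ l $ j) = matrix_inv H $ k $ l"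
proof -
  let ?G = "matrix_inv H" and ?Q = "matrix_inv P"
  have PQ: "P ** ?Q = mat 1" "?Q ** P = mat 1" using matrix_inv_mult[OF assms(2)] .
  have tQ: "transpose P ** transpose ?Q = mat 1" "transpose ?Q ** transpose P = mat 1"
    using PQ by (simp_all flip: matrix_transpose_mul add: transpose_mat)
  have "(transpose P ** H ** P) ** (?Q ** ?G ** transpose ?Q) = transpose P ** (H ** ((P ** ?Q) ** ?G)) ** transpose ?Q"
    by (simp only: matrix_mul_assoc)
  also have "\<dots> = mat 1" using PQ tQ matrix_inv_mult[OF assms(1)] by simp
  finally have "matrix_inv (transpose P ** H ** P) = ?Q ** ?G ** transpose ?Q" by (rule matrix_inv_eqI(1))
  then have "P ** matrix_inv (transpose P ** H ** P) ** transpose P = (P ** ?Q) ** ?G ** (transpose ?Q ** transpose P)"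
    by (simp only: matrix_mul_assoc)
  also have "\<dots> = ?G" using PQ tQ by simp
  finally have "(P ** matrix_inv (transpose P ** H ** P) ** transpose P) $ k $ l = ?G $ k $ l" by simp
  then show ?thesis
    by (simp add: matrix_matrix_mult_def transpose_def sum_distrib_right) (subst sum.swap, simp)
qed

lemma sum_congruent:
  fixes H P :: "real^'n::finite^'n"
  assumes "invertible H" "invertible P"
  shows "(\<Sum>i\<in>UNIV. \<Sum>j\<in>UNIV. matrix_inv (transpose P ** H ** P) $ i $ j * (\<Sum>k\<in>UNIV. \<Sum>l\<in>UNIV. P $ k $ i * P $ l $ j * F k l))
     = (\<Sum>k\<in>UNIV. \<Sum>l\<in>UNIV. matrix_inv H $ k $ l * F k l)"
proof -
  let ?G = "matrix_inv (transpose P ** H ** P)"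
  have "(\<Sum>i\<in>UNIV. \<Sum>j\<in>UNIV. ?G $ i $ j * (\<Sum>k\<in>UNIV. \<Sum>l\<in>UNIV. P $ k $ i * P $ l $ j * F k l))
      = (\<Sum>i\<in>UNIV. \<Sum>j\<in>UNIV. \<Sum>k\<in>UNIV. \<Sum>l\<in>UNIV. P $ k $ i * ?G $ i $ j * P $ l $ j * F k l)"
    by (simp add: sum_distrib_left mult_ac)
  also have "\<dots> = (\<Sum>i\<in>UNIV. \<Sum>k\<in>UNIV. \<Sum>j\<in>UNIV. \<Sum>l\<in>UNIV. P $ k $ i * ?G $ i $ j * P $ l $ j * F k l)"
    by (intro sum.cong refl sum.swap)
  also have "\<dots> = (\<Sum>k\<in>UNIV. \<Sum>i\<in>UNIV. \<Sum>l\<in>UNIV. \<Sum>j\<in>UNIV. P $ k $ i * ?G $ i $ j * P $ l $ j * F k l)"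
    by (subst sum.swap) (intro sum.cong refl sum.swap)
  also have "\<dots> = (\<Sum>k\<in>UNIV. \<Sum>l\<in>UNIV. \<Sum>i\<in>UNIV. \<Sum>j\<in>UNIV. P $ k $ i * ?G $ i $ j * P $ l $ j * F k l)"
    by (intro sum.cong refl sum.swap)
  also have "\<dots> = (\<Sum>k\<in>UNIV. \<Sum>l\<in>UNIV. matrix_inv H $ k $ l * F k l)"
    by (simp flip: matrix_inv_congruent[OF assms] add: sum_distrib_right)
  finally show ?thesis .
qed

text \<open>Contractions do not depend on the basis; each pair of indices is one instance of
  \<open>sum_congruent\<close>.\<close>

lemma contr_change_basis:
  fixes H P :: "real^'n::finite^'n"
  assumes "invertible H" "invertible P"
  shows "contr (transpose P ** H ** P) r (change_basis P r v) (change_basis P r w) = contr H r v w"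
proof (induction r arbitrary: v w)
  case (Suc r)
  let ?H = "transpose P ** H ** P"
  have "contr ?H (Suc r) (change_basis P (Suc r) v) (change_basis P (Suc r) w) =
     (\<Sum>i\<in>UNIV. \<Sum>j\<in>UNIV. matrix_inv ?H $ i $ j * (\<Sum>k\<in>UNIV. \<Sum>l\<in>UNIV. P $ k $ i * P $ l $ j *
        contr ?H r (change_basis P r (\<lambda>I. v (k # I))) (change_basis P r (\<lambda>I. w (l # I)))))"
    by (simp add: contr_Suc change_basis_Suc contr_sum_left contr_sum_right contr_scale_left contr_scale_right
        sum_distrib_left mult_ac)
  also have "\<dots> = contr H (Suc r) v w"
    unfolding sum_congruent[OF assms] contr_Suc Suc.IH ..
  finally show ?case .
qed simp

text \<open>The building block \<open>\<omega>\<^sub>p\<^sub>i\<^sup>A \<omega>\<^sub>j\<^sub>q\<^sub>A\<close> of \<open>\<omega> \<circledast> \<omega>\<close>.\<close>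

definition pair_contr :: "real^'n^'n \<Rightarrow> nat \<Rightarrow> 'n::finite tensor \<Rightarrow> 'n \<Rightarrow> 'n \<Rightarrow> 'n \<Rightarrow> 'n \<Rightarrow> real" where
  "pair_contr H m w p i j q = contr H m (\<lambda>A. w (p # i # A)) (\<lambda>B. w (j # q # B))"

lemma circledast_pair:
  "circledast H (Suc (Suc m)) w [i, j, p, q] = pair_contr H m w p i j q - pair_contr H m w p j i q"
  by (simp add: circledast_def pair_contr_def contr_def sum_subtractf algebra_simps)

lemma sum_rot3: "(\<Sum>b\<in>B. \<Sum>c\<in>C. \<Sum>d\<in>D. F b c d) = (\<Sum>d\<in>D. \<Sum>b\<in>B. \<Sum>c\<in>C. F b c d)"
  by (rule trans[OF sum.cong[OF refl sum.swap] sum.swap])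

lemma sum_pull4:
  fixes F :: "'n::finite \<Rightarrow> 'n \<Rightarrow> 'n \<Rightarrow> 'n \<Rightarrow> real"
  shows "(\<Sum>a\<in>UNIV. \<Sum>b\<in>UNIV. \<Sum>c\<in>UNIV. \<Sum>d\<in>UNIV. F a b c d) = (\<Sum>c\<in>UNIV. \<Sum>d\<in>UNIV. \<Sum>a\<in>UNIV. \<Sum>b\<in>UNIV. F a b c d)"
proof -
  have "(\<Sum>a\<in>UNIV. \<Sum>b\<in>UNIV. \<Sum>c\<in>UNIV. \<Sum>d\<in>UNIV. F a b c d) = (\<Sum>a\<in>UNIV. \<Sum>c\<in>UNIV. \<Sum>b\<in>UNIV. \<Sum>d\<in>UNIV. F a b c d)"
    by (intro sum.cong refl sum.swap)
  also have "\<dots> = (\<Sum>c\<in>UNIV. \<Sum>a\<in>UNIV. \<Sum>d\<in>UNIV. \<Sum>b\<in>UNIV. F a b c d)"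
    by (subst sum.swap) (intro sum.cong refl sum.swap)
  also have "\<dots> = (\<Sum>c\<in>UNIV. \<Sum>d\<in>UNIV. \<Sum>a\<in>UNIV. \<Sum>b\<in>UNIV. F a b c d)"
    by (intro sum.cong refl sum.swap)
  finally show ?thesis .
qed

lemma pair_contr_change_basis:
  fixes H P :: "real^'n::finite^'n"
  assumes "invertible H" "invertible P"
  shows "pair_contr (transpose P ** H ** P) m (change_basis P (Suc (Suc m)) w) p i j q =
    (\<Sum>a\<in>UNIV. \<Sum>b\<in>UNIV. \<Sum>c\<in>UNIV. \<Sum>d\<in>UNIV. P $ a $ p * P $ b $ i * P $ c $ j * P $ d $ q * pair_contr H m w a b c d)"
  unfolding pair_contr_def
  by (simp add: change_basis_Suc contr_sum_left contr_sum_right contr_scale_left contr_scale_right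
      contr_change_basis[OF assms] sum_distrib_left mult_ac)

lemma change_basis_4: "change_basis P 4 Y [i, j, p, q] =
   (\<Sum>a\<in>UNIV. \<Sum>b\<in>UNIV. \<Sum>c\<in>UNIV. \<Sum>d\<in>UNIV. P $ a $ i * P $ b $ j * P $ c $ p * P $ d $ q * Y [a, b, c, d])"
  by (simp add: numeral_eq_Suc change_basis_Suc sum_distrib_left mult_ac)

lemma change_basis_2: "change_basis P 2 Y [i, j] = (\<Sum>a\<in>UNIV. \<Sum>b\<in>UNIV. P $ a $ i * P $ b $ j * Y [a, b])"
  by (simp add: numeral_eq_Suc change_basis_Suc sum_distrib_left mult_ac)

lemma multi_idx_4E:
  assumes "I \<in> multi_idx 4" obtains i j p q where "I = [i, j, p, q]"
proof -
  from assms have "length I = Suc (Suc (Suc (Suc 0)))" by (simp add: multi_idx_def)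
  then show ?thesis using that by (auto simp: length_Suc_conv)
qed

lemma multi_idx_2E:
  assumes "I \<in> multi_idx 2" obtains i j where "I = [i, j]"
proof -
  from assms have "length I = Suc (Suc 0)" by (simp add: multi_idx_def)
  then show ?thesis using that by (auto simp: length_Suc_conv)
qed

lemma circledast_change_basis:
  fixes H P :: "real^'n::finite^'n"
  assumes "invertible H" "invertible P" and I: "I \<in> multi_idx 4"
  shows "circledast (transpose P ** H ** P) (Suc (Suc m)) (change_basis P (Suc (Suc m)) w) I
      = change_basis P 4 (circledast H (Suc (Suc m)) w) I"
proof -
  obtain i j p q where I_eq: "I = [i, j, p, q]" using multi_idx_4E[OF I] .
  let ?B = "pair_contr H m w"
  have 1: "(\<Sum>a\<in>UNIV. \<Sum>b\<in>UNIV. \<Sum>c\<in>UNIV. \<Sum>d\<in>UNIV. P $ a $ p * P $ b $ i * P $ c $ j * P $ d $ q * ?B a b c d) =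
    (\<Sum>b\<in>UNIV. \<Sum>c\<in>UNIV. \<Sum>a\<in>UNIV. \<Sum>d\<in>UNIV. P $ b $ i * P $ c $ j * P $ a $ p * P $ d $ q * ?B a b c d)" for i j
    by (subst sum_rot3[symmetric]) (simp add: mult_ac)
  have 2: "(\<Sum>b\<in>UNIV. \<Sum>c\<in>UNIV. \<Sum>a\<in>UNIV. \<Sum>d\<in>UNIV. P $ b $ j * P $ c $ i * P $ a $ p * P $ d $ q * ?B a b c d) =
    (\<Sum>c\<in>UNIV. \<Sum>b\<in>UNIV. \<Sum>a\<in>UNIV. \<Sum>d\<in>UNIV. P $ c $ i * P $ b $ j * P $ a $ p * P $ d $ q * ?B a b c d)"
    by (subst sum.swap) (simp add: mult_ac)
  show ?thesis
    unfolding I_eq circledast_pair pair_contr_change_basis[OF assms(1,2)] change_basis_4 1 2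
    by (simp add: right_diff_distrib sum_subtractf)
qed

lemma rho_change_basis:
  fixes H P :: "real^'n::finite^'n"
  assumes "invertible H" "invertible P" and Y: "\<And>I. I \<in> multi_idx 4 \<Longrightarrow> Y' I = change_basis P 4 Y I"
    and I: "I \<in> multi_idx 2"
  shows "rho (transpose P ** H ** P) Y' I = change_basis P 2 (rho H Y) I"
proof -
  obtain i j where I_eq: "I = [i, j]" using multi_idx_2E[OF I] .
  have "Y' [p, i, j, q] = (\<Sum>a\<in>UNIV. \<Sum>d\<in>UNIV. P $ a $ p * P $ d $ q *
      (\<Sum>b\<in>UNIV. \<Sum>c\<in>UNIV. P $ b $ i * P $ c $ j * Y [a, b, c, d]))" for p q
  proof -
    have "Y' [p, i, j, q] = (\<Sum>a\<in>UNIV. \<Sum>b\<in>UNIV. \<Sum>c\<in>UNIV. \<Sum>d\<in>UNIV. P $ a $ p * P $ b $ i * P $ c $ j * P $ d $ q * Y [a, b, c, d])"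
      using Y[of "[p, i, j, q]"] by (simp add: change_basis_4 multi_idx_def)
    also have "\<dots> = (\<Sum>a\<in>UNIV. \<Sum>d\<in>UNIV. \<Sum>b\<in>UNIV. \<Sum>c\<in>UNIV. P $ a $ p * P $ b $ i * P $ c $ j * P $ d $ q * Y [a, b, c, d])"
      by (intro sum.cong refl sum_rot3)
    finally show ?thesis by (simp add: sum_distrib_left mult_ac)
  qed
  note Y'_eq = this
  have "rho (transpose P ** H ** P) Y' I = (\<Sum>a\<in>UNIV. \<Sum>d\<in>UNIV. matrix_inv H $ a $ d *
      (\<Sum>b\<in>UNIV. \<Sum>c\<in>UNIV. P $ b $ i * P $ c $ j * Y [a, b, c, d]))"
    unfolding I_eq rho_def list.case Y'_eq by (rule sum_congruent[OF assms(1,2)])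
  also have "\<dots> = (\<Sum>a\<in>UNIV. \<Sum>d\<in>UNIV. \<Sum>b\<in>UNIV. \<Sum>c\<in>UNIV. matrix_inv H $ a $ d * (P $ b $ i * P $ c $ j * Y [a, b, c, d]))"
    by (simp only: sum_distrib_left)
  also have "\<dots> = (\<Sum>b\<in>UNIV. \<Sum>c\<in>UNIV. \<Sum>a\<in>UNIV. \<Sum>d\<in>UNIV. matrix_inv H $ a $ d * (P $ b $ i * P $ c $ j * Y [a, b, c, d]))"
    by (rule sum_pull4)
  also have "\<dots> = change_basis P 2 (rho H Y) I"
    by (simp add: I_eq change_basis_2 rho_def sum_distrib_left mult_ac)
  finally show ?thesis .
qed

text \<open>Both parts of the function maximised in \<open>\<Lambda>\<^sub>n\<^sub>,\<^sub>k\<close> are natural, so a maximum taken over the tensors on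
  one Euclidean space bounds the function on every other one.\<close>

lemma lambda_integrand_change_basis:
  fixes H P :: "real^'n::finite^'n" and m :: nat and w :: "'n tensor"
  assumes "invertible H" "invertible P"
  defines "H' \<equiv> transpose P ** H ** P" and "w' \<equiv> change_basis P (Suc (Suc m)) w"
  shows "norm_sq H' 4 (circledast H' (Suc (Suc m)) w') = norm_sq H 4 (circledast H (Suc (Suc m)) w)"
    and "norm_sq H' 2 (rho H' (circledast H' (Suc (Suc m)) w')) = norm_sq H 2 (rho H (circledast H (Suc (Suc m)) w))"
    and "norm_sq H' (Suc (Suc m)) w' = norm_sq H (Suc (Suc m)) w"
proof -
  let ?k = "Suc (Suc m)"
  have Y: "circledast H' ?k w' I = change_basis P 4 (circledast H ?k w) I" if "I \<in> multi_idx 4" for I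
    unfolding H'_def w'_def by (rule circledast_change_basis[OF assms(1,2) that])
  have "norm_sq H' 4 (circledast H' ?k w') = norm_sq H' 4 (change_basis P 4 (circledast H ?k w))"
    unfolding norm_sq_contr by (intro contr_cong Y)
  also have "\<dots> = norm_sq H 4 (circledast H ?k w)"
    unfolding norm_sq_contr H'_def by (rule contr_change_basis[OF assms(1,2)])
  finally show "norm_sq H' 4 (circledast H' ?k w') = norm_sq H 4 (circledast H ?k w)" .
  have "norm_sq H' 2 (rho H' (circledast H' ?k w')) = norm_sq H' 2 (change_basis P 2 (rho H (circledast H ?k w)))"
    unfolding norm_sq_contr H'_def
    by (intro contr_cong rho_change_basis[OF assms(1,2)] Y[unfolded H'_def])
  also have "\<dots> = norm_sq H 2 (rho H (circledast H ?k w))"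
    unfolding norm_sq_contr H'_def by (rule contr_change_basis[OF assms(1,2)])
  finally show "norm_sq H' 2 (rho H' (circledast H' ?k w')) = norm_sq H 2 (rho H (circledast H ?k w))" .
  show "norm_sq H' ?k w' = norm_sq H ?k w"
    unfolding norm_sq_contr H'_def w'_def by (rule contr_change_basis[OF assms(1,2)])
qed

lemma sum_permute_list:
  fixes f :: "'n::finite list \<Rightarrow> real"
  assumes p: "p permutes {..<r}"
  shows "(\<Sum>J\<in>multi_idx r. f (permute_list p J)) = (\<Sum>J\<in>multi_idx r. f J)"
proof (rule sum.reindex_bij_witness[of _ "permute_list (inv p)" "permute_list p"])
  have ip: "inv p permutes {..<r}" by (rule permutes_inv[OF p])
  fix J :: "'n list" assume J: "J \<in> multi_idx r"
  then have l: "length J = r" by (simp add: multi_idx_def)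
  show "permute_list p J \<in> multi_idx r" "permute_list (inv p) J \<in> multi_idx r" using l by (simp_all add: multi_idx_def)
  have "permute_list (inv p) (permute_list p J) = permute_list (p \<circ> inv p) J"
    using permute_list_compose[of "inv p" J p] ip l by simp
  then show "permute_list (inv p) (permute_list p J) = J" using permutes_inv_o(1)[OF p] by simp
  have "permute_list p (permute_list (inv p) J) = permute_list (inv p \<circ> p) J"
    using permute_list_compose[of p J "inv p"] p l by simp
  then show "permute_list p (permute_list (inv p) J) = J" using permutes_inv_o(2)[OF p] by simp
qed simp

lemma symmetric_tensor_permute:
  assumes "symmetric_tensor r w" "p permutes {..<r}" "J \<in> multi_idx r"
  shows "w (permute_list p J) = w J"
proof -
  have l: "length J = r" using assms(3) by (simp add: multi_idx_def)
  then have "mset (permute_list p J) = mset J" using assms(2) by (simp add: mset_permute_list)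
  moreover have "permute_list p J \<in> multi_idx r" using l by (simp add: multi_idx_def)
  ultimately show ?thesis using assms(1,3) unfolding symmetric_tensor_def by blast
qed

lemma prod_nth_permute:
  fixes F :: "nat \<Rightarrow> real"
  assumes "p permutes {..<r}"
  shows "(\<Prod>a<r. F (p a)) = (\<Prod>a<r. F a)"
  using prod.permute[OF assms, of F] by (simp add: comp_def)

lemma idx_weight_permute:
  assumes "p permutes {..<r}" "I \<in> multi_idx r" "J \<in> multi_idx r"
  shows "idx_weight H (permute_list p I) (permute_list p J) = idx_weight H I J"
proof -
  have l: "length I = r" "length J = r" using assms by (auto simp: multi_idx_def)
  have "idx_weight H (permute_list p I) (permute_list p J) = (\<Prod>a<r. matrix_inv H $ (I ! p a) $ (J ! p a))"
    unfolding idx_weight_def using assms(1) l by (intro prod.cong) (simp_all add: permute_list_nth)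
  then show ?thesis
    using prod_nth_permute[OF assms(1), of "\<lambda>a. matrix_inv H $ (I ! a) $ (J ! a)"] l by (simp add: idx_weight_def)
qed

text \<open>Permuting the indices of the result is undone by the same permutation of the summation indices.\<close>

lemma symmetric_change_basis:
  assumes w: "symmetric_tensor r w"
  shows "symmetric_tensor r (change_basis P r w)"
  unfolding symmetric_tensor_def
proof (intro ballI impI)
  fix I J :: "'a list" assume IJ: "I \<in> multi_idx r" "J \<in> multi_idx r" "mset I = mset J"
  have l: "length J = r" using IJ by (simp add: multi_idx_def)
  obtain p where p: "p permutes {..<r}" "permute_list p J = I"
    using mset_eq_permutation[OF IJ(3)] l by metis
  have "change_basis P r w I = (\<Sum>K\<in>multi_idx r. (\<Prod>a<r. P $ (permute_list p K ! a) $ (permute_list p J ! a)) * w (permute_list p K))"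
    unfolding change_basis_def p(2)[symmetric] by (rule sum_permute_list[OF p(1), symmetric])
  also have "\<dots> = (\<Sum>K\<in>multi_idx r. (\<Prod>a<r. P $ (K ! a) $ (J ! a)) * w K)"
  proof (intro sum.cong refl arg_cong2[where f="(*)"])
    fix K :: "'a list" assume K: "K \<in> multi_idx r"
    have "(\<Prod>a<r. P $ (permute_list p K ! a) $ (permute_list p J ! a)) = (\<Prod>a<r. P $ (K ! p a) $ (J ! p a))"
      using p(1) l length_multi_idx[OF K] by (intro prod.cong) (simp_all add: permute_list_nth)
    then show "(\<Prod>a<r. P $ (permute_list p K ! a) $ (permute_list p J ! a)) = (\<Prod>a<r. P $ (K ! a) $ (J ! a))"
      using prod_nth_permute[OF p(1), of "\<lambda>a. P $ (K ! a) $ (J ! a)"] by simp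
    show "w (permute_list p K) = w K" by (rule symmetric_tensor_permute[OF w p(1) K])
  qed
  finally show "change_basis P r w I = change_basis P r w J" by (simp add: change_basis_def)
qed

lemma change_basis_sum: "change_basis P r (\<lambda>J. \<Sum>k\<in>K. w k J) I = (\<Sum>k\<in>K. change_basis P r (w k) I)"
  unfolding change_basis_def by (simp add: sum_distrib_left) (rule sum.swap)

lemma change_basis_scale: "change_basis P r (\<lambda>J. a * w J) I = a * change_basis P r w I"
  by (simp add: change_basis_def sum_distrib_left mult_ac)

lemma trace_free_change_basis:
  fixes H P :: "real^'n::finite^'n"
  assumes "invertible H" "invertible P" "trace_free H (Suc (Suc m)) w"
  shows "trace_free (transpose P ** H ** P) (Suc (Suc m)) (change_basis P (Suc (Suc m)) w)"
  unfolding trace_free_def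
proof
  fix A :: "'n list" assume "A \<in> multi_idx (Suc (Suc m) - 2)"
  let ?H = "transpose P ** H ** P"
  have "(\<Sum>i\<in>UNIV. \<Sum>j\<in>UNIV. matrix_inv ?H $ i $ j * change_basis P (Suc (Suc m)) w (i # j # A)) =
    (\<Sum>i\<in>UNIV. \<Sum>j\<in>UNIV. matrix_inv ?H $ i $ j * (\<Sum>k\<in>UNIV. \<Sum>l\<in>UNIV. P $ k $ i * P $ l $ j * change_basis P m (\<lambda>B. w (k # l # B)) A))"
    by (simp add: change_basis_Suc sum_distrib_left mult_ac)
  also have "\<dots> = (\<Sum>k\<in>UNIV. \<Sum>l\<in>UNIV. matrix_inv H $ k $ l * change_basis P m (\<lambda>B. w (k # l # B)) A)"
    by (rule sum_congruent[OF assms(1,2)])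
  also have "\<dots> = change_basis P m (\<lambda>B. \<Sum>k\<in>UNIV. \<Sum>l\<in>UNIV. matrix_inv H $ k $ l * w (k # l # B)) A"
    by (simp add: change_basis_sum change_basis_scale)
  also have "\<dots> = 0"
    unfolding change_basis_def using assms(3) by (intro sum.neutral) (simp add: trace_free_def)
  finally show "(\<Sum>i\<in>UNIV. \<Sum>j\<in>UNIV. matrix_inv ?H $ i $ j * change_basis P (Suc (Suc m)) w (i # j # A)) = 0" .
qed

section \<open>The constant \<open>\<Lambda>\<^sub>n\<^sub>,\<^sub>k\<close>\<close>

lemma matrix_inv_mat_1 [simp]: "matrix_inv (mat 1 :: real^'n::finite^'n) = mat 1"
  by (rule matrix_inv_eqI(1)) simp

lemma mat_1_nth: "(mat 1 :: real^'n^'n) $ i $ j = (if i = j then 1 else 0)"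
  by (simp add: mat_def)

lemma idx_weight_mat_1:
  fixes I J :: "'n::finite list"
  assumes "length I = length J"
  shows "idx_weight (mat 1) I J = (if I = J then 1 else 0)"
proof (cases "I = J")
  case False
  then obtain a where "a < length I" "I ! a \<noteq> J ! a" using assms nth_equalityI by blast
  then have "a \<in> {..<length I}" "matrix_inv (mat 1 :: real^'n^'n) $ (I ! a) $ (J ! a) = 0" by (simp_all add: mat_1_nth)
  then have "idx_weight (mat 1) I J = 0" unfolding idx_weight_def by (intro prod_zero) auto
  then show ?thesis using False by simp
qed (simp add: idx_weight_def mat_1_nth)

lemma contr_mat_1: "contr (mat 1) r v w = (\<Sum>I\<in>multi_idx r. v I * w I)"
proof -
  have "(\<Sum>J\<in>multi_idx r. idx_weight (mat 1) I J * v I * w J) = v I * w I" if "I \<in> multi_idx r" for I :: "'a list"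
  proof -
    have "(\<Sum>J\<in>multi_idx r. idx_weight (mat 1) I J * v I * w J) = (\<Sum>J\<in>multi_idx r. if I = J then v I * w J else 0)"
      using that by (intro sum.cong refl) (auto simp: idx_weight_mat_1 multi_idx_def)
    then show ?thesis using that by simp
  qed
  then show ?thesis by (simp add: contr_def)
qed

lemma norm_sq_mat_1: "norm_sq (mat 1) r w = (\<Sum>I\<in>multi_idx r. (w I)\<^sup>2)"
  by (simp add: norm_sq_contr contr_mat_1 power2_eq_square)

text \<open>The function whose maximum on the unit sphere is \<open>\<Lambda>\<^sub>n\<^sub>,\<^sub>k\<close>.\<close>

definition Lambda_form :: "real^'n^'n \<Rightarrow> nat \<Rightarrow> 'n::finite tensor \<Rightarrow> real" where
  "Lambda_form H k w = (real k - 1) / 2 * norm_sq H 4 (circledast H k w)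
                       + norm_sq H 2 (rho H (circledast H k w))"

lemma Lambda_form_scale: "Lambda_form H (Suc (Suc m)) (\<lambda>I. a * w I) = a ^ 4 * Lambda_form H (Suc (Suc m)) w"
proof -
  let ?k = "Suc (Suc m)"
  have Y: "circledast H ?k (\<lambda>I. a * w I) I = a\<^sup>2 * circledast H ?k w I" if I4: "I \<in> multi_idx 4" for I
  proof -
    obtain i j p q where "I = [i, j, p, q]" using multi_idx_4E[OF I4] .
    then show ?thesis
      by (simp add: circledast_pair pair_contr_def contr_scale_left contr_scale_right power2_eq_square algebra_simps)
  qed
  have R: "rho H (circledast H ?k (\<lambda>I. a * w I)) I = a\<^sup>2 * rho H (circledast H ?k w) I" if I4: "I \<in> multi_idx 2" for I
  proof -
    obtain i j where "I = [i, j]" using multi_idx_2E[OF I4] .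
    then show ?thesis using Y by (simp add: rho_def multi_idx_def sum_distrib_left mult_ac)
  qed
  have "norm_sq H 4 (circledast H ?k (\<lambda>I. a * w I)) = contr H 4 (\<lambda>I. a\<^sup>2 * circledast H ?k w I) (\<lambda>I. a\<^sup>2 * circledast H ?k w I)"
    unfolding norm_sq_contr by (intro contr_cong Y)
  moreover have "norm_sq H 2 (rho H (circledast H ?k (\<lambda>I. a * w I))) = contr H 2 (\<lambda>I. a\<^sup>2 * rho H (circledast H ?k w) I) (\<lambda>I. a\<^sup>2 * rho H (circledast H ?k w) I)"
    unfolding norm_sq_contr by (intro contr_cong R)
  ultimately show ?thesis
    by (simp add: Lambda_form_def contr_scale_left contr_scale_right norm_sq_contr algebra_simps power_numeral_reduce)
qed

lemma Lambda_form_cong: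
  assumes "\<And>I. I \<in> multi_idx (Suc (Suc m)) \<Longrightarrow> w I = w' I"
  shows "Lambda_form H (Suc (Suc m)) w = Lambda_form H (Suc (Suc m)) w'"
proof -
  let ?k = "Suc (Suc m)"
  have Y: "circledast H ?k w I = circledast H ?k w' I" if I4: "I \<in> multi_idx 4" for I
  proof -
    obtain i j p q where "I = [i, j, p, q]" using multi_idx_4E[OF I4] .
    moreover have "pair_contr H m w a b c d = pair_contr H m w' a b c d" for a b c d
      unfolding pair_contr_def by (intro contr_cong assms) auto
    ultimately show ?thesis by (simp add: circledast_pair)
  qed
  have R: "rho H (circledast H ?k w) I = rho H (circledast H ?k w') I" if I4: "I \<in> multi_idx 2" for I
  proof -
    obtain i j where "I = [i, j]" using multi_idx_2E[OF I4] .
    then show ?thesis using Y by (simp add: rho_def multi_idx_def)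
  qed
  show ?thesis unfolding Lambda_form_def norm_sq_contr
    by (intro arg_cong2[where f="(+)"] arg_cong2[where f="(*)"] contr_cong Y R refl)
qed

lemma abs_contr_mat_1_le:
  fixes v w :: "'n::finite tensor"
  assumes "\<And>I. I \<in> multi_idx r \<Longrightarrow> \<bar>v I\<bar> \<le> a" "\<And>I. I \<in> multi_idx r \<Longrightarrow> \<bar>w I\<bar> \<le> b" "0 \<le> a" "0 \<le> b"
  shows "\<bar>contr (mat 1) r v w\<bar> \<le> real (card (multi_idx r :: 'n list set)) * (a * b)"
proof -
  have "\<bar>contr (mat 1) r v w\<bar> \<le> (\<Sum>I\<in>(multi_idx r :: 'n list set). \<bar>v I * w I\<bar>)"
    unfolding contr_mat_1 by (rule sum_abs)
  also have "\<dots> \<le> (\<Sum>I\<in>(multi_idx r :: 'n list set). a * b)"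
    by (intro sum_mono) (auto simp: abs_mult intro!: mult_mono assms)
  finally show ?thesis by simp
qed

text \<open>On the unit sphere all components lie between \<open>-1\<close> and \<open>1\<close>, which bounds each of the finite sums.
  The bound makes the supremum in \<open>\<Lambda>\<^sub>n\<^sub>,\<^sub>k\<close> meaningful.\<close>

lemma Lambda_form_bounded:
  obtains K where "\<And>w :: 'n::finite tensor. norm_sq (mat 1) (Suc (Suc m)) w = 1 \<Longrightarrow>
     Lambda_form (mat 1 :: real^'n^'n) (Suc (Suc m)) w \<le> K"
proof -
  let ?k = "Suc (Suc m)" and ?I = "mat 1 :: real^'n^'n"
  define N where "N r = real (card (multi_idx r :: 'n list set))" for r
  define Y where "Y = 2 * N m"
  have N0: "N r \<ge> 0" for r by (simp add: N_def)
  have "Lambda_form ?I ?k w \<le> (real ?k - 1) / 2 * (N 4 * (Y * Y)) + N 2 * ((real CARD('n) * Y) * (real CARD('n) * Y))"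
    if w: "norm_sq ?I ?k w = 1" for w :: "'n tensor"
  proof -
    have w1: "\<bar>w I\<bar> \<le> 1" if "I \<in> multi_idx ?k" for I
    proof -
      have "(w I)\<^sup>2 \<le> (\<Sum>I\<in>multi_idx ?k. (w I)\<^sup>2)" using that by (intro member_le_sum) auto
      then show ?thesis using w unfolding norm_sq_mat_1 by (simp add: abs_square_le_1)
    qed
    have P: "\<bar>pair_contr ?I m w a b c d\<bar> \<le> N m" for a b c d
      using abs_contr_mat_1_le[of m "\<lambda>A. w (a # b # A)" 1 "\<lambda>A. w (c # d # A)" 1] w1
      by (simp add: pair_contr_def N_def)
    have Y: "\<bar>circledast ?I ?k w I\<bar> \<le> Y" if I4: "I \<in> multi_idx 4" for I
    proof -
      obtain i j p q where "I = [i, j, p, q]" using multi_idx_4E[OF I4] .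
      then show ?thesis using P[of p i j q] P[of p j i q] by (simp add: circledast_pair Y_def)
    qed
    have R: "\<bar>rho ?I (circledast ?I ?k w) I\<bar> \<le> real CARD('n) * Y" if I4: "I \<in> multi_idx 2" for I
    proof -
      obtain i j where I: "I = [i, j]" using multi_idx_2E[OF I4] .
      have "\<bar>rho ?I (circledast ?I ?k w) I\<bar> = \<bar>\<Sum>p\<in>UNIV. circledast ?I ?k w [p, i, j, p]\<bar>"
        by (simp add: I rho_def mat_1_nth if_distrib[of "\<lambda>u. u * _"] cong: if_cong)
      also have "\<dots> \<le> (\<Sum>p\<in>(UNIV::'n set). Y)"
        by (rule order_trans[OF sum_abs sum_mono]) (rule Y, simp add: multi_idx_def)
      finally show ?thesis by simp
    qed
    have Y0: "Y \<ge> 0" using N0 by (simp add: Y_def)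
    have 1: "norm_sq ?I 4 (circledast ?I ?k w) \<le> N 4 * (Y * Y)"
      using abs_contr_mat_1_le[of 4 "circledast ?I ?k w" Y "circledast ?I ?k w" Y, OF Y Y Y0 Y0] by (simp add: norm_sq_contr N_def)
    have 2: "norm_sq ?I 2 (rho ?I (circledast ?I ?k w)) \<le> N 2 * ((real CARD('n) * Y) * (real CARD('n) * Y))"
      using abs_contr_mat_1_le[of 2 "rho ?I (circledast ?I ?k w)" "real CARD('n) * Y" "rho ?I (circledast ?I ?k w)" "real CARD('n) * Y", OF R R] Y0 by (simp add: norm_sq_contr N_def)
    show ?thesis unfolding Lambda_form_def by (intro add_mono mult_left_mono 1 2) simp
  qed
  then show ?thesis by (rule that)
qed

text \<open>Passing to an orthonormal frame and dividing by the norm gives a competitor in the definition of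
  \<open>\<Lambda>\<^sub>n\<^sub>,\<^sub>k\<close>; homogeneity of degree four turns the comparison into the claim. A tensor of norm zero has
  vanishing components, and then both sides vanish.\<close>

lemma Lambda_form_le:
  fixes H :: "real^'n::finite^'n" and w :: "'n tensor"
  assumes pos: "\<And>v. v \<noteq> 0 \<Longrightarrow> v \<bullet> (H *v v) > 0" and sym: "transpose H = H"
    and w: "symmetric_tensor k w" "trace_free H k w" and k: "k \<ge> 2"
  shows "Lambda_form H k w \<le> Lambda (mat 1 :: real^'n^'n) k * (norm_sq H k w)\<^sup>2"
    and "norm_sq H k w \<ge> 0"
proof -
  obtain m where m: "k = Suc (Suc m)" using k by (metis add_2_eq_Suc le_Suc_ex)
  let ?I = "mat 1 :: real^'n^'n"
  obtain E :: "real^'n^'n" where E: "transpose E ** H ** E = mat 1" using orthonormal_frame[OF pos sym] .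
  have inv: "invertible H" "invertible E"
  proof -
    show "invertible H" using pos_def_det_pos[OF pos sym] by (simp add: invertible_det_nz)
    have "det (transpose E ** H ** E) = 1" using E by simp
    then show "invertible E" by (auto simp: det_mul invertible_det_nz)
  qed
  define v where "v = change_basis E k w"
  have v: "symmetric_tensor k v" "trace_free ?I k v"
    using symmetric_change_basis[OF w(1)] trace_free_change_basis[OF inv w(2)[unfolded m]] E by (simp_all add: v_def m)
  have eq: "Lambda_form H k w = Lambda_form ?I k v" "norm_sq H k w = norm_sq ?I k v"
    using lambda_integrand_change_basis[OF inv, of m w] by (simp_all add: E v_def m Lambda_form_def)
  show n0: "norm_sq H k w \<ge> 0" unfolding eq norm_sq_mat_1 by (simp add: sum_nonneg)
  show "Lambda_form H k w \<le> Lambda ?I k * (norm_sq H k w)\<^sup>2"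
  proof (cases "norm_sq H k w = 0")
    case True
    then have "v I = 0 * v I" if "I \<in> multi_idx k" for I
      using that unfolding eq norm_sq_mat_1 by (simp add: sum_nonneg_eq_0_iff)
    then have "Lambda_form ?I k v = Lambda_form ?I k (\<lambda>I. 0 * v I)" unfolding m by (intro Lambda_form_cong) (simp add: m)
    then show ?thesis using True Lambda_form_scale[of ?I m 0 v] unfolding eq(1) by (simp add: m)
  next
    case False
    define N where "N = norm_sq H k w"
    have N: "N > 0" using False n0 by (simp add: N_def)
    define u where "u = (\<lambda>I. (1 / sqrt N) * v I)"
    have "symmetric_tensor k u" using v(1) unfolding u_def symmetric_tensor_def by metis
    moreover have "trace_free ?I k u"
    proof -
      have "(\<Sum>i\<in>UNIV. \<Sum>j\<in>UNIV. matrix_inv ?I $ i $ j * u (i # j # A)) = (1 / sqrt N) * (\<Sum>i\<in>UNIV. \<Sum>j\<in>UNIV. matrix_inv ?I $ i $ j * v (i # j # A))" for A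
        by (simp add: u_def sum_distrib_left mult_ac)
      then show ?thesis using v(2) unfolding trace_free_def by simp
    qed
    moreover have "norm_sq ?I k u = 1"
      using N unfolding u_def norm_sq_contr contr_scale_left contr_scale_right
      by (simp add: flip: norm_sq_contr eq N_def)
    ultimately have "Lambda_form ?I k u \<in> {Lambda_form ?I k w | w :: 'n tensor.
                     symmetric_tensor k w \<and> trace_free ?I k w \<and> norm_sq ?I k w = 1}" by blast
    moreover have "bdd_above {Lambda_form ?I k w | w :: 'n tensor.
                     symmetric_tensor k w \<and> trace_free ?I k w \<and> norm_sq ?I k w = 1}"
    proof -
      obtain K where "\<And>w :: 'n tensor. norm_sq ?I k w = 1 \<Longrightarrow> Lambda_form ?I k w \<le> K"
        using Lambda_form_bounded[of m] unfolding m by blast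
      then show ?thesis by (intro bdd_aboveI[of _ K]) auto
    qed
    ultimately have "Lambda_form ?I k u \<le> Lambda ?I k"
      unfolding Lambda_def Lambda_form_def[symmetric] by (rule cSup_upper)
    moreover have "Lambda_form ?I k u = (1 / N\<^sup>2) * Lambda_form ?I k v"
    proof -
      have "(1 / sqrt N) ^ 4 = 1 / N\<^sup>2"
        using N by (simp add: power_divide power4_eq_xxxx power2_eq_square)
      then show ?thesis unfolding u_def m Lambda_form_scale by simp
    qed
    ultimately show ?thesis using N unfolding N_def[symmetric] eq(1) by (simp add: field_simps)
  qed
qed

section \<open>The curvature term of the Bochner formula at a point\<close>

lemma contr_4: "contr H 4 F K = (\<Sum>p\<in>UNIV. \<Sum>q\<in>UNIV. matrix_inv H $ p $ q * (\<Sum>i\<in>UNIV. \<Sum>j\<in>UNIV. matrix_inv H $ i $ j *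
    (\<Sum>b\<in>UNIV. \<Sum>c\<in>UNIV. matrix_inv H $ b $ c * (\<Sum>l\<in>UNIV. \<Sum>r\<in>UNIV. matrix_inv H $ l $ r * (F [p, i, b, l] * K [q, j, c, r])))))"
  by (simp add: numeral_eq_Suc contr_Suc)

lemma contr_2: "contr H 2 F K = (\<Sum>p\<in>UNIV. \<Sum>q\<in>UNIV. matrix_inv H $ p $ q * (\<Sum>i\<in>UNIV. \<Sum>j\<in>UNIV. matrix_inv H $ i $ j *
    (F [p, i] * K [q, j])))"
  by (simp add: numeral_eq_Suc contr_Suc)

text \<open>A function of four indices as a tensor, so that contractions of such functions can be written with
  \<open>contr\<close>.\<close>

definition slot_form :: "('n::finite \<Rightarrow> 'n \<Rightarrow> 'n \<Rightarrow> 'n \<Rightarrow> real) \<Rightarrow> 'n tensor" where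
  "slot_form F I = (case I of [p, i, b, l] \<Rightarrow> F p i b l | _ \<Rightarrow> 0)"

lemma slot_form_4 [simp]: "slot_form F [p, i, b, l] = F p i b l"
  by (simp add: slot_form_def)

text \<open>The contraction pairs the slots of the two factors in order, so exchanging the first two slots of
  both factors only changes the order of summation.\<close>

lemma contr_4_swap:
  "contr H 4 (slot_form F) (slot_form K) = contr H 4 (slot_form (\<lambda>p i. F i p)) (slot_form (\<lambda>q j. K j q))"
proof -
  let ?S = "\<lambda>p q i j. \<Sum>b\<in>UNIV. \<Sum>c\<in>UNIV. matrix_inv H $ b $ c * (\<Sum>l\<in>UNIV. \<Sum>r\<in>UNIV. matrix_inv H $ l $ r * (F p i b l * K q j c r))"
  have "contr H 4 (slot_form F) (slot_form K) =
     (\<Sum>p\<in>UNIV. \<Sum>q\<in>UNIV. \<Sum>i\<in>UNIV. \<Sum>j\<in>UNIV. matrix_inv H $ p $ q * (matrix_inv H $ i $ j * ?S p q i j))"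
    unfolding contr_4 slot_form_4 by (simp only: sum_distrib_left)
  also have "\<dots> = (\<Sum>i\<in>UNIV. \<Sum>j\<in>UNIV. \<Sum>p\<in>UNIV. \<Sum>q\<in>UNIV. matrix_inv H $ p $ q * (matrix_inv H $ i $ j * ?S p q i j))"
    by (rule sum_pull4)
  also have "\<dots> = (\<Sum>i\<in>UNIV. \<Sum>j\<in>UNIV. \<Sum>p\<in>UNIV. \<Sum>q\<in>UNIV. matrix_inv H $ i $ j * (matrix_inv H $ p $ q * ?S p q i j))"
    by (simp only: mult.left_commute)
  also have "\<dots> = contr H 4 (slot_form (\<lambda>p i. F i p)) (slot_form (\<lambda>q j. K j q))"
    unfolding contr_4 slot_form_4 by (simp only: sum_distrib_left)
  finally show ?thesis .
qed

text \<open>For symmetric tensors it does not matter into which slot a matrix \<open>M\<close> is inserted: the transposition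
  of \<open>0\<close> and \<open>a\<close>, applied to both summation indices, moves slot \<open>a\<close> to the front.\<close>

lemma contr_slot_symmetric:
  fixes H :: "real^'n::finite^'n"
  assumes v: "symmetric_tensor (Suc m) v" and w: "symmetric_tensor (Suc m) w" and a: "a < Suc m"
  shows "contr H (Suc m) (\<lambda>A. \<Sum>r\<in>UNIV. M (A ! a) r * v (A[a := r])) w =
    (\<Sum>b\<in>UNIV. \<Sum>c\<in>UNIV. matrix_inv H $ b $ c * (\<Sum>r\<in>UNIV. M b r * contr H m (\<lambda>A. v (r # A)) (\<lambda>B. w (c # B))))"
proof -
  define p where "p = Transposition.transpose 0 a"
  have p: "p permutes {..<Suc m}" unfolding p_def using a by (intro permutes_swap_id) auto
  have pp: "p (p x) = x" for x by (simp add: p_def)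
  have upd: "(permute_list p A)[a := r] = permute_list p (A[0 := r])" if "A \<in> multi_idx (Suc m)" for A :: "'n list" and r
  proof (rule nth_equalityI)
    have l: "length A = Suc m" using that by (simp add: multi_idx_def)
    then show "length ((permute_list p A)[a := r]) = length (permute_list p (A[0 := r]))" by simp
    fix x assume "x < length ((permute_list p A)[a := r])"
    then have x: "x < Suc m" using l by simp
    have px: "p x < Suc m" using permutes_in_image[OF p, of x] x by simp
    have "p x = 0 \<longleftrightarrow> x = a" by (auto simp: p_def Transposition.transpose_def split: if_splits)
    then show "(permute_list p A)[a := r] ! x = permute_list p (A[0 := r]) ! x"
      using p l x px a by (auto simp: permute_list_nth nth_list_update)
  qed
  have nth: "permute_list p A ! a = A ! 0" if "A \<in> multi_idx (Suc m)" for A :: "'n list"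
    using that p a by (simp add: permute_list_nth multi_idx_def) (simp add: p_def)
  have "contr H (Suc m) (\<lambda>A. \<Sum>r\<in>UNIV. M (A ! a) r * v (A[a := r])) w =
    (\<Sum>I\<in>multi_idx (Suc m). \<Sum>J\<in>multi_idx (Suc m). idx_weight H (permute_list p I) (permute_list p J) *
       (\<Sum>r\<in>UNIV. M (permute_list p I ! a) r * v ((permute_list p I)[a := r])) * w (permute_list p J))"
    unfolding contr_def
    by (subst sum_permute_list[OF p, symmetric], subst (2) sum_permute_list[OF p, symmetric]) (rule refl)
  also have "\<dots> = contr H (Suc m) (\<lambda>A. \<Sum>r\<in>UNIV. M (A ! 0) r * v (A[0 := r])) w"
    unfolding contr_def
  proof (intro sum.cong refl arg_cong2[where f="(*)"])
    fix I J :: "'n list" assume IJ: "I \<in> multi_idx (Suc m)" "J \<in> multi_idx (Suc m)"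
    show "idx_weight H (permute_list p I) (permute_list p J) = idx_weight H I J" by (rule idx_weight_permute[OF p IJ])
    show "w (permute_list p J) = w J" by (rule symmetric_tensor_permute[OF w p IJ(2)])
    show "M (permute_list p I ! a) r = M (I ! 0) r" for r using nth[OF IJ(1)] by simp
    show "v ((permute_list p I)[a := r]) = v (I[0 := r])" for r
      unfolding upd[OF IJ(1)] using IJ(1) by (intro symmetric_tensor_permute[OF v p]) (simp add: multi_idx_def)
  qed
  also have "\<dots> = (\<Sum>b\<in>UNIV. \<Sum>c\<in>UNIV. matrix_inv H $ b $ c * (\<Sum>r\<in>UNIV. M b r * contr H m (\<lambda>A. v (r # A)) (\<lambda>B. w (c # B))))"
    by (simp add: contr_Suc contr_sum_left contr_scale_left sum_distrib_left) (rule sum_rot3[symmetric])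
  finally show ?thesis .
qed

lemma symmetric_tensor_Cons: "symmetric_tensor (Suc r) w \<Longrightarrow> symmetric_tensor r (\<lambda>A. w (q # A))"
  unfolding symmetric_tensor_def by (metis Cons_in_multi_idx mset.simps(2))

lemma symmetric_tensor_swap:
  assumes "symmetric_tensor (Suc (Suc m)) w" "A \<in> multi_idx m"
  shows "w (p # q # A) = w (q # p # A)"
proof -
  have "p # q # A \<in> multi_idx (Suc (Suc m))" "q # p # A \<in> multi_idx (Suc (Suc m))" "mset (p # q # A) = mset (q # p # A)"
    using assms(2) by (auto simp: add_mset_commute)
  then show ?thesis using assms(1) unfolding symmetric_tensor_def by blast
qed

text \<open>The situation in one tangent space with inner product \<open>H\<close>: \<open>w\<close> stands for \<open>\<omega>\<close>, the rank is
  \<open>k = m + 2\<close>, \<open>l\<close> stands for \<open>\<kappa> / (n (n - 1))\<close>, and \<open>R\<close> for the curvature \<open>R\<^sub>i\<^sub>j\<^sub>k\<^sup>p\<close>. The last assumption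
  is the coupled equation with the last index raised.

  All contractions that occur reduce to two: \<open>P p i j q = \<omega>\<^sub>p\<^sub>i\<^sup>A \<omega>\<^sub>j\<^sub>q\<^sub>A\<close> and its trace
  \<open>Q i j = \<rho>(\<omega> \<circledast> \<omega>)\<^sub>i\<^sub>j\<close>.\<close>

locale curvature_term =
  fixes H :: "real^'n::finite^'n" and m :: nat and w :: "'n tensor" and c l :: real
    and R :: "'n \<Rightarrow> 'n \<Rightarrow> 'n \<Rightarrow> 'n \<Rightarrow> real"
  assumes inv: "invertible H" and symH: "transpose H = H"
    and w: "symmetric_tensor (Suc (Suc m)) w" and tf: "trace_free H (Suc (Suc m)) w"
    and R: "\<And>p i b r. R p i b r = (\<Sum>q\<in>UNIV. matrix_inv H $ q $ r *
        (c * circledast H (Suc (Suc m)) w [p, i, b, q] - l * (H $ b $ p * H $ i $ q - H $ b $ i * H $ p $ q)))"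
begin

abbreviation "G \<equiv> matrix_inv H"
abbreviation "P \<equiv> pair_contr H m w"
definition "Q i j = contr H (Suc m) (\<lambda>A. w (i # A)) (\<lambda>B. w (j # B))"

lemma G_sym: "G $ i $ j = G $ j $ i"
  using arg_cong[OF matrix_inv_symmetric[OF inv symH], of "\<lambda>A. A $ j $ i"] by (simp add: transpose_def)

lemma H_sym: "H $ i $ j = H $ j $ i"
  using arg_cong[OF symH, of "\<lambda>A. A $ j $ i"] by (simp add: transpose_def)

lemma GH: "(\<Sum>q\<in>UNIV. G $ p $ q * H $ q $ r) = (if p = r then 1 else 0)"
  using arg_cong[OF matrix_inv_mult(2)[OF inv], of "\<lambda>A. A $ p $ r"] by (simp add: matrix_matrix_mult_def mat_1_nth)

lemma GH': "(\<Sum>q\<in>UNIV. G $ q $ p * H $ q $ r) = (if p = r then 1 else 0)"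
  using GH[of p r] by (simp add: G_sym)

lemma P_sym1: "P p i j q = P i p j q" and P_sym2: "P p i j q = P p i q j" and P_sym: "P p i j q = P j q p i"
proof -
  show "P p i j q = P i p j q" unfolding pair_contr_def by (intro contr_cong refl symmetric_tensor_swap[OF w])
  show "P p i j q = P p i q j" unfolding pair_contr_def by (intro contr_cong refl symmetric_tensor_swap[OF w])
  show "P p i j q = P j q p i" unfolding pair_contr_def by (rule contr_commute[OF matrix_inv_symmetric[OF inv symH]])
qed

lemma Q_P: "Q i j = (\<Sum>p\<in>UNIV. \<Sum>q\<in>UNIV. G $ p $ q * P i p j q)"
  unfolding Q_def contr_Suc pair_contr_def ..

lemma Q_sym: "Q i j = Q j i"
  unfolding Q_def by (rule contr_commute[OF matrix_inv_symmetric[OF inv symH]])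

lemma norm_Q: "norm_sq H (Suc (Suc m)) w = (\<Sum>i\<in>UNIV. \<Sum>j\<in>UNIV. G $ i $ j * Q i j)"
  unfolding norm_sq_contr Q_def by (rule contr_Suc)

lemma trace_P: "(\<Sum>p\<in>UNIV. \<Sum>q\<in>UNIV. G $ p $ q * P p q i j) = 0"
proof -
  have "(\<Sum>p\<in>UNIV. \<Sum>q\<in>UNIV. G $ p $ q * P p q i j) = contr H m (\<lambda>A. \<Sum>p\<in>UNIV. \<Sum>q\<in>UNIV. G $ p $ q * w (p # q # A)) (\<lambda>B. w (i # j # B))"
    by (simp add: pair_contr_def contr_sum_left contr_scale_left)
  also have "\<dots> = contr H m (\<lambda>A. 0) (\<lambda>B. w (i # j # B))"
    using tf by (intro contr_cong) (auto simp: trace_free_def)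
  finally show ?thesis by (simp add: contr_zero_left)
qed

definition "Y p i b q = P b p i q - P b i p q"

lemma circledast_Y: "circledast H (Suc (Suc m)) w [p, i, b, q] = Y p i b q"
  by (simp add: circledast_pair Y_def)

lemma rho_Q: "rho H (circledast H (Suc (Suc m)) w) [i, j] = Q i j"
proof -
  have "rho H (circledast H (Suc (Suc m)) w) [i, j] = (\<Sum>p\<in>UNIV. \<Sum>q\<in>UNIV. G $ p $ q * P j p i q) - (\<Sum>p\<in>UNIV. \<Sum>q\<in>UNIV. G $ p $ q * P p q j i)"
    unfolding rho_def list.case circledast_Y Y_def right_diff_distrib sum_subtractf by (simp add: P_sym[of j i])
  then show ?thesis using Q_P[of j i] trace_P Q_sym by simp
qed

text \<open>The trace over \<open>p\<close> and \<open>q\<close> turns the curvature into minus the Ricci tensor, which by the coupled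
  equation is a combination of \<open>\<rho>(\<omega> \<circledast> \<omega>)\<close> and \<open>H\<close>. The first part of \<open>Y\<close> has no trace because \<open>\<omega>\<close> has
  none; the trace of \<open>h \<circledast> h\<close> gives the factor \<open>n - 1\<close>.\<close>

lemma ricci_term:
  "(\<Sum>p\<in>UNIV. \<Sum>q\<in>UNIV. G $ p $ q * (\<Sum>i\<in>UNIV. \<Sum>j\<in>UNIV. G $ i $ j * (\<Sum>r\<in>UNIV. R p i q r * Q r j)))
    = - c * norm_sq H 2 (rho H (circledast H (Suc (Suc m)) w)) - l * (real CARD('n) - 1) * norm_sq H (Suc (Suc m)) w"
proof -
  have tr: "(\<Sum>p\<in>UNIV. \<Sum>q\<in>UNIV. G $ p $ q * (c * Y p i q s - l * (H $ q $ p * H $ i $ s - H $ q $ i * H $ p $ s)))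
      = - c * Q i s - l * (real CARD('n) - 1) * H $ i $ s" for i s
  proof -
    have 1: "(\<Sum>p\<in>UNIV. \<Sum>q\<in>UNIV. G $ p $ q * Y p i q s) = - Q i s"
    proof -
      have "(\<Sum>p\<in>UNIV. \<Sum>q\<in>UNIV. G $ p $ q * P q p i s) = 0"
        using trace_P[of i s] by (subst P_sym1)
      moreover have "(\<Sum>p\<in>UNIV. \<Sum>q\<in>UNIV. G $ p $ q * P q i p s) = Q i s"
      proof -
        have "Q i s = (\<Sum>q\<in>UNIV. \<Sum>p\<in>UNIV. G $ q $ p * P i q s p)" by (rule Q_P)
        also have "\<dots> = (\<Sum>p\<in>UNIV. \<Sum>q\<in>UNIV. G $ q $ p * P i q s p)" by (rule sum.swap)
        also have "\<dots> = (\<Sum>p\<in>UNIV. \<Sum>q\<in>UNIV. G $ p $ q * P q i p s)"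
          by (intro sum.cong refl arg_cong2[where f="(*)"] G_sym) (simp add: P_sym1[of i] P_sym2[of _ i s])
        finally show ?thesis by simp
      qed
      ultimately show ?thesis by (simp add: Y_def right_diff_distrib sum_subtractf)
    qed
    have 2: "(\<Sum>p\<in>UNIV. \<Sum>q\<in>UNIV. G $ p $ q * (H $ q $ p * H $ i $ s)) = real CARD('n) * H $ i $ s"
      by (simp add: mult.assoc[symmetric] sum_distrib_right[symmetric] GH)
    have 3: "(\<Sum>p\<in>UNIV. \<Sum>q\<in>UNIV. G $ p $ q * (H $ q $ i * H $ p $ s)) = H $ i $ s"
      by (simp add: mult.assoc[symmetric] sum_distrib_right[symmetric] GH if_distrib[of "\<lambda>u. u * _"] cong: if_cong)
    have "(\<Sum>p\<in>UNIV. \<Sum>q\<in>UNIV. G $ p $ q * (c * Y p i q s - l * (H $ q $ p * H $ i $ s - H $ q $ i * H $ p $ s)))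
      = c * (\<Sum>p\<in>UNIV. \<Sum>q\<in>UNIV. G $ p $ q * Y p i q s) - l * ((\<Sum>p\<in>UNIV. \<Sum>q\<in>UNIV. G $ p $ q * (H $ q $ p * H $ i $ s)) - (\<Sum>p\<in>UNIV. \<Sum>q\<in>UNIV. G $ p $ q * (H $ q $ i * H $ p $ s)))"
      unfolding sum_distrib_left sum_subtractf[symmetric] by (intro sum.cong refl) (simp add: algebra_simps)
    then show ?thesis unfolding 1 2 3 by (simp add: algebra_simps)
  qed
  have "(\<Sum>p\<in>UNIV. \<Sum>q\<in>UNIV. G $ p $ q * (\<Sum>i\<in>UNIV. \<Sum>j\<in>UNIV. G $ i $ j * (\<Sum>r\<in>UNIV. R p i q r * Q r j)))
    = (\<Sum>p\<in>UNIV. \<Sum>q\<in>UNIV. \<Sum>i\<in>UNIV. \<Sum>j\<in>UNIV. \<Sum>r\<in>UNIV. \<Sum>s\<in>UNIV. G $ p $ q * (G $ i $ j * (G $ s $ r *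
        (c * Y p i q s - l * (H $ q $ p * H $ i $ s - H $ q $ i * H $ p $ s)) * Q r j)))"
    unfolding R circledast_Y by (simp only: sum_distrib_left sum_distrib_right)
  also have "\<dots> = (\<Sum>i\<in>UNIV. \<Sum>j\<in>UNIV. \<Sum>p\<in>UNIV. \<Sum>q\<in>UNIV. \<Sum>r\<in>UNIV. \<Sum>s\<in>UNIV. G $ p $ q * (G $ i $ j * (G $ s $ r *
        (c * Y p i q s - l * (H $ q $ p * H $ i $ s - H $ q $ i * H $ p $ s)) * Q r j)))"
    by (rule sum_pull4)
  also have "\<dots> = (\<Sum>i\<in>UNIV. \<Sum>j\<in>UNIV. \<Sum>r\<in>UNIV. \<Sum>s\<in>UNIV. \<Sum>p\<in>UNIV. \<Sum>q\<in>UNIV. G $ p $ q * (G $ i $ j * (G $ s $ r *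
        (c * Y p i q s - l * (H $ q $ p * H $ i $ s - H $ q $ i * H $ p $ s)) * Q r j)))"
    by (intro sum.cong refl sum_pull4)
  also have "\<dots> = (\<Sum>i\<in>UNIV. \<Sum>j\<in>UNIV. \<Sum>r\<in>UNIV. \<Sum>s\<in>UNIV. G $ i $ j * (G $ s $ r * (Q r j *
        (\<Sum>p\<in>UNIV. \<Sum>q\<in>UNIV. G $ p $ q * (c * Y p i q s - l * (H $ q $ p * H $ i $ s - H $ q $ i * H $ p $ s))))))"
    by (simp only: sum_distrib_left mult_ac)
  also have "\<dots> = (\<Sum>i\<in>UNIV. \<Sum>j\<in>UNIV. \<Sum>r\<in>UNIV. \<Sum>s\<in>UNIV. - c * (G $ i $ j * (G $ s $ r * (Q i s * Q j r)))
       - l * (real CARD('n) - 1) * (G $ i $ j * (Q r j * (G $ s $ r * H $ s $ i))))"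
    unfolding tr using H_sym by (intro sum.cong refl) (simp add: algebra_simps Q_sym)
  also have "\<dots> = - c * (\<Sum>i\<in>UNIV. \<Sum>j\<in>UNIV. \<Sum>r\<in>UNIV. \<Sum>s\<in>UNIV. G $ i $ j * (G $ s $ r * (Q i s * Q j r)))
       - l * (real CARD('n) - 1) * (\<Sum>i\<in>UNIV. \<Sum>j\<in>UNIV. \<Sum>r\<in>UNIV. \<Sum>s\<in>UNIV. G $ i $ j * (Q r j * (G $ s $ r * H $ s $ i)))"
    by (simp only: sum_subtractf sum_distrib_left)
  also have "(\<Sum>i\<in>UNIV. \<Sum>j\<in>UNIV. \<Sum>r\<in>UNIV. \<Sum>s\<in>UNIV. G $ i $ j * (G $ s $ r * (Q i s * Q j r)))
      = norm_sq H 2 (rho H (circledast H (Suc (Suc m)) w))"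
    unfolding norm_sq_contr contr_2 rho_Q by (intro sum.cong refl, subst sum.swap, simp only: sum_distrib_left)
  also have "(\<Sum>i\<in>UNIV. \<Sum>j\<in>UNIV. \<Sum>r\<in>UNIV. \<Sum>s\<in>UNIV. G $ i $ j * (Q r j * (G $ s $ r * H $ s $ i)))
      = norm_sq H (Suc (Suc m)) w"
    by (simp add: sum_distrib_left[symmetric] GH' norm_Q if_distrib[of "\<lambda>u. _ * u"] cong: if_cong)
  finally show ?thesis .
qed

text \<open>A product of two metrics contracts to a renaming of indices.\<close>

lemma GH_GH:
  "(\<Sum>b\<in>UNIV. \<Sum>b'\<in>UNIV. G $ b $ b' * (\<Sum>s\<in>UNIV. \<Sum>r\<in>UNIV. G $ s $ r * (H $ b $ x * H $ y $ s * F b' r))) = F x y"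
proof -
  have "(\<Sum>b\<in>UNIV. \<Sum>b'\<in>UNIV. G $ b $ b' * (\<Sum>s\<in>UNIV. \<Sum>r\<in>UNIV. G $ s $ r * (H $ b $ x * H $ y $ s * F b' r)))
    = (\<Sum>b\<in>UNIV. \<Sum>b'\<in>UNIV. \<Sum>s\<in>UNIV. \<Sum>r\<in>UNIV. G $ b $ b' * (G $ s $ r * (H $ b $ x * H $ y $ s * F b' r)))"
    by (simp only: sum_distrib_left)
  also have "\<dots> = (\<Sum>b'\<in>UNIV. \<Sum>b\<in>UNIV. \<Sum>r\<in>UNIV. \<Sum>s\<in>UNIV. G $ b $ b' * (G $ s $ r * (H $ b $ x * H $ y $ s * F b' r)))"
    by (subst sum.swap) (intro sum.cong refl sum.swap)
  also have "\<dots> = (\<Sum>b'\<in>UNIV. \<Sum>r\<in>UNIV. \<Sum>b\<in>UNIV. \<Sum>s\<in>UNIV. G $ b $ b' * (G $ s $ r * (H $ b $ x * H $ y $ s * F b' r)))"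
    by (intro sum.cong refl sum.swap)
  also have "\<dots> = (\<Sum>b'\<in>UNIV. \<Sum>r\<in>UNIV. (\<Sum>b\<in>UNIV. G $ b $ b' * H $ b $ x) * (\<Sum>s\<in>UNIV. G $ s $ r * H $ s $ y) * F b' r)"
    unfolding sum_product by (simp only: sum_distrib_left sum_distrib_right H_sym[of y] mult_ac)
  also have "\<dots> = F x y"
    unfolding GH' mult.assoc sum_distrib_left[symmetric] by (simp add: if_distrib[of "\<lambda>u. u * _"] cong: if_cong)
  finally show ?thesis .
qed

text \<open>In the part with \<open>\<omega> \<circledast> \<omega>\<close> the antisymmetry of \<open>Y\<close> in its first two slots allows the other factor \<open>P\<close>
  to be antisymmetrised, and its antisymmetrisation is \<open>-Y/2\<close>; this is where \<open>|\<omega> \<circledast> \<omega>|\<^sup>2\<close> comes from. In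
  the part with \<open>h \<circledast> h\<close> one term is the squared norm of \<open>\<omega>\<close> and the other a trace of \<open>\<omega>\<close>, which is zero.\<close>

lemma riemann_term:
  "(\<Sum>p\<in>UNIV. \<Sum>q\<in>UNIV. G $ p $ q * (\<Sum>i\<in>UNIV. \<Sum>j\<in>UNIV. G $ i $ j * (\<Sum>b\<in>UNIV. \<Sum>b'\<in>UNIV. G $ b $ b' * (\<Sum>r\<in>UNIV. R p i b r * P q r j b'))))
    = - (c / 2) * norm_sq H 4 (circledast H (Suc (Suc m)) w) - l * norm_sq H (Suc (Suc m)) w"
proof -
  let ?K = "slot_form (\<lambda>q j b' r. P q r j b')"
  have "(\<Sum>p\<in>UNIV. \<Sum>q\<in>UNIV. G $ p $ q * (\<Sum>i\<in>UNIV. \<Sum>j\<in>UNIV. G $ i $ j * (\<Sum>b\<in>UNIV. \<Sum>b'\<in>UNIV. G $ b $ b' * (\<Sum>r\<in>UNIV. R p i b r * P q r j b'))))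
    = contr H 4 (slot_form (\<lambda>p i b s. c * Y p i b s - l * (H $ b $ p * H $ i $ s - H $ b $ i * H $ p $ s))) ?K"
  proof -
    have "(\<Sum>r\<in>UNIV. R p i b r * P q r j b') = (\<Sum>s\<in>UNIV. \<Sum>r\<in>UNIV. G $ s $ r *
         ((c * Y p i b s - l * (H $ b $ p * H $ i $ s - H $ b $ i * H $ p $ s)) * P q r j b'))" for p q i j b b'
      unfolding R circledast_Y sum_distrib_right by (subst sum.swap) (simp only: mult_ac)
    then show ?thesis unfolding contr_4 slot_form_4 by simp
  qed
  also have "\<dots> = c * contr H 4 (slot_form Y) ?K - l * (contr H 4 (slot_form (\<lambda>p i b s. H $ b $ p * H $ i $ s)) ?K
       - contr H 4 (slot_form (\<lambda>p i b s. H $ b $ i * H $ p $ s)) ?K)"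
    unfolding contr_4 slot_form_4 sum_distrib_left sum_subtractf[symmetric] by (intro sum.cong refl) (simp add: algebra_simps)
  also have "contr H 4 (slot_form (\<lambda>p i b s. H $ b $ p * H $ i $ s)) ?K = norm_sq H (Suc (Suc m)) w"
  proof -
    have "contr H 4 (slot_form (\<lambda>p i b s. H $ b $ p * H $ i $ s)) ?K =
      (\<Sum>p\<in>UNIV. \<Sum>q\<in>UNIV. G $ p $ q * (\<Sum>i\<in>UNIV. \<Sum>j\<in>UNIV. G $ i $ j * P q i j p))"
      unfolding contr_4 slot_form_4 GH_GH ..
    also have "\<dots> = (\<Sum>p\<in>UNIV. \<Sum>q\<in>UNIV. G $ p $ q * Q p q)"
    proof -
      have "(\<Sum>i\<in>UNIV. \<Sum>j\<in>UNIV. G $ i $ j * P q i j p) = Q p q" for p q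
        by (subst Q_sym, subst Q_P) (simp only: P_sym2[of q _ _ p])
      then show ?thesis by simp
    qed
    finally show ?thesis unfolding norm_Q .
  qed
  also have "contr H 4 (slot_form (\<lambda>p i b s. H $ b $ i * H $ p $ s)) ?K = 0"
  proof -
    have "contr H 4 (slot_form (\<lambda>p i b s. H $ b $ i * H $ p $ s)) ?K =
      contr H 4 (slot_form (\<lambda>i p b s. H $ b $ i * H $ p $ s)) (slot_form (\<lambda>j q b' r. P q r j b'))"
      by (rule contr_4_swap)
    also have "\<dots> = (\<Sum>i\<in>UNIV. \<Sum>j\<in>UNIV. G $ i $ j * (\<Sum>p\<in>UNIV. \<Sum>q\<in>UNIV. G $ p $ q * P p q j i))"
      unfolding contr_4 slot_form_4 GH_GH by (simp add: P_sym1)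
    also have "\<dots> = 0" by (simp add: trace_P)
    finally show ?thesis .
  qed
  also have "contr H 4 (slot_form Y) ?K = - (1 / 2) * norm_sq H 4 (circledast H (Suc (Suc m)) w)"
  proof -
    have Ya: "Y i p = (\<lambda>b q. - Y p i b q)" for p i by (simp add: Y_def fun_eq_iff)
    have n: "norm_sq H 4 (circledast H (Suc (Suc m)) w) = contr H 4 (slot_form Y) (slot_form Y)"
      unfolding norm_sq_contr contr_4 slot_form_4 circledast_Y ..
    have "contr H 4 (slot_form Y) ?K = contr H 4 (slot_form (\<lambda>p i b q. - Y p i b q)) (slot_form (\<lambda>j q b' r. P q r j b'))"
      unfolding Ya[symmetric] by (rule contr_4_swap)
    also have "\<dots> = - contr H 4 (slot_form Y) (slot_form (\<lambda>q j b' r. P j r q b'))"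
      unfolding contr_4 slot_form_4 by (simp add: sum_negf)
    finally have "2 * contr H 4 (slot_form Y) ?K = contr H 4 (slot_form Y) ?K - contr H 4 (slot_form Y) (slot_form (\<lambda>q j b' r. P j r q b'))"
      by simp
    also have "\<dots> = contr H 4 (slot_form Y) (\<lambda>I. (-1) * slot_form Y I)"
      unfolding contr_diff_right[symmetric]
    proof (intro contr_cong refl)
      fix I :: "'n list" assume "I \<in> multi_idx 4"
      then obtain q j b r where I: "I = [q, j, b, r]" by (rule multi_idx_4E)
      have "P q r j b = P b j q r" "P j r q b = P b q j r"
        by (metis P_sym P_sym1)+
      then show "?K I - slot_form (\<lambda>q j b' r. P j r q b') I = - 1 * slot_form Y I" by (simp add: I Y_def)
    qed
    finally show ?thesis unfolding n contr_scale_right by simp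
  qed
  finally show ?thesis by (simp add: algebra_simps)
qed

text \<open>Here \<open>S\<close> stands for the second covariant derivative of \<open>\<omega>\<close>. The Codazzi symmetry turns
  \<open>D\<^sub>pD\<^sub>q\<omega>\<^sub>i\<^sub>A\<close> into \<open>D\<^sub>pD\<^sub>i\<omega>\<^sub>q\<^sub>A\<close>; commuting the derivatives produces \<open>D\<^sub>iD\<^sub>p\<omega>\<^sub>q\<^sub>A\<close>, whose trace over
  \<open>p\<close> and \<open>q\<close> vanishes, and one curvature term for each index of \<open>\<omega>\<^sub>q\<^sub>A\<close>. The index \<open>q\<close> gives the
  Ricci term; the other \<open>k - 1\<close> indices contribute equally because \<open>\<omega>\<close> is symmetric.\<close>

lemma bochner_identity:
  assumes codazzi: "\<And>p q i A. A \<in> multi_idx (Suc m) \<Longrightarrow> S (p # q # i # A) = S (p # i # q # A)"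
    and trace: "\<And>i A. A \<in> multi_idx (Suc m) \<Longrightarrow> (\<Sum>p\<in>UNIV. \<Sum>q\<in>UNIV. G $ p $ q * S (i # p # q # A)) = 0"
    and ricci: "\<And>p i I. I \<in> multi_idx (Suc (Suc m)) \<Longrightarrow>
        S (p # i # I) - S (i # p # I) = - (\<Sum>a<Suc (Suc m). \<Sum>r\<in>UNIV. R p i (I ! a) r * w (I[a := r]))"
  shows "(\<Sum>p\<in>UNIV. \<Sum>q\<in>UNIV. G $ p $ q * contr H (Suc (Suc m)) (\<lambda>I. S (p # q # I)) w)
     = c * Lambda_form H (Suc (Suc m)) w + l * (real CARD('n) + real m) * norm_sq H (Suc (Suc m)) w"
proof -
  have S: "S (p # q # i # A) = S (i # p # q # A) - (\<Sum>r\<in>UNIV. R p i q r * w (r # A))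
      - (\<Sum>a<Suc m. \<Sum>r\<in>UNIV. R p i (A ! a) r * w (q # A[a := r]))" if A: "A \<in> multi_idx (Suc m)" for p q i A
    using codazzi[OF A, of p q i] ricci[of "q # A" p i] A
    by (simp add: sum.lessThan_Suc_shift del: sum.lessThan_Suc)
  have "contr H (Suc (Suc m)) (\<lambda>I. S (p # q # I)) w = (\<Sum>i\<in>UNIV. \<Sum>j\<in>UNIV. G $ i $ j *
      (contr H (Suc m) (\<lambda>A. S (i # p # q # A)) (\<lambda>B. w (j # B)) - (\<Sum>r\<in>UNIV. R p i q r * Q r j)
        - (real m + 1) * (\<Sum>b\<in>UNIV. \<Sum>b'\<in>UNIV. G $ b $ b' * (\<Sum>r\<in>UNIV. R p i b r * P q r j b'))))" for p q
  proof -
    have "contr H (Suc m) (\<lambda>A. S (p # q # i # A)) (\<lambda>B. w (j # B)) =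
      contr H (Suc m) (\<lambda>A. S (i # p # q # A)) (\<lambda>B. w (j # B)) - (\<Sum>r\<in>UNIV. R p i q r * Q r j)
        - (real m + 1) * (\<Sum>b\<in>UNIV. \<Sum>b'\<in>UNIV. G $ b $ b' * (\<Sum>r\<in>UNIV. R p i b r * P q r j b'))" for i j
    proof -
      have sl: "contr H (Suc m) (\<lambda>A. \<Sum>r\<in>UNIV. R p i (A ! a) r * w (q # A[a := r])) (\<lambda>B. w (j # B))
        = (\<Sum>b\<in>UNIV. \<Sum>b'\<in>UNIV. G $ b $ b' * (\<Sum>r\<in>UNIV. R p i b r * P q r j b'))" if "a < Suc m" for a
        unfolding pair_contr_def
        by (rule contr_slot_symmetric[OF symmetric_tensor_Cons[OF w] symmetric_tensor_Cons[OF w] that])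
      have "contr H (Suc m) (\<lambda>A. S (p # q # i # A)) (\<lambda>B. w (j # B)) =
        contr H (Suc m) (\<lambda>A. S (i # p # q # A) - (\<Sum>r\<in>UNIV. R p i q r * w (r # A))
          - (\<Sum>a<Suc m. \<Sum>r\<in>UNIV. R p i (A ! a) r * w (q # A[a := r]))) (\<lambda>B. w (j # B))"
        by (intro contr_cong S refl)
      also have "\<dots> = contr H (Suc m) (\<lambda>A. S (i # p # q # A)) (\<lambda>B. w (j # B)) - (\<Sum>r\<in>UNIV. R p i q r * Q r j)
        - (\<Sum>a<Suc m. \<Sum>b\<in>UNIV. \<Sum>b'\<in>UNIV. G $ b $ b' * (\<Sum>r\<in>UNIV. R p i b r * P q r j b'))"
      proof -
        have "contr H (Suc m) (\<lambda>A. \<Sum>a<Suc m. \<Sum>r\<in>UNIV. R p i (A ! a) r * w (q # A[a := r])) (\<lambda>B. w (j # B))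
          = (\<Sum>a<Suc m. \<Sum>b\<in>UNIV. \<Sum>b'\<in>UNIV. G $ b $ b' * (\<Sum>r\<in>UNIV. R p i b r * P q r j b'))"
          unfolding contr_sum_left[of H "Suc m" _ "{..<Suc m}"] by (intro sum.cong refl sl) simp
        moreover have "contr H (Suc m) (\<lambda>A. \<Sum>r\<in>UNIV. R p i q r * w (r # A)) (\<lambda>B. w (j # B)) = (\<Sum>r\<in>UNIV. R p i q r * Q r j)"
          by (simp add: contr_sum_left contr_scale_left Q_def)
        ultimately show ?thesis unfolding contr_diff_left by simp
      qed
      finally show ?thesis by (simp only: sum_constant card_lessThan of_nat_Suc add.commute)
    qed
    then show ?thesis by (subst contr_Suc) simp
  qed
  note eq = this
  have zero: "(\<Sum>p\<in>UNIV. \<Sum>q\<in>UNIV. G $ p $ q * (\<Sum>i\<in>UNIV. \<Sum>j\<in>UNIV. G $ i $ j * contr H (Suc m) (\<lambda>A. S (i # p # q # A)) (\<lambda>B. w (j # B)))) = 0"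
  proof -
    have z: "(\<Sum>p\<in>UNIV. \<Sum>q\<in>UNIV. G $ p $ q * contr H (Suc m) (\<lambda>A. S (i # p # q # A)) (\<lambda>B. w (j # B))) = 0" for i j
    proof -
      have "(\<Sum>p\<in>UNIV. \<Sum>q\<in>UNIV. G $ p $ q * contr H (Suc m) (\<lambda>A. S (i # p # q # A)) (\<lambda>B. w (j # B)))
        = contr H (Suc m) (\<lambda>A. \<Sum>p\<in>UNIV. \<Sum>q\<in>UNIV. G $ p $ q * S (i # p # q # A)) (\<lambda>B. w (j # B))"
        by (simp add: contr_sum_left contr_scale_left)
      also have "\<dots> = contr H (Suc m) (\<lambda>A. 0) (\<lambda>B. w (j # B))" by (intro contr_cong trace refl)
      finally show ?thesis by (simp add: contr_zero_left)
    qed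
    have "(\<Sum>p\<in>UNIV. \<Sum>q\<in>UNIV. G $ p $ q * (\<Sum>i\<in>UNIV. \<Sum>j\<in>UNIV. G $ i $ j * contr H (Suc m) (\<lambda>A. S (i # p # q # A)) (\<lambda>B. w (j # B))))
      = (\<Sum>i\<in>UNIV. \<Sum>j\<in>UNIV. \<Sum>p\<in>UNIV. \<Sum>q\<in>UNIV. G $ p $ q * (G $ i $ j * contr H (Suc m) (\<lambda>A. S (i # p # q # A)) (\<lambda>B. w (j # B))))"
      unfolding sum_distrib_left by (rule sum_pull4)
    also have "\<dots> = (\<Sum>i\<in>UNIV. \<Sum>j\<in>UNIV. G $ i $ j * (\<Sum>p\<in>UNIV. \<Sum>q\<in>UNIV. G $ p $ q * contr H (Suc m) (\<lambda>A. S (i # p # q # A)) (\<lambda>B. w (j # B))))"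
      by (simp only: sum_distrib_left mult.left_commute)
    finally show ?thesis by (simp add: z)
  qed
  have "(\<Sum>p\<in>UNIV. \<Sum>q\<in>UNIV. G $ p $ q * contr H (Suc (Suc m)) (\<lambda>I. S (p # q # I)) w)
     = (\<Sum>p\<in>UNIV. \<Sum>q\<in>UNIV. G $ p $ q * (\<Sum>i\<in>UNIV. \<Sum>j\<in>UNIV. G $ i $ j * contr H (Suc m) (\<lambda>A. S (i # p # q # A)) (\<lambda>B. w (j # B))))
      - (\<Sum>p\<in>UNIV. \<Sum>q\<in>UNIV. G $ p $ q * (\<Sum>i\<in>UNIV. \<Sum>j\<in>UNIV. G $ i $ j * (\<Sum>r\<in>UNIV. R p i q r * Q r j)))
      - (real m + 1) * (\<Sum>p\<in>UNIV. \<Sum>q\<in>UNIV. G $ p $ q * (\<Sum>i\<in>UNIV. \<Sum>j\<in>UNIV. G $ i $ j * (\<Sum>b\<in>UNIV. \<Sum>b'\<in>UNIV. G $ b $ b' * (\<Sum>r\<in>UNIV. R p i b r * P q r j b'))))"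
  proof -
    have alg: "(\<Sum>p\<in>UNIV. \<Sum>q\<in>UNIV. G $ p $ q * (\<Sum>i\<in>UNIV. \<Sum>j\<in>UNIV. G $ i $ j * (a p q i j - b p q i j - t * d p q i j)))
      = (\<Sum>p\<in>UNIV. \<Sum>q\<in>UNIV. G $ p $ q * (\<Sum>i\<in>UNIV. \<Sum>j\<in>UNIV. G $ i $ j * a p q i j))
      - (\<Sum>p\<in>UNIV. \<Sum>q\<in>UNIV. G $ p $ q * (\<Sum>i\<in>UNIV. \<Sum>j\<in>UNIV. G $ i $ j * b p q i j))
      - t * (\<Sum>p\<in>UNIV. \<Sum>q\<in>UNIV. G $ p $ q * (\<Sum>i\<in>UNIV. \<Sum>j\<in>UNIV. G $ i $ j * d p q i j))" for a b d t
      unfolding sum_distrib_left sum_subtractf[symmetric] by (intro sum.cong refl) (simp add: algebra_simps)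
    show ?thesis unfolding eq alg ..
  qed
  then show ?thesis
    unfolding zero ricci_term riemann_term Lambda_form_def by (simp add: field_simps)
qed

end

section \<open>Tensor calculus in a chart\<close>

lemma norm_sq_nonneg:
  fixes H :: "real^'n::finite^'n"
  assumes pos: "\<And>v. v \<noteq> 0 \<Longrightarrow> v \<bullet> (H *v v) > 0" and sym: "transpose H = H"
  shows "norm_sq H r w \<ge> 0"
proof -
  obtain E :: "real^'n^'n" where E: "transpose E ** H ** E = mat 1" using orthonormal_frame[OF pos sym] .
  have inv: "invertible H" using pos_def_det_pos[OF pos sym] by (simp add: invertible_det_nz)
  have "det (transpose E ** H ** E) = 1" using E by simp
  then have "invertible E" by (auto simp: det_mul invertible_det_nz)
  from contr_change_basis[OF inv this, of r w w] have "norm_sq H r w = norm_sq (mat 1 :: real^'n^'n) r (change_basis E r w)"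
    by (simp add: E norm_sq_contr)
  then show ?thesis by (simp add: norm_sq_mat_1 sum_nonneg)
qed

text \<open>Cramer's rule exhibits the entries of the inverse as rational functions of the entries of \<open>A\<close>, so
  the inverse metric is smooth.\<close>

lemma matrix_inv_cramer:
  fixes A :: "real^'n::finite^'n"
  assumes "det A \<noteq> 0"
  shows "matrix_inv A $ k $ j = det (\<chi> i l. if l = k then (axis j 1 :: real^'n) $ i else A $ i $ l) / det A"
proof -
  have inv: "A ** matrix_inv A = mat 1" using assms matrix_inv_mult(1) invertible_det_nz by blast
  have "A *v column j (matrix_inv A) = column j (A ** matrix_inv A)"
    by (simp add: column_def matrix_vector_mult_def matrix_matrix_mult_def vec_eq_iff)
  also have "\<dots> = axis j 1" unfolding inv by (simp add: column_def mat_def axis_def vec_eq_iff)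
  finally have "column j (matrix_inv A) = (\<chi> k. det (\<chi> i l. if l = k then (axis j 1 :: real^'n) $ i else A $ i $ l) / det A)"
    using cramer[OF assms] by blast
  then show ?thesis by (simp add: column_def vec_eq_iff)
qed

lemma differentiable_prod:
  fixes f :: "'a \<Rightarrow> real^'m \<Rightarrow> real"
  assumes "\<And>a. f a differentiable (at x)"
  shows "(\<lambda>x. \<Prod>a\<in>A. f a x) differentiable (at x)"
  unfolding differentiable_def by (intro exI, rule has_derivative_prod, rule differentiable_has_derivative[OF assms])

lemma delta_sum:
  fixes f :: "'n::finite \<Rightarrow> real"
  shows "(\<Sum>s\<in>UNIV. (if j = s then 1 else 0) * f s) = f j" "(\<Sum>s\<in>UNIV. (if s = j then 1 else 0) * f s) = f j"
    "(\<Sum>s\<in>UNIV. f s * (if j = s then 1 else 0)) = f j" "(\<Sum>s\<in>UNIV. f s * (if s = j then 1 else 0)) = f j"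
  by (simp_all add: if_distrib[of "\<lambda>u. u * _"] if_distrib[of "\<lambda>u. _ * u"] cong: if_cong)

text \<open>The differential of the determinant at the identity is the trace: a permutation other than the
  identity moves at least two points, so its product still contains a vanishing entry after one factor
  has been differentiated.\<close>

lemma det_near_identity:
  fixes N :: "real^'m \<Rightarrow> real^'n::finite^'n"
  assumes d: "\<And>i j. (\<lambda>y. N y $ i $ j) differentiable (at x)" and N: "N x = mat 1"
  shows "pd m (\<lambda>y. det (N y)) x = (\<Sum>i\<in>UNIV. pd m (\<lambda>y. N y $ i $ i) x)"
proof -
  have dp: "(\<lambda>y. \<Prod>i\<in>UNIV. N y $ i $ p i) differentiable (at x)" for p
    by (rule differentiable_prod[OF d])
  have prod: "(\<Sum>i\<in>UNIV. pd m (\<lambda>y. N y $ i $ p i) x * (\<Prod>j\<in>UNIV - {i}. N x $ j $ p j))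
     = (if p = id then \<Sum>i\<in>UNIV. pd m (\<lambda>y. N y $ i $ i) x else 0)" if p: "p permutes UNIV" for p
  proof (cases "p = id")
    case False
    have "(\<Prod>j\<in>UNIV - {i}. N x $ j $ p j) = 0" for i
    proof -
      obtain a where a: "p a \<noteq> a" using False by (auto simp: fun_eq_iff)
      have "p (p a) \<noteq> p a" using a permutes_inj[OF p] by (auto dest: injD)
      \<comment> \<open>Both \<open>a\<close> and \<open>p a\<close> are moved, so one of them differs from \<open>i\<close>.\<close>
      then obtain b where "b \<noteq> i" "p b \<noteq> b" using a by metis
      then have "b \<in> UNIV - {i}" "N x $ b $ p b = 0" by (auto simp: N mat_1_nth)
      then show ?thesis by (intro prod_zero) auto
    qed
    then show ?thesis using False by (simp only: mult_zero_right sum.neutral_const if_False)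
  qed (simp add: N mat_1_nth)
  have "pd m (\<lambda>y. det (N y)) x = (\<Sum>p | p permutes UNIV. of_int (sign p) * (\<Sum>i\<in>UNIV. pd m (\<lambda>y. N y $ i $ p i) x * (\<Prod>j\<in>UNIV - {i}. N x $ j $ p j)))"
    unfolding det_def by (subst pd_sum) (simp_all add: dp pd_cmult differentiable_mult pd_prod d)
  also have "\<dots> = (\<Sum>p | p permutes (UNIV :: 'n set). if p = id then (\<Sum>i\<in>UNIV. pd m (\<lambda>y. N y $ i $ i) x) else 0)"
    by (intro sum.cong refl) (auto simp: prod sign_id)
  also have "\<dots> = (\<Sum>i\<in>UNIV. pd m (\<lambda>y. N y $ i $ i) x)"
    by (simp add: permutes_id finite_permutations)
  finally show ?thesis .
qed

text \<open>Jacobi's formula, reduced to the identity matrix by writing \<open>H y = H x (H x)\<^sup>-\<^sup>1 H y\<close>.\<close>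

lemma pd_det:
  fixes H :: "real^'m \<Rightarrow> real^'n::finite^'n"
  assumes d: "\<And>i j. (\<lambda>y. H y $ i $ j) differentiable (at x)" and inv: "invertible (H x)"
  shows "pd m (\<lambda>y. det (H y)) x = det (H x) * (\<Sum>i\<in>UNIV. \<Sum>j\<in>UNIV. matrix_inv (H x) $ i $ j * pd m (\<lambda>y. H y $ j $ i) x)"
proof -
  let ?N = "\<lambda>y. matrix_inv (H x) ** H y"
  have nth: "(\<lambda>y. ?N y $ i $ k) = (\<lambda>y. \<Sum>j\<in>UNIV. matrix_inv (H x) $ i $ j * H y $ j $ k)" for i k
    by (simp add: matrix_matrix_mult_def)
  have dN: "(\<lambda>y. ?N y $ i $ k) differentiable (at x)" for i k
    unfolding nth by (intro differentiable_sum differentiable_mult) (auto simp: d)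
  have "H y = H x ** ?N y" for y by (simp add: matrix_mul_assoc matrix_inv_mult[OF inv])
  then have det: "det (H y) = det (H x) * det (?N y)" for y by (metis det_mul)
  have dd: "(\<lambda>y. det (?N y)) differentiable (at x)"
    unfolding det_def
    by (intro differentiable_sum differentiable_mult differentiable_prod dN differentiable_const ballI) (rule finite_permutations, simp)
  have "pd m (\<lambda>y. det (H y)) x = det (H x) * pd m (\<lambda>y. det (?N y)) x"
    by (subst det) (rule pd_cmult[OF dd])
  also have "pd m (\<lambda>y. det (?N y)) x = (\<Sum>i\<in>UNIV. pd m (\<lambda>y. ?N y $ i $ i) x)"
    by (rule det_near_identity[OF dN]) (simp add: matrix_inv_mult[OF inv])
  finally show ?thesis unfolding nth by (simp add: pd_sum pd_cmult d differentiable_mult)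
qed

text \<open>The calculus in one chart: \<open>S\<close> is the range of the chart and \<open>g\<close> the metric in its coordinates.\<close>

locale riemannian_chart =
  fixes S :: "(real^'n::finite) set" and g :: "real^'n \<Rightarrow> 'n tensor"
  assumes S: "open S" and g_smooth: "\<And>i j. smooth_fun_on S (\<lambda>x. g x [i, j])"
    and pos: "\<And>x v. x \<in> S \<Longrightarrow> v \<noteq> 0 \<Longrightarrow> v \<bullet> (gram (g x) *v v) > 0"
    and sym: "\<And>x. x \<in> S \<Longrightarrow> transpose (gram (g x)) = gram (g x)"
begin

abbreviation "H x \<equiv> gram (g x)"
abbreviation "G x \<equiv> matrix_inv (H x)"
abbreviation "\<Gamma> \<equiv> christoffel g"
abbreviation "D \<equiv> cov_deriv g"

definition smooth_field :: "nat \<Rightarrow> (real^'n \<Rightarrow> 'n tensor) \<Rightarrow> bool" where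
  "smooth_field r T \<longleftrightarrow> (\<forall>I\<in>multi_idx r. smooth_fun_on S (\<lambda>x. T x I))"

lemma H_nth: "H x $ i $ j = g x [i, j]" by (simp add: gram_def)

lemma H_smooth: "smooth_fun_on S (\<lambda>x. H x $ i $ j)"
  unfolding H_nth by (rule g_smooth)

lemma det_pos: "x \<in> S \<Longrightarrow> det (H x) > 0"
  using pos_def_det_pos[OF pos sym] by blast

lemma inv: "x \<in> S \<Longrightarrow> invertible (H x)"
  using det_pos invertible_det_nz by (metis less_irrefl)

lemma g_sym: "x \<in> S \<Longrightarrow> g x [i, j] = g x [j, i]"
  using arg_cong[OF sym, of x "\<lambda>A. A $ j $ i"] by (simp add: transpose_def H_nth)

lemma G_symm: "x \<in> S \<Longrightarrow> G x $ i $ j = G x $ j $ i"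
  using arg_cong[OF matrix_inv_symmetric[OF inv sym], of x "\<lambda>A. A $ j $ i"] by (simp add: transpose_def)

lemma GH: "x \<in> S \<Longrightarrow> (\<Sum>q\<in>UNIV. G x $ p $ q * g x [q, r]) = (if p = r then 1 else 0)"
  using arg_cong[OF matrix_inv_mult(2)[OF inv], of x "\<lambda>A. A $ p $ r"]
  by (simp add: matrix_matrix_mult_def mat_1_nth H_nth)

lemma HG: "x \<in> S \<Longrightarrow> (\<Sum>q\<in>UNIV. g x [p, q] * G x $ q $ r) = (if p = r then 1 else 0)"
  using arg_cong[OF matrix_inv_mult(1)[OF inv], of x "\<lambda>A. A $ p $ r"]
  by (simp add: matrix_matrix_mult_def mat_1_nth H_nth)

lemma G_smooth: "smooth_fun_on S (\<lambda>x. G x $ i $ j)"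
proof -
  have "smooth_fun_on S (\<lambda>x. det (\<chi> a l. if l = i then (axis j 1 :: real^'n) $ a else H x $ a $ l) / det (H x))"
  proof (intro smooth_divide smooth_det S H_smooth)
    show "smooth_fun_on S (\<lambda>x. (\<chi> a l. if l = i then (axis j 1 :: real^'n) $ a else H x $ a $ l) $ b $ c)" for b c
      by (cases "c = i") (simp_all add: H_smooth)
    show "det (H x) \<noteq> 0" if "x \<in> S" for x using det_pos[OF that] by simp
  qed
  moreover have "G x $ i $ j = det (\<chi> a l. if l = i then (axis j 1 :: real^'n) $ a else H x $ a $ l) / det (H x)" if "x \<in> S" for x
    by (rule matrix_inv_cramer) (use det_pos[OF that] in simp)
  ultimately show ?thesis using smooth_cong[OF S] by (metis (no_types, lifting))
qed

lemma christoffel_smooth: "smooth_fun_on S (\<lambda>x. \<Gamma> x i j p)"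
  unfolding christoffel_def
  by (intro smooth_divide smooth_sum smooth_mult smooth_add smooth_diff smooth_const G_smooth smooth_fun_on_pd g_smooth S) simp_all

lemma differentiable_in_chart: "smooth_fun_on S f \<Longrightarrow> x \<in> S \<Longrightarrow> f differentiable (at x)"
  using smooth_differentiable_at S by blast

lemma christoffel_sym:
  assumes "x \<in> S" shows "\<Gamma> x i j p = \<Gamma> x j i p"
proof -
  have "pd q (\<lambda>y. g y [i, j]) x = pd q (\<lambda>y. g y [j, i]) x" for q
    by (rule pd_cong[OF S assms g_sym])
  then show ?thesis unfolding christoffel_def by (simp add: add.commute)
qed

text \<open>Lowering the last index gives the Christoffel symbols of the first kind.\<close>

lemma christoffel_lower:
  assumes x: "x \<in> S"
  shows "(\<Sum>q\<in>UNIV. \<Gamma> x m i q * g x [q, j]) = (pd m (\<lambda>y. g y [i, j]) x + pd i (\<lambda>y. g y [m, j]) x - pd j (\<lambda>y. g y [m, i]) x) / 2"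
proof -
  let ?c = "\<lambda>s. pd m (\<lambda>y. g y [i, s]) x + pd i (\<lambda>y. g y [m, s]) x - pd s (\<lambda>y. g y [m, i]) x"
  have "(\<Sum>q\<in>UNIV. \<Gamma> x m i q * g x [q, j]) = (\<Sum>q\<in>UNIV. \<Sum>s\<in>UNIV. g x [j, q] * G x $ q $ s * (?c s / 2))"
    unfolding christoffel_def by (simp add: sum_distrib_left sum_distrib_right sum_divide_distrib g_sym[OF x, of _ j] mult_ac)
  also have "\<dots> = (\<Sum>s\<in>UNIV. (\<Sum>q\<in>UNIV. g x [j, q] * G x $ q $ s) * (?c s / 2))"
    by (subst sum.swap) (simp only: sum_distrib_right)
  also have "\<dots> = ?c j / 2"
    unfolding HG[OF x] delta_sum ..
  finally show ?thesis .
qed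

text \<open>This says that the covariant derivative of the metric is zero.\<close>

lemma pd_metric:
  assumes x: "x \<in> S"
  shows "pd m (\<lambda>y. g y [i, j]) x = (\<Sum>q\<in>UNIV. \<Gamma> x m i q * g x [q, j]) + (\<Sum>q\<in>UNIV. \<Gamma> x m j q * g x [i, q])"
proof -
  have "pd q (\<lambda>y. g y [a, b]) x = pd q (\<lambda>y. g y [b, a]) x" for q a b
    by (rule pd_cong[OF S x g_sym])
  from this[of m i j]
  have "(\<Sum>q\<in>UNIV. \<Gamma> x m i q * g x [q, j]) + (\<Sum>q\<in>UNIV. \<Gamma> x m j q * g x [q, i]) = pd m (\<lambda>y. g y [i, j]) x"
    unfolding christoffel_lower[OF x] by (simp add: field_simps)
  then show ?thesis by (simp add: g_sym[OF x, of _ i])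
qed

text \<open>The covariant derivative of the inverse metric is zero as well; this follows by differentiating
  \<open>h\<^sup>i\<^sup>b h\<^sub>b\<^sub>k = \<delta>\<^sup>i\<^sub>k\<close>.\<close>

lemma pd_inverse_metric:
  assumes x: "x \<in> S"
  shows "pd m (\<lambda>y. G y $ i $ j) x = - (\<Sum>a\<in>UNIV. \<Gamma> x m a j * G x $ i $ a) - (\<Sum>a\<in>UNIV. \<Gamma> x m a i * G x $ a $ j)"
proof -
  \<comment> \<open>Differentiate the relation between the metric and its inverse; the other factor is then inverted.\<close>
  have z: "(\<Sum>b\<in>UNIV. pd m (\<lambda>y. G y $ i $ b) x * g x [b, k]) = - (\<Sum>b\<in>UNIV. G x $ i $ b * pd m (\<lambda>y. g y [b, k]) x)" for k
  proof -
    have "pd m (\<lambda>y. \<Sum>b\<in>UNIV. G y $ i $ b * g y [b, k]) x = pd m (\<lambda>y. if i = k then 1 else 0) x"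
      by (rule pd_cong[OF S x GH])
    also have "\<dots> = 0" by (rule pd_const)
    also have "pd m (\<lambda>y. \<Sum>b\<in>UNIV. G y $ i $ b * g y [b, k]) x =
        (\<Sum>b\<in>UNIV. pd m (\<lambda>y. G y $ i $ b) x * g x [b, k] + G x $ i $ b * pd m (\<lambda>y. g y [b, k]) x)"
      by (simp add: pd_sum pd_mult differentiable_mult differentiable_in_chart[OF G_smooth x] differentiable_in_chart[OF g_smooth x])
    finally show ?thesis by (simp add: sum.distrib)
  qed
  have "pd m (\<lambda>y. G y $ i $ j) x = (\<Sum>b\<in>UNIV. pd m (\<lambda>y. G y $ i $ b) x * (\<Sum>k\<in>UNIV. g x [b, k] * G x $ k $ j))"
    unfolding HG[OF x] delta_sum ..
  also have "\<dots> = (\<Sum>k\<in>UNIV. (\<Sum>b\<in>UNIV. pd m (\<lambda>y. G y $ i $ b) x * g x [b, k]) * G x $ k $ j)"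
    unfolding sum_distrib_left sum_distrib_right by (subst sum.swap) (simp only: mult.assoc)
  also have "\<dots> = - (\<Sum>k\<in>UNIV. \<Sum>b\<in>UNIV. G x $ i $ b * pd m (\<lambda>y. g y [b, k]) x * G x $ k $ j)"
    unfolding z by (simp add: sum_negf sum_distrib_right)
  also have "(\<Sum>k\<in>UNIV. \<Sum>b\<in>UNIV. G x $ i $ b * pd m (\<lambda>y. g y [b, k]) x * G x $ k $ j) =
     (\<Sum>k\<in>UNIV. \<Sum>b\<in>UNIV. \<Sum>q\<in>UNIV. G x $ i $ b * \<Gamma> x m b q * (g x [q, k] * G x $ k $ j))
     + (\<Sum>k\<in>UNIV. \<Sum>b\<in>UNIV. \<Sum>q\<in>UNIV. G x $ k $ j * \<Gamma> x m k q * (G x $ i $ b * g x [b, q]))"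
    unfolding pd_metric[OF x] by (simp add: sum_distrib_left sum_distrib_right sum.distrib algebra_simps)
  also have "(\<Sum>k\<in>UNIV. \<Sum>b\<in>UNIV. \<Sum>q\<in>UNIV. G x $ i $ b * \<Gamma> x m b q * (g x [q, k] * G x $ k $ j)) = (\<Sum>a\<in>UNIV. \<Gamma> x m a j * G x $ i $ a)"
  proof -
    have "(\<Sum>k\<in>UNIV. \<Sum>b\<in>UNIV. \<Sum>q\<in>UNIV. G x $ i $ b * \<Gamma> x m b q * (g x [q, k] * G x $ k $ j))
       = (\<Sum>b\<in>UNIV. \<Sum>q\<in>UNIV. G x $ i $ b * \<Gamma> x m b q * (\<Sum>k\<in>UNIV. g x [q, k] * G x $ k $ j))"
      unfolding sum_distrib_left by (rule sum_rot3[symmetric])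
    then show ?thesis unfolding HG[OF x] delta_sum by (simp add: mult.commute)
  qed
  also have "(\<Sum>k\<in>UNIV. \<Sum>b\<in>UNIV. \<Sum>q\<in>UNIV. G x $ k $ j * \<Gamma> x m k q * (G x $ i $ b * g x [b, q])) = (\<Sum>a\<in>UNIV. \<Gamma> x m a i * G x $ a $ j)"
  proof -
    have "(\<Sum>k\<in>UNIV. \<Sum>b\<in>UNIV. \<Sum>q\<in>UNIV. G x $ k $ j * \<Gamma> x m k q * (G x $ i $ b * g x [b, q]))
       = (\<Sum>k\<in>UNIV. \<Sum>q\<in>UNIV. G x $ k $ j * \<Gamma> x m k q * (\<Sum>b\<in>UNIV. G x $ i $ b * g x [b, q]))"
      unfolding sum_distrib_left by (intro sum.cong refl sum.swap)
    then show ?thesis unfolding GH[OF x] delta_sum by (simp add: mult.commute)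
  qed
  finally show ?thesis by simp
qed

lemma cov_deriv_eq: "D T x (i # I) = pd i (\<lambda>y. T y I) x - (\<Sum>a<length I. \<Sum>p\<in>UNIV. \<Gamma> x i (I ! a) p * T x (I[a := p]))"
  by (simp add: cov_deriv_def)

text \<open>The first index of a tensor may be treated as a spectator, at the price of one Christoffel term.
  This lets statements about contractions be proved by induction on the rank.\<close>

lemma cov_deriv_Cons:
  "D T x (i # j # I) = D (\<lambda>y I. T y (j # I)) x (i # I) - (\<Sum>p\<in>UNIV. \<Gamma> x i j p * T x (p # I))"
  unfolding cov_deriv_eq by (simp add: sum.lessThan_Suc_shift del: sum.lessThan_Suc)

lemma smooth_field_Cons: "smooth_field (Suc r) T \<Longrightarrow> smooth_field r (\<lambda>y I. T y (j # I))"
  by (simp add: smooth_field_def)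

lemma smooth_field_cov_deriv:
  assumes T: "smooth_field r T"
  shows "smooth_field (Suc r) (D T)"
  unfolding smooth_field_def
proof
  fix L :: "'n list" assume "L \<in> multi_idx (Suc r)"
  then obtain i I where L: "L = i # I" and I: "I \<in> multi_idx r" by (auto simp: multi_idx_Suc)
  have "smooth_fun_on S (\<lambda>x. T x (I[a := p]))" for a p
    using T I unfolding smooth_field_def by (simp add: multi_idx_def)
  moreover have "smooth_fun_on S (pd i (\<lambda>y. T y I))"
    using T I unfolding smooth_field_def by (intro smooth_fun_on_pd) auto
  ultimately show "smooth_fun_on S (\<lambda>x. D T x L)"
    unfolding L cov_deriv_eq by (intro smooth_diff smooth_sum smooth_mult christoffel_smooth S)
qed

lemma contr_smooth:
  "smooth_field r T \<Longrightarrow> smooth_field r U \<Longrightarrow> smooth_fun_on S (\<lambda>x. contr (H x) r (T x) (U x))"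
proof (induction r arbitrary: T U)
  case 0
  then show ?case by (simp add: smooth_field_def smooth_mult[OF S])
next
  case (Suc r)
  show ?case unfolding contr_Suc
    by (intro smooth_sum smooth_mult S G_smooth Suc.IH smooth_field_Cons Suc.prems)
qed

text \<open>Metric compatibility: the Christoffel terms of the two factors cancel the derivatives of the
  inverse metric, one index at a time.\<close>
lemma pd_contr:
  assumes x: "x \<in> S"
  shows "smooth_field r T \<Longrightarrow> smooth_field r U \<Longrightarrow>
    pd m (\<lambda>y. contr (H y) r (T y) (U y)) x =
      contr (H x) r (\<lambda>I. D T x (m # I)) (U x) + contr (H x) r (T x) (\<lambda>I. D U x (m # I))"
proof (induction r arbitrary: T U)
  case 0
  then have "(\<lambda>y. T y []) differentiable (at x)" "(\<lambda>y. U y []) differentiable (at x)"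
    using differentiable_in_chart[OF _ x] by (auto simp: smooth_field_def)
  then show ?case by (simp add: pd_mult cov_deriv_eq)
next
  case (Suc r)
  let ?T = "\<lambda>i y I. T y (i # I)" and ?U = "\<lambda>i y I. U y (i # I)"
  have sT: "smooth_field r (?T i)" and sU: "smooth_field r (?U i)" for i
    using Suc.prems smooth_field_Cons by auto
  let ?C = "\<lambda>i j. contr (H x) r (?T i x) (?U j x)"
  have "pd m (\<lambda>y. contr (H y) (Suc r) (T y) (U y)) x =
     (\<Sum>i\<in>UNIV. \<Sum>j\<in>UNIV. pd m (\<lambda>y. G y $ i $ j) x * ?C i j + G x $ i $ j * pd m (\<lambda>y. contr (H y) r (?T i y) (?U j y)) x)"
    unfolding contr_Suc
    by (simp add: pd_sum pd_mult differentiable_sum differentiable_mult differentiable_in_chart[OF G_smooth x]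
         differentiable_in_chart[OF contr_smooth[OF sT sU] x])
  also have "\<dots> = (\<Sum>i\<in>UNIV. \<Sum>j\<in>UNIV. G x $ i $ j * (contr (H x) r (\<lambda>I. D (?T i) x (m # I)) (?U j x) + contr (H x) r (?T i x) (\<lambda>I. D (?U j) x (m # I))))
     - (\<Sum>i\<in>UNIV. \<Sum>j\<in>UNIV. \<Sum>a\<in>UNIV. \<Gamma> x m a j * G x $ i $ a * ?C i j) - (\<Sum>i\<in>UNIV. \<Sum>j\<in>UNIV. \<Sum>a\<in>UNIV. \<Gamma> x m a i * G x $ a $ j * ?C i j)"
    unfolding Suc.IH[OF sT sU] pd_inverse_metric[OF x]
    by (simp add: sum.distrib sum_subtractf sum_distrib_left sum_distrib_right algebra_simps)
  also have "(\<Sum>i\<in>UNIV. \<Sum>j\<in>UNIV. \<Sum>a\<in>UNIV. \<Gamma> x m a j * G x $ i $ a * ?C i j) = (\<Sum>i\<in>UNIV. \<Sum>j\<in>UNIV. G x $ i $ j * (\<Sum>p\<in>UNIV. \<Gamma> x m j p * ?C i p))"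
    unfolding sum_distrib_left by (rule sum.cong[OF refl], subst sum.swap, simp only: mult_ac)
  also have "(\<Sum>i\<in>UNIV. \<Sum>j\<in>UNIV. \<Sum>a\<in>UNIV. \<Gamma> x m a i * G x $ a $ j * ?C i j) = (\<Sum>i\<in>UNIV. \<Sum>j\<in>UNIV. G x $ i $ j * (\<Sum>p\<in>UNIV. \<Gamma> x m i p * ?C p j))"
    unfolding sum_distrib_left by (subst sum_rot3, rule sum.cong[OF refl], subst sum.swap, simp only: mult_ac)
  also have "(\<Sum>i\<in>UNIV. \<Sum>j\<in>UNIV. G x $ i $ j * (contr (H x) r (\<lambda>I. D (?T i) x (m # I)) (?U j x) + contr (H x) r (?T i x) (\<lambda>I. D (?U j) x (m # I))))
      - (\<Sum>i\<in>UNIV. \<Sum>j\<in>UNIV. G x $ i $ j * (\<Sum>p\<in>UNIV. \<Gamma> x m j p * ?C i p)) - (\<Sum>i\<in>UNIV. \<Sum>j\<in>UNIV. G x $ i $ j * (\<Sum>p\<in>UNIV. \<Gamma> x m i p * ?C p j))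
     = (\<Sum>i\<in>UNIV. \<Sum>j\<in>UNIV. G x $ i $ j * ((contr (H x) r (\<lambda>I. D (?T i) x (m # I)) (?U j x) - (\<Sum>p\<in>UNIV. \<Gamma> x m i p * ?C p j))
         + (contr (H x) r (?T i x) (\<lambda>I. D (?U j) x (m # I)) - (\<Sum>p\<in>UNIV. \<Gamma> x m j p * ?C i p))))"
    unfolding sum_subtractf[symmetric] by (intro sum.cong refl) (simp add: algebra_simps)
  also have "\<dots> = contr (H x) (Suc r) (\<lambda>I. D T x (m # I)) (U x) + contr (H x) (Suc r) (T x) (\<lambda>I. D U x (m # I))"
    unfolding contr_Suc sum.distrib[symmetric]
    by (simp add: cov_deriv_Cons contr_diff_left contr_diff_right contr_sum_left contr_sum_right contr_scale_left contr_scale_right distrib_left)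
  finally show ?case .
qed

text \<open>The curvature is read off from the coordinate forms, whose first covariant derivatives are minus the
  Christoffel symbols.\<close>

lemma curvature_christoffel:
  assumes x: "x \<in> S"
  shows "curvature g x i j k p = pd i (\<lambda>y. \<Gamma> y j k p) x - pd j (\<lambda>y. \<Gamma> y i k p) x
     - (\<Sum>q\<in>UNIV. \<Gamma> x i k q * \<Gamma> x j q p) + (\<Sum>q\<in>UNIV. \<Gamma> x j k q * \<Gamma> x i q p)"
proof -
  have D1: "D (coord_form p) y [a, b] = - \<Gamma> y a b p" for y a b
  proof -
    have "coord_form p y ([b][0 := q]) = (if p = q then 1 else 0)" for q by (auto simp: coord_form_def)
    moreover have "pd a (\<lambda>y. coord_form p y [b]) y = 0" by (simp add: coord_form_def)
    ultimately show ?thesis by (simp add: cov_deriv_eq delta_sum)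
  qed
  have D2: "D (D (coord_form p)) x [a, b, k] = - pd a (\<lambda>y. \<Gamma> y b k p) x + (\<Sum>q\<in>UNIV. \<Gamma> x a b q * \<Gamma> x q k p) + (\<Sum>q\<in>UNIV. \<Gamma> x a k q * \<Gamma> x b q p)" for a b
    unfolding cov_deriv_eq[of "D (coord_form p)"]
    by (simp add: D1 pd_minus differentiable_in_chart[OF christoffel_smooth x] sum_negf)
  show ?thesis
    unfolding curvature_def D2 by (simp add: christoffel_sym[OF x, of j i])
qed

text \<open>The Ricci identity for tensors of any rank: the terms in which two different indices are hit
  are symmetric in the two directions of differentiation, so only the terms that hit one index twice
  survive, and these make up the curvature.\<close>
lemma ricci_identity:
  assumes x: "x \<in> S" and T: "smooth_field r T" and I: "I \<in> multi_idx r"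
  shows "D (D T) x (i # j # I) - D (D T) x (j # i # I) =
     - (\<Sum>a<r. \<Sum>p\<in>UNIV. curvature g x i j (I ! a) p * T x (I[a := p]))"
proof -
  have len: "length I = r" using I by (simp add: multi_idx_def)
  have Tsm: "smooth_fun_on S (\<lambda>x. T x J)" if "length J = r" for J
    using T that by (simp add: smooth_field_def multi_idx_def)
  \<comment> \<open>\<open>?diag\<close> collects the terms in which one index is hit twice, \<open>?off\<close> those with two different indices; \<open>?first\<close> and \<open>?der\<close> contain the derivatives of \<open>T\<close> and of the Christoffel symbols.\<close>
  let ?off = "\<lambda>i j a b. \<Sum>p\<in>UNIV. \<Sum>q\<in>UNIV. if b = a then 0 else \<Gamma> x i (I ! a) p * \<Gamma> x j (I ! b) q * T x (I[a := p, b := q])"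
  let ?diag = "\<lambda>i j. \<Sum>a<r. \<Sum>p\<in>UNIV. (\<Sum>q\<in>UNIV. \<Gamma> x i (I ! a) q * \<Gamma> x j q p) * T x (I[a := p])"
  let ?first = "\<lambda>i j. \<Sum>a<r. \<Sum>p\<in>UNIV. \<Gamma> x i (I ! a) p * pd j (\<lambda>y. T y (I[a := p])) x"
  let ?der = "\<lambda>i j. \<Sum>a<r. \<Sum>p\<in>UNIV. pd i (\<lambda>y. \<Gamma> y j (I ! a) p) x * T x (I[a := p])"
  have main: "D (D T) x (i # j # I) = pd i (pd j (\<lambda>y. T y I)) x - ?der i j - ?first j i - ?first i j
      - (\<Sum>p\<in>UNIV. \<Gamma> x i j p * D T x (p # I)) + ?diag i j + (\<Sum>a<r. \<Sum>b<r. ?off i j a b)" for i j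
  proof -
    have "D (D T) x (i # j # I) = pd i (\<lambda>y. D T y (j # I)) x - (\<Sum>p\<in>UNIV. \<Gamma> x i j p * D T x (p # I))
        - (\<Sum>a<r. \<Sum>p\<in>UNIV. \<Gamma> x i (I ! a) p * D T x (j # I[a := p]))"
      unfolding cov_deriv_Cons[of "D T"] by (subst cov_deriv_eq) (simp add: len)
    moreover have "pd i (\<lambda>y. D T y (j # I)) x = pd i (pd j (\<lambda>y. T y I)) x - ?der i j - ?first j i"
      unfolding cov_deriv_eq len
      by (simp add: pd_diff pd_sum pd_mult differentiable_sum differentiable_mult Tsm len
          differentiable_in_chart[OF smooth_fun_on_pd[OF Tsm] x] differentiable_in_chart[OF Tsm x] differentiable_in_chart[OF christoffel_smooth x] sum.distrib)
    moreover have "(\<Sum>a<r. \<Sum>p\<in>UNIV. \<Gamma> x i (I ! a) p * D T x (j # I[a := p])) = ?first i j - ?diag i j - (\<Sum>a<r. \<Sum>b<r. ?off i j a b)"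
    proof -
      have "(\<Sum>p\<in>UNIV. \<Gamma> x i (I ! a) p * D T x (j # I[a := p])) =
         (\<Sum>p\<in>UNIV. \<Gamma> x i (I ! a) p * pd j (\<lambda>y. T y (I[a := p])) x)
         - (\<Sum>p\<in>UNIV. (\<Sum>q\<in>UNIV. \<Gamma> x i (I ! a) q * \<Gamma> x j q p) * T x (I[a := p])) - (\<Sum>b<r. ?off i j a b)"
        if a: "a < r" for a
      proof -
        have "(\<Sum>b<r. \<Sum>q\<in>UNIV. \<Gamma> x j (I[a := p] ! b) q * T x (I[a := p, b := q]))
          = (\<Sum>q\<in>UNIV. \<Gamma> x j p q * T x (I[a := q])) + (\<Sum>b<r. \<Sum>q\<in>UNIV. if b = a then 0 else \<Gamma> x j (I ! b) q * T x (I[a := p, b := q]))" for p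
        proof -
          let ?f = "\<lambda>b. \<Sum>q\<in>UNIV. \<Gamma> x j (I[a := p] ! b) q * T x (I[a := p, b := q])"
          let ?g = "\<lambda>b. \<Sum>q\<in>UNIV. if b = a then 0 else \<Gamma> x j (I ! b) q * T x (I[a := p, b := q])"
          have "sum ?f {..<r} = ?f a + sum ?f ({..<r} - {a})" by (rule sum.remove) (simp_all add: a)
          moreover have "sum ?g {..<r} = ?g a + sum ?g ({..<r} - {a})" by (rule sum.remove) (simp_all add: a)
          moreover have "sum ?f ({..<r} - {a}) = sum ?g ({..<r} - {a})"
            by (intro sum.cong refl) (auto simp: len)
          moreover have "?f a = (\<Sum>q\<in>UNIV. \<Gamma> x j p q * T x (I[a := q]))" using a by (simp add: len)
          ultimately show ?thesis by simp
        qed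
        then have "\<Gamma> x i (I ! a) p * D T x (j # I[a := p]) = \<Gamma> x i (I ! a) p * pd j (\<lambda>y. T y (I[a := p])) x
            - (\<Sum>q\<in>UNIV. \<Gamma> x i (I ! a) p * \<Gamma> x j p q * T x (I[a := q]))
            - (\<Sum>b<r. \<Sum>q\<in>UNIV. if b = a then 0 else \<Gamma> x i (I ! a) p * \<Gamma> x j (I ! b) q * T x (I[a := p, b := q]))" for p
          unfolding cov_deriv_eq
          by (simp add: len right_diff_distrib distrib_left sum_distrib_left mult.assoc if_distrib[of "\<lambda>u. _ * u"] cong: if_cong)
        moreover have "(\<Sum>p\<in>UNIV. \<Sum>q\<in>UNIV. \<Gamma> x i (I ! a) p * \<Gamma> x j p q * T x (I[a := q])) =
           (\<Sum>p\<in>UNIV. (\<Sum>q\<in>UNIV. \<Gamma> x i (I ! a) q * \<Gamma> x j q p) * T x (I[a := p]))"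
          by (subst sum.swap) (simp only: sum_distrib_right)
        moreover have "(\<Sum>p\<in>UNIV. \<Sum>b<r. \<Sum>q\<in>UNIV. if b = a then 0 else \<Gamma> x i (I ! a) p * \<Gamma> x j (I ! b) q * T x (I[a := p, b := q]))
          = (\<Sum>b<r. ?off i j a b)" by (rule sum.swap)
        ultimately show ?thesis by (simp add: sum_subtractf)
      qed
      then show ?thesis by (simp add: sum_subtractf)
    qed
    ultimately show ?thesis by linarith
  qed
  have off: "(\<Sum>a<r. \<Sum>b<r. ?off i j a b) = (\<Sum>a<r. \<Sum>b<r. ?off j i a b)"
  proof -
    have "?off i j a b = ?off j i b a" for a b
    proof -
      have "?off i j a b = (\<Sum>q\<in>UNIV. \<Sum>p\<in>UNIV. if b = a then 0 else \<Gamma> x i (I ! a) p * \<Gamma> x j (I ! b) q * T x (I[a := p, b := q]))"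
        by (rule sum.swap)
      also have "\<dots> = ?off j i b a"
        by (intro sum.cong refl) (auto simp: list_update_swap)
      finally show ?thesis .
    qed
    then have "(\<Sum>a<r. \<Sum>b<r. ?off i j a b) = (\<Sum>a<r. \<Sum>b<r. ?off j i b a)" by simp
    also have "\<dots> = (\<Sum>a<r. \<Sum>b<r. ?off j i a b)" by (rule sum.swap)
    finally show ?thesis .
  qed
  have "pd i (pd j (\<lambda>y. T y I)) x = pd j (pd i (\<lambda>y. T y I)) x"
    by (rule pd_commute[OF S Tsm[OF len] x])
  moreover have "(\<Sum>p\<in>UNIV. \<Gamma> x i j p * D T x (p # I)) = (\<Sum>p\<in>UNIV. \<Gamma> x j i p * D T x (p # I))"
    by (simp add: christoffel_sym[OF x, of i j])
  moreover have "(\<Sum>a<r. \<Sum>p\<in>UNIV. curvature g x i j (I ! a) p * T x (I[a := p])) = ?der i j - ?der j i - ?diag i j + ?diag j i"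
    unfolding curvature_christoffel[OF x] by (simp add: algebra_simps sum.distrib sum_subtractf)
  ultimately show ?thesis unfolding main[of i j] main[of j i] off by linarith
qed

text \<open>Covariant differentiation commutes with the trace, since the metric is parallel.\<close>

lemma cov_deriv_trace:
  assumes x: "x \<in> S" and T: "smooth_field (Suc (Suc r)) T"
    and tf: "\<And>y A. y \<in> S \<Longrightarrow> A \<in> multi_idx r \<Longrightarrow> (\<Sum>p\<in>UNIV. \<Sum>q\<in>UNIV. G y $ p $ q * T y (p # q # A)) = 0"
    and A: "A \<in> multi_idx r"
  shows "(\<Sum>p\<in>UNIV. \<Sum>q\<in>UNIV. G x $ p $ q * D T x (m # p # q # A)) = 0"
proof -
  have Tsm: "smooth_fun_on S (\<lambda>x. T x (p # q # A))" for p q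
    using T A by (simp add: smooth_field_def)
  have expand: "D T x (m # p # q # A) = pd m (\<lambda>y. T y (p # q # A)) x - (\<Sum>s\<in>UNIV. \<Gamma> x m p s * T x (s # q # A))
     - (\<Sum>s\<in>UNIV. \<Gamma> x m q s * T x (p # s # A)) - (\<Sum>a<r. \<Sum>s\<in>UNIV. \<Gamma> x m (A ! a) s * T x (p # q # A[a := s]))" for p q
    using length_multi_idx[OF A] unfolding cov_deriv_eq by (simp add: sum.lessThan_Suc_shift del: sum.lessThan_Suc)
  have "pd m (\<lambda>y. \<Sum>p\<in>UNIV. \<Sum>q\<in>UNIV. G y $ p $ q * T y (p # q # A)) x = pd m (\<lambda>y. 0) x"
    by (rule pd_cong[OF S x]) (rule tf[OF _ A])
  moreover have "pd m (\<lambda>y. \<Sum>p\<in>UNIV. \<Sum>q\<in>UNIV. G y $ p $ q * T y (p # q # A)) x =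
     (\<Sum>p\<in>UNIV. \<Sum>q\<in>UNIV. pd m (\<lambda>y. G y $ p $ q) x * T x (p # q # A)) + (\<Sum>p\<in>UNIV. \<Sum>q\<in>UNIV. G x $ p $ q * pd m (\<lambda>y. T y (p # q # A)) x)"
    by (simp add: pd_sum pd_mult differentiable_sum differentiable_mult differentiable_in_chart[OF G_smooth x] differentiable_in_chart[OF Tsm x] sum.distrib)
  moreover have "(\<Sum>p\<in>UNIV. \<Sum>q\<in>UNIV. pd m (\<lambda>y. G y $ p $ q) x * T x (p # q # A)) =
     - (\<Sum>p\<in>UNIV. \<Sum>q\<in>UNIV. G x $ p $ q * (\<Sum>s\<in>UNIV. \<Gamma> x m q s * T x (p # s # A))) - (\<Sum>p\<in>UNIV. \<Sum>q\<in>UNIV. G x $ p $ q * (\<Sum>s\<in>UNIV. \<Gamma> x m p s * T x (s # q # A)))"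
  proof -
    have "(\<Sum>p\<in>UNIV. \<Sum>q\<in>UNIV. pd m (\<lambda>y. G y $ p $ q) x * T x (p # q # A)) =
      - (\<Sum>p\<in>UNIV. \<Sum>q\<in>UNIV. \<Sum>a\<in>UNIV. \<Gamma> x m a q * G x $ p $ a * T x (p # q # A)) - (\<Sum>p\<in>UNIV. \<Sum>q\<in>UNIV. \<Sum>a\<in>UNIV. \<Gamma> x m a p * G x $ a $ q * T x (p # q # A))"
      unfolding pd_inverse_metric[OF x] by (simp add: left_diff_distrib sum_subtractf sum_negf sum_distrib_right)
    also have "(\<Sum>p\<in>UNIV. \<Sum>q\<in>UNIV. \<Sum>a\<in>UNIV. \<Gamma> x m a q * G x $ p $ a * T x (p # q # A)) = (\<Sum>p\<in>UNIV. \<Sum>q\<in>UNIV. G x $ p $ q * (\<Sum>s\<in>UNIV. \<Gamma> x m q s * T x (p # s # A)))"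
      unfolding sum_distrib_left by (rule sum.cong[OF refl], subst sum.swap, simp only: mult_ac)
    also have "(\<Sum>p\<in>UNIV. \<Sum>q\<in>UNIV. \<Sum>a\<in>UNIV. \<Gamma> x m a p * G x $ a $ q * T x (p # q # A)) = (\<Sum>p\<in>UNIV. \<Sum>q\<in>UNIV. G x $ p $ q * (\<Sum>s\<in>UNIV. \<Gamma> x m p s * T x (s # q # A)))"
      unfolding sum_distrib_left by (subst sum_rot3, rule sum.cong[OF refl], subst sum.swap, simp only: mult_ac)
    finally show ?thesis .
  qed
  moreover have "(\<Sum>p\<in>UNIV. \<Sum>q\<in>UNIV. G x $ p $ q * (\<Sum>a<r. \<Sum>s\<in>UNIV. \<Gamma> x m (A ! a) s * T x (p # q # A[a := s]))) = 0"
  proof -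
    have "(\<Sum>p\<in>UNIV. \<Sum>q\<in>UNIV. G x $ p $ q * (\<Sum>a<r. \<Sum>s\<in>UNIV. \<Gamma> x m (A ! a) s * T x (p # q # A[a := s])))
      = (\<Sum>p\<in>UNIV. \<Sum>a<r. \<Sum>s\<in>UNIV. \<Sum>q\<in>UNIV. \<Gamma> x m (A ! a) s * (G x $ p $ q * T x (p # q # A[a := s])))"
      unfolding sum_distrib_left by (rule sum.cong[OF refl], subst sum_rot3[symmetric], simp only: mult.left_commute)
    also have "\<dots> = (\<Sum>a<r. \<Sum>s\<in>UNIV. \<Gamma> x m (A ! a) s * (\<Sum>p\<in>UNIV. \<Sum>q\<in>UNIV. G x $ p $ q * T x (p # q # A[a := s])))"
      unfolding sum_distrib_left by (rule sum_rot3[symmetric])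
    also have "\<dots> = 0"
      using A by (simp add: tf[OF x] multi_idx_def)
    finally show ?thesis .
  qed
  ultimately show ?thesis
    unfolding expand by (simp add: right_diff_distrib sum_subtractf)
qed

text \<open>Covariant differentiation preserves symmetries. Used for the symmetry of \<open>\<omega>\<close> and for the Codazzi
  symmetry of \<open>D\<omega>\<close>.\<close>

lemma cov_deriv_swap:
  assumes x: "x \<in> S"
    and sw: "\<And>y a b A. y \<in> S \<Longrightarrow> A \<in> multi_idx r \<Longrightarrow> T y (a # b # A) = T y (b # a # A)"
    and A: "A \<in> multi_idx r"
  shows "D T x (m # a # b # A) = D T x (m # b # a # A)"
proof -
  have expand: "D T x (m # p # q # A) = pd m (\<lambda>y. T y (p # q # A)) x - (\<Sum>s\<in>UNIV. \<Gamma> x m p s * T x (s # q # A))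
     - (\<Sum>s\<in>UNIV. \<Gamma> x m q s * T x (p # s # A)) - (\<Sum>a<r. \<Sum>s\<in>UNIV. \<Gamma> x m (A ! a) s * T x (p # q # A[a := s]))" for p q
    using length_multi_idx[OF A] unfolding cov_deriv_eq by (simp add: sum.lessThan_Suc_shift del: sum.lessThan_Suc)
  have "pd m (\<lambda>y. T y (a # b # A)) x = pd m (\<lambda>y. T y (b # a # A)) x"
    by (rule pd_cong[OF S x]) (rule sw[OF _ A])
  moreover have "(\<Sum>s\<in>UNIV. \<Gamma> x m p s * T x (s # q # A)) = (\<Sum>s\<in>UNIV. \<Gamma> x m p s * T x (q # s # A))" for p q
    by (intro sum.cong refl) (simp add: sw[OF x A, of _ q])
  moreover have "T x (a # b # A[i := s]) = T x (b # a # A[i := s])" for i s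
    by (rule sw[OF x]) (use A in \<open>simp add: multi_idx_def\<close>)
  ultimately show ?thesis unfolding expand by simp
qed

text \<open>By Jacobi's formula the logarithmic derivative of \<open>det h\<close> is \<open>h\<^sup>i\<^sup>j \<partial>\<^sub>m h\<^sub>i\<^sub>j\<close>, which is twice the contracted
  Christoffel symbol.\<close>

lemma pd_volume:
  assumes x: "x \<in> S"
  shows "pd m (\<lambda>y. sqrt (det (H y))) x = sqrt (det (H x)) * (\<Sum>p\<in>UNIV. \<Gamma> x m p p)"
proof -
  have "pd m (\<lambda>y. det (H y)) x = det (H x) * (\<Sum>i\<in>UNIV. \<Sum>j\<in>UNIV. G x $ i $ j * pd m (\<lambda>y. g y [j, i]) x)"
    by (subst pd_det[OF differentiable_in_chart[OF H_smooth x] inv[OF x]]) (simp add: H_nth)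
  also have "(\<Sum>i\<in>UNIV. \<Sum>j\<in>UNIV. G x $ i $ j * pd m (\<lambda>y. g y [j, i]) x) = 2 * (\<Sum>p\<in>UNIV. \<Gamma> x m p p)"
  proof -
    have "(\<Sum>i\<in>UNIV. \<Sum>j\<in>UNIV. G x $ i $ j * pd m (\<lambda>y. g y [j, i]) x) =
      (\<Sum>i\<in>UNIV. \<Sum>j\<in>UNIV. \<Sum>q\<in>UNIV. \<Gamma> x m j q * (g x [q, i] * G x $ i $ j)) + (\<Sum>i\<in>UNIV. \<Sum>j\<in>UNIV. \<Sum>q\<in>UNIV. \<Gamma> x m i q * (G x $ i $ j * g x [j, q]))"
      unfolding pd_metric[OF x] by (simp add: distrib_left sum.distrib sum_distrib_left mult_ac)
    also have "(\<Sum>i\<in>UNIV. \<Sum>j\<in>UNIV. \<Sum>q\<in>UNIV. \<Gamma> x m j q * (g x [q, i] * G x $ i $ j)) = (\<Sum>j\<in>UNIV. \<Sum>q\<in>UNIV. \<Gamma> x m j q * (\<Sum>i\<in>UNIV. g x [q, i] * G x $ i $ j))"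
      unfolding sum_distrib_left by (rule sum_rot3[symmetric])
    also have "\<dots> = (\<Sum>p\<in>UNIV. \<Gamma> x m p p)" unfolding HG[OF x] delta_sum ..
    also have "(\<Sum>i\<in>UNIV. \<Sum>j\<in>UNIV. \<Sum>q\<in>UNIV. \<Gamma> x m i q * (G x $ i $ j * g x [j, q])) = (\<Sum>i\<in>UNIV. \<Sum>q\<in>UNIV. \<Gamma> x m i q * (\<Sum>j\<in>UNIV. G x $ i $ j * g x [j, q]))"
      unfolding sum_distrib_left by (rule sum.cong[OF refl], rule sum.swap)
    also have "\<dots> = (\<Sum>p\<in>UNIV. \<Gamma> x m p p)" unfolding GH[OF x] delta_sum ..
    finally show ?thesis by simp
  qed
  finally have d: "pd m (\<lambda>y. det (H y)) x = det (H x) * (2 * (\<Sum>p\<in>UNIV. \<Gamma> x m p p))" .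
  have "(\<lambda>y. det (H y)) differentiable (at x)"
    using differentiable_in_chart[OF smooth_det[OF S H_smooth] x] .
  from pd_chain_rule_real(2)[OF this DERIV_real_sqrt[OF det_pos[OF x]], of m]
  have "pd m (\<lambda>y. sqrt (det (H y))) x = (det (H x) / sqrt (det (H x))) * (\<Sum>p\<in>UNIV. \<Gamma> x m p p)"
    unfolding d by (simp only: divide_inverse mult_ac) simp
  also have "det (H x) / sqrt (det (H x)) = sqrt (det (H x))"
    by (rule real_div_sqrt) (rule less_imp_le[OF det_pos[OF x]])
  finally show ?thesis .
qed

text \<open>The right-hand side is \<open>\<surd>(det h)\<close> times the divergence \<open>h\<^sup>i\<^sup>j D\<^sub>iV\<^sub>j\<close>. The contracted Christoffel
  symbols produced by \<open>\<surd>(det h)\<close> cancel one of the two terms that come from the inverse metric.\<close>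

lemma divergence_formula:
  assumes x: "x \<in> S" and V: "\<And>j. smooth_fun_on S (V j)"
  shows "(\<Sum>i\<in>UNIV. pd i (\<lambda>y. sqrt (det (H y)) * (\<Sum>j\<in>UNIV. G y $ i $ j * V j y)) x) =
    sqrt (det (H x)) * (\<Sum>i\<in>UNIV. \<Sum>j\<in>UNIV. G x $ i $ j * (pd i (V j) x - (\<Sum>p\<in>UNIV. \<Gamma> x i j p * V p x)))"
proof -
  let ?v = "sqrt (det (H x))"
  have dv: "(\<lambda>y. sqrt (det (H y))) differentiable (at x)"
    using differentiable_in_chart[OF smooth_sqrt[OF S smooth_det[OF S H_smooth] det_pos] x] .
  have dG: "(\<lambda>y. G y $ i $ j) differentiable (at x)" for i j using differentiable_in_chart[OF G_smooth x] .
  have dV: "V j differentiable (at x)" for j using differentiable_in_chart[OF V x] .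
  have "pd i (\<lambda>y. sqrt (det (H y)) * (\<Sum>j\<in>UNIV. G y $ i $ j * V j y)) x =
     ?v * ((\<Sum>j\<in>UNIV. \<Sum>p\<in>UNIV. \<Gamma> x i p p * G x $ i $ j * V j x)
      + (\<Sum>j\<in>UNIV. G x $ i $ j * pd i (V j) x)
      - (\<Sum>j\<in>UNIV. \<Sum>a\<in>UNIV. \<Gamma> x i a j * G x $ i $ a * V j x) - (\<Sum>j\<in>UNIV. \<Sum>a\<in>UNIV. \<Gamma> x i a i * G x $ a $ j * V j x))" for i
  proof -
    have "pd i (\<lambda>y. sqrt (det (H y)) * (\<Sum>j\<in>UNIV. G y $ i $ j * V j y)) x =
      (?v * (\<Sum>p\<in>UNIV. \<Gamma> x i p p)) * (\<Sum>j\<in>UNIV. G x $ i $ j * V j x)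
       + ?v * (\<Sum>j\<in>UNIV. pd i (\<lambda>y. G y $ i $ j) x * V j x + G x $ i $ j * pd i (V j) x)"
      by (simp add: pd_mult[OF dv] pd_sum pd_mult[OF dG dV] dG dV differentiable_sum differentiable_mult pd_volume[OF x])
    also have "(\<Sum>j\<in>UNIV. pd i (\<lambda>y. G y $ i $ j) x * V j x + G x $ i $ j * pd i (V j) x) =
      (\<Sum>j\<in>UNIV. G x $ i $ j * pd i (V j) x)
      - (\<Sum>j\<in>UNIV. \<Sum>a\<in>UNIV. \<Gamma> x i a j * G x $ i $ a * V j x) - (\<Sum>j\<in>UNIV. \<Sum>a\<in>UNIV. \<Gamma> x i a i * G x $ a $ j * V j x)"
      unfolding pd_inverse_metric[OF x]
      by (simp add: sum.distrib sum_subtractf left_diff_distrib sum_distrib_right sum_negf)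
    also have "(?v * (\<Sum>p\<in>UNIV. \<Gamma> x i p p)) * (\<Sum>j\<in>UNIV. G x $ i $ j * V j x) = ?v * (\<Sum>j\<in>UNIV. \<Sum>p\<in>UNIV. \<Gamma> x i p p * G x $ i $ j * V j x)"
      by (simp add: sum_distrib_left sum_distrib_right mult_ac) (rule sum.swap)
    finally show ?thesis by (simp add: algebra_simps)
  qed
  moreover have "(\<Sum>i\<in>UNIV. \<Sum>j\<in>UNIV. \<Sum>a\<in>UNIV. \<Gamma> x i a i * G x $ a $ j * V j x) = (\<Sum>i\<in>UNIV. \<Sum>j\<in>UNIV. \<Sum>p\<in>UNIV. \<Gamma> x i p p * G x $ i $ j * V j x)"
  proof -
    have "(\<Sum>i\<in>UNIV. \<Sum>j\<in>UNIV. \<Sum>a\<in>UNIV. \<Gamma> x i a i * G x $ a $ j * V j x) = (\<Sum>a\<in>UNIV. \<Sum>i\<in>UNIV. \<Sum>j\<in>UNIV. \<Gamma> x i a i * G x $ a $ j * V j x)"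
      by (rule sum_rot3)
    also have "\<dots> = (\<Sum>a\<in>UNIV. \<Sum>j\<in>UNIV. \<Sum>i\<in>UNIV. \<Gamma> x a i i * G x $ a $ j * V j x)"
      by (rule sum.cong[OF refl], subst sum.swap, simp only: christoffel_sym[OF x])
    finally show ?thesis .
  qed
  moreover have "(\<Sum>i\<in>UNIV. \<Sum>j\<in>UNIV. \<Sum>a\<in>UNIV. \<Gamma> x i a j * G x $ i $ a * V j x) = (\<Sum>i\<in>UNIV. \<Sum>j\<in>UNIV. G x $ i $ j * (\<Sum>p\<in>UNIV. \<Gamma> x i j p * V p x))"
    unfolding sum_distrib_left by (rule sum.cong[OF refl], subst sum.swap, simp only: mult_ac)
  ultimately show ?thesis
    by (simp add: sum_distrib_left[symmetric] sum.distrib sum_subtractf right_diff_distrib) (simp add: distrib_left)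
qed

text \<open>The right-hand side is \<open>\<surd>(det h)\<close> times half the Laplacian of \<open>\<phi> = |\<omega>|\<^sup>2\<close>, because
  \<open>V j = \<langle>D\<^sub>j\<omega>, \<omega>\<rangle>\<close> is half the differential of \<open>\<phi>\<close>. It splits into \<open>|D\<omega>|\<^sup>2 \<ge> 0\<close> and the curvature term,
  and \<open>c \<le> 0\<close> makes the upper bound by \<open>\<Lambda>\<^sub>n\<^sub>,\<^sub>k\<close> a lower bound for the latter.\<close>

lemma bochner_inequality:
  assumes x: "x \<in> S" and T: "smooth_field (Suc (Suc m)) T"
    and symT: "\<And>y. y \<in> S \<Longrightarrow> symmetric_tensor (Suc (Suc m)) (T y)"
    and tfT: "\<And>y. y \<in> S \<Longrightarrow> trace_free (H y) (Suc (Suc m)) (T y)"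
    and codazzi: "\<And>y i j A. y \<in> S \<Longrightarrow> A \<in> multi_idx (Suc m) \<Longrightarrow> D T y (i # j # A) = D T y (j # i # A)"
    and eq: "\<And>L. L \<in> multi_idx 4 \<Longrightarrow> Riem g x L - c * circledast (H x) (Suc (Suc m)) (T x) L = - l * circledast (H x) 2 (g x) L"
    and c: "c \<le> 0"
  defines "\<phi> \<equiv> norm_sq (H x) (Suc (Suc m)) (T x)"
    and "V \<equiv> \<lambda>j y. contr (H y) (Suc (Suc m)) (\<lambda>I. D T y (j # I)) (T y)"
  shows "sqrt (det (H x)) * (\<phi> * (l * (real CARD('n) + real m) + c * Lambda (mat 1 :: real^'n^'n) (Suc (Suc m)) * \<phi>))
     \<le> (\<Sum>i\<in>UNIV. pd i (\<lambda>y. sqrt (det (H y)) * (\<Sum>j\<in>UNIV. G y $ i $ j * V j y)) x)"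
proof -
  let ?k = "Suc (Suc m)"
  have DT: "smooth_field (Suc ?k) (D T)" by (rule smooth_field_cov_deriv[OF T])
  have V_smooth: "smooth_fun_on S (V j)" for j
    unfolding V_def by (intro contr_smooth smooth_field_Cons DT T)
  \<comment> \<open>The covariant derivative of the one-form \<open>V\<close>, by the product rule.\<close>
  have div: "pd i (V j) x - (\<Sum>p\<in>UNIV. \<Gamma> x i j p * V p x) =
     contr (H x) ?k (\<lambda>I. D (D T) x (i # j # I)) (T x) + contr (H x) ?k (\<lambda>I. D T x (j # I)) (\<lambda>I. D T x (i # I))" for i j
    unfolding V_def
    by (simp add: pd_contr[OF x smooth_field_Cons[OF DT] T] cov_deriv_Cons[of "D T"] contr_diff_left contr_sum_left contr_scale_left)
  have R: "curvature g x p i b r = (\<Sum>q\<in>UNIV. G x $ q $ r *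
        (c * circledast (H x) ?k (T x) [p, i, b, q] - l * (H x $ b $ p * H x $ i $ q - H x $ b $ i * H x $ p $ q)))" for p i b r
  proof -
    have "(\<Sum>s\<in>UNIV. curvature g x p i b s * g x [s, q]) =
      c * circledast (H x) ?k (T x) [p, i, b, q] - l * (H x $ b $ p * H x $ i $ q - H x $ b $ i * H x $ p $ q)" for q
    proof -
      have "circledast (H x) 2 (g x) [p, i, b, q] = H x $ b $ p * H x $ i $ q - H x $ b $ i * H x $ p $ q"
        using circledast_pair[of "H x" 0 "g x" p i b q] by (simp add: pair_contr_def H_nth numeral_2_eq_2)
      then show ?thesis using eq[of "[p, i, b, q]"] by (simp add: multi_idx_def Riem_def)
    qed
    note lower = this
    have "(\<Sum>q\<in>UNIV. G x $ q $ r * (c * circledast (H x) ?k (T x) [p, i, b, q] - l * (H x $ b $ p * H x $ i $ q - H x $ b $ i * H x $ p $ q)))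
       = (\<Sum>q\<in>UNIV. \<Sum>s\<in>UNIV. curvature g x p i b s * (g x [s, q] * G x $ q $ r))"
      unfolding lower[symmetric] sum_distrib_left by (simp only: mult_ac)
    also have "\<dots> = (\<Sum>s\<in>UNIV. curvature g x p i b s * (\<Sum>q\<in>UNIV. g x [s, q] * G x $ q $ r))"
      unfolding sum_distrib_left by (rule sum.swap)
    also have "\<dots> = curvature g x p i b r" unfolding HG[OF x] delta_sum ..
    finally show ?thesis by simp
  qed
  have trT: "(\<Sum>p\<in>UNIV. \<Sum>q\<in>UNIV. G y $ p $ q * T y (p # q # B)) = 0" if "y \<in> S" "B \<in> multi_idx m" for y B
    using tfT[OF that(1)] that(2) by (simp add: trace_free_def)
  have trDT: "(\<Sum>p\<in>UNIV. \<Sum>q\<in>UNIV. G y $ p $ q * D T y (p # q # A)) = 0" if y: "y \<in> S" and A: "A \<in> multi_idx (Suc m)" for y A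
  proof -
    obtain a B where AB: "A = a # B" and B: "B \<in> multi_idx m" using A by (auto simp: multi_idx_Suc)
    \<comment> \<open>Symmetry of \<open>\<omega>\<close> followed by the Codazzi equation brings the two traced indices together.\<close>
    have "D T y (p # q # a # B) = D T y (a # p # q # B)" for p q
    proof -
      have "D T y (p # q # a # B) = D T y (p # a # q # B)"
        by (rule cov_deriv_swap[OF y _ B]) (rule symmetric_tensor_swap[OF symT])
      also have "\<dots> = D T y (a # p # q # B)" by (rule codazzi[OF y]) (use B in simp)
      finally show ?thesis .
    qed
    then show ?thesis unfolding AB using cov_deriv_trace[OF y T trT B, of a] by simp
  qed
  have ct: "curvature_term (H x) m (T x) c l (curvature g x)"
    by unfold_locales (use inv[OF x] sym[OF x] symT[OF x] tfT[OF x] R in auto)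
  have boch: "(\<Sum>p\<in>UNIV. \<Sum>q\<in>UNIV. G x $ p $ q * contr (H x) ?k (\<lambda>I. D (D T) x (p # q # I)) (T x))
     = c * Lambda_form (H x) ?k (T x) + l * (real CARD('n) + real m) * \<phi>"
    unfolding \<phi>_def
  proof (rule curvature_term.bochner_identity[OF ct])
    show "D (D T) x (p # q # i # A) = D (D T) x (p # i # q # A)" if "A \<in> multi_idx (Suc m)" for p q i A
      by (rule cov_deriv_swap[OF x _ that]) (rule codazzi)
    show "(\<Sum>p\<in>UNIV. \<Sum>q\<in>UNIV. G x $ p $ q * D (D T) x (i # p # q # A)) = 0" if "A \<in> multi_idx (Suc m)" for i A
      by (rule cov_deriv_trace[OF x DT trDT that])
    show "D (D T) x (p # i # I) - D (D T) x (i # p # I) = - (\<Sum>a<?k. \<Sum>r\<in>UNIV. curvature g x p i (I ! a) r * T x (I[a := r]))"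
      if "I \<in> multi_idx ?k" for p i I
      by (rule ricci_identity[OF x T that])
  qed
  have grad: "(\<Sum>i\<in>UNIV. \<Sum>j\<in>UNIV. G x $ i $ j * contr (H x) ?k (\<lambda>I. D T x (j # I)) (\<lambda>I. D T x (i # I))) = norm_sq (H x) (Suc ?k) (D T x)"
    unfolding norm_sq_contr contr_Suc[of _ ?k]
    by (subst sum.swap) (intro sum.cong refl arg_cong2[where f="(*)"] G_symm x)
  have "c * (Lambda (mat 1 :: real^'n^'n) ?k * \<phi>\<^sup>2) \<le> c * Lambda_form (H x) ?k (T x)"
    unfolding \<phi>_def
    by (intro mult_left_mono_neg c Lambda_form_le(1)[OF pos[OF x] sym[OF x] symT[OF x] tfT[OF x]]) auto
  then have "\<phi> * (l * (real CARD('n) + real m) + c * Lambda (mat 1 :: real^'n^'n) ?k * \<phi>)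
      \<le> c * Lambda_form (H x) ?k (T x) + l * (real CARD('n) + real m) * \<phi> + norm_sq (H x) (Suc ?k) (D T x)"
    using norm_sq_nonneg[OF pos[OF x] sym[OF x], of "Suc ?k" "D T x"] by (simp add: algebra_simps power2_eq_square)
  also have "\<dots> = (\<Sum>i\<in>UNIV. \<Sum>j\<in>UNIV. G x $ i $ j * (pd i (V j) x - (\<Sum>p\<in>UNIV. \<Gamma> x i j p * V p x)))"
    unfolding div distrib_left sum.distrib boch grad ..
  finally show ?thesis
    unfolding divergence_formula[OF x V_smooth] using det_pos[OF x] by (intro mult_left_mono) auto
qed

lemma pd_norm_sq:
  assumes x: "x \<in> S" and T: "smooth_field r T"
  shows "pd j (\<lambda>y. norm_sq (H y) r (T y)) x = 2 * contr (H x) r (\<lambda>I. D T x (j # I)) (T x)"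
  unfolding norm_sq_contr pd_contr[OF x T T]
  using contr_commute[OF matrix_inv_symmetric[OF inv[OF x] sym[OF x]]] by simp

end

section \<open>Integration by parts for compactly supported functions\<close>

lemma integrable_compact_support:
  fixes f :: "real^'n::finite \<Rightarrow> real"
  assumes C: "open C" and K: "compact K" "K \<subseteq> C" and f: "continuous_on C f" and z: "\<And>x. x \<in> C \<Longrightarrow> x \<notin> K \<Longrightarrow> f x = 0"
  shows "integrable lborel (\<lambda>x. indicator C x * f x)"
proof -
  have "integrable lborel (\<lambda>x. indicator K x *\<^sub>R f x)"
    by (rule borel_integrable_compact[OF K(1) continuous_on_subset[OF f K(2)]])
  moreover have "(\<lambda>x. indicator K x *\<^sub>R f x) = (\<lambda>x. indicator C x * f x)"
    using z K(2) by (auto simp: indicator_def fun_eq_iff)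
  ultimately show ?thesis by simp
qed

text \<open>The integral of a partial derivative is the limit of the integrals of difference quotients, and
  these vanish because Lebesgue measure is invariant under translations.\<close>
lemma integral_pd_eq_0:
  fixes f :: "real^'n::finite \<Rightarrow> real"
  assumes C: "open C" and K: "compact K" "K \<subseteq> C" and f: "Ck (Suc 0) C f" and z: "\<And>x. x \<in> C \<Longrightarrow> x \<notin> K \<Longrightarrow> f x = 0"
  shows "(LINT x|lborel. indicator C x * pd i f x) = 0"
    and "\<And>x. x \<in> C \<Longrightarrow> x \<notin> K \<Longrightarrow> pd i f x = 0"
proof -
  have oK: "open (- K)" using K(1) compact_imp_closed by blast
  show pz: "pd i f x = 0" if "x \<in> C" "x \<notin> K" for x
  proof -
    have "pd i f x = pd i (\<lambda>y. 0) x"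
      by (rule pd_cong[of "C - K"]) (use C K that z compact_imp_closed in \<open>auto simp: open_Diff\<close>)
    then show ?thesis by simp
  qed
  define F where "F x = indicator C x * f x" for x
  define P where "P x = indicator C x * pd i f x" for x
  have dF: "F differentiable (at x)" and pF: "pd i F x = P x" for x
  proof -
    have "F differentiable (at x) \<and> pd i F x = P x"
    proof (cases "x \<in> C")
      case True
      have "F y = f y" if "y \<in> C" for y using that by (simp add: F_def)
      then show ?thesis
        using differentiable_cong_open[OF C True, of F f] pd_cong[OF C True, of F f] f True
        by (simp add: differentiable_on_eq_differentiable_at[OF C] P_def)
    next
      case False
      then have x: "x \<in> - K" using K by auto
      have "F y = 0" if "y \<in> - K" for y using that z by (auto simp: F_def indicator_def)
      then show ?thesis
        using differentiable_cong_open[OF oK x, of F "\<lambda>y. 0"] pd_cong[OF oK x, of F "\<lambda>y. 0"] False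
        by (simp add: P_def)
    qed
    then show "F differentiable (at x)" "pd i F x = P x" by auto
  qed
  let ?e = "\<lambda>n. (1 / real (Suc n)) *\<^sub>R (axis i 1 :: real^'n)"
  define Q where "Q n x = real (Suc n) * (F (x + ?e n) - F x)" for n x
  have line: "((\<lambda>s. F (x + s *\<^sub>R axis i 1)) has_real_derivative P (x + s *\<^sub>R axis i 1)) (at s)" for x s
  proof -
    have "((\<lambda>s. x + s *\<^sub>R axis i 1) has_derivative (\<lambda>h. h *\<^sub>R axis i 1)) (at s)"
      by (auto intro!: derivative_eq_intros)
    from has_derivative_compose[OF this differentiable_has_derivative[OF dF]]
    show ?thesis
      using linear_cmul[OF linear_frechet_derivative[OF dF]] pF[symmetric]
      by (simp add: has_field_derivative_def pd_def mult_commute_abs)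
  qed
  obtain B where B: "\<And>x. \<bar>P x\<bar> \<le> B"
  proof -
    have "compact (pd i f ` K)" using f K by (intro compact_continuous_image) (auto intro: continuous_on_subset)
    then have "bounded (pd i f ` K)" by (rule compact_imp_bounded)
    then obtain b where b: "\<And>x. x \<in> K \<Longrightarrow> \<bar>pd i f x\<bar> \<le> b"
      unfolding bounded_real by blast
    have "\<bar>P x\<bar> \<le> max b 0" for x
      using b[of x] pz[of x] K(2) by (cases "x \<in> K") (auto simp: P_def indicator_def)
    then show ?thesis by (rule that)
  qed
  obtain r where r: "r > 0" "\<And>x. x \<in> K \<Longrightarrow> norm x \<le> r"
    using compact_imp_bounded[OF K(1)] bounded_pos by blast
  have FK: "F x = 0" if "x \<notin> K" for x using z[of x] that by (auto simp: F_def indicator_def)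
  have ne: "norm (?e n) \<le> 1" for n by simp
  have Qb: "norm (Q n x) \<le> indicator (cball 0 (r + 1)) x * B" for n x
  proof (cases "x \<in> cball 0 (r + 1)")
    case True
    \<comment> \<open>By the mean value theorem a difference quotient is bounded by the derivative, which gives the dominating function.\<close>
    have "\<exists>s. 0 < s \<and> s < 1 / real (Suc n) \<and> F (x + (1 / real (Suc n)) *\<^sub>R axis i 1) - F (x + 0 *\<^sub>R axis i 1) = (1 / real (Suc n) - 0) * P (x + s *\<^sub>R axis i 1)"
      by (intro MVT2 line) auto
    then obtain s where "F (x + ?e n) - F x = (1 / real (Suc n)) * P (x + s *\<^sub>R axis i 1)" by auto
    then have "Q n x = P (x + s *\<^sub>R axis i 1)" by (simp add: Q_def)
    then show ?thesis using True B by simp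
  next
    case False
    then have n: "norm x > r + 1" by simp
    have "norm x \<le> norm (x + ?e n) + norm (?e n)" using norm_triangle_ineq4[of "x + ?e n" "?e n"] by simp
    then have "norm (x + ?e n) > r" using n ne[of n] by linarith
    then have "x \<notin> K" "x + ?e n \<notin> K" using r n by force+
    then show ?thesis using FK False by (simp add: Q_def)
  qed
  have lim: "(\<lambda>n. Q n x) \<longlonglongrightarrow> P x" for x
  proof -
    have "((\<lambda>s. (F (x + s *\<^sub>R axis i 1) - F x) / s) \<longlongrightarrow> P x) (at 0)"
      using line[of x 0] by (simp add: DERIV_def)
    moreover have "filterlim (\<lambda>n. 1 / real (Suc n)) (at 0) sequentially"
      unfolding filterlim_at using LIMSEQ_inverse_real_of_nat by (auto simp: inverse_eq_divide)
    ultimately have "(\<lambda>n. (F (x + (1 / real (Suc n)) *\<^sub>R axis i 1) - F x) / (1 / real (Suc n))) \<longlonglongrightarrow> P x"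
      by (rule filterlim_compose)
    then show ?thesis by (simp add: Q_def mult.commute)
  qed
  have F_cont: "continuous_on UNIV F"
    using dF differentiable_imp_continuous_within continuous_at_imp_continuous_on by blast
  have Fm: "F \<in> borel_measurable borel" by (rule borel_measurable_continuous_onI[OF F_cont])
  have Qm: "Q n \<in> borel_measurable borel" for n
    unfolding Q_def by (intro borel_measurable_continuous_onI continuous_intros continuous_on_compose2[OF F_cont]) auto
  have Fi: "integrable lborel F"
    unfolding F_def[abs_def] by (rule integrable_compact_support[OF C K Ck_continuous[OF f] z])
  have Qi: "(LINT x|lborel. Q n x) = 0" for n
  proof -
    \<comment> \<open>Translation invariance: \<open>F\<close> and its translate have the same integral.\<close>
    have d: "distr lborel borel ((+) (?e n)) = lborel" by (rule lborel_distr_plus)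
    have "integrable (distr lborel borel ((+) (?e n))) F" using Fi d by simp
    then have i: "integrable lborel (\<lambda>x. F (?e n + x))"
      by (subst (asm) integrable_distr_eq) (use Fm in auto)
    have "(LINT x|lborel. F (?e n + x)) = (LINT x|distr lborel borel ((+) (?e n)). F x)"
      by (subst integral_distr) (use Fm in auto)
    then have "(LINT x|lborel. F (?e n + x)) = (LINT x|lborel. F x)" using d by simp
    then show ?thesis unfolding Q_def using Fi i by (simp add: add.commute)
  qed
  have "(\<lambda>n. LINT x|lborel. Q n x) \<longlonglongrightarrow> (LINT x|lborel. P x)"
  proof (rule integral_dominated_convergence[where w="\<lambda>x. indicator (cball 0 (r + 1)) x * B"])
    show "P \<in> borel_measurable lborel"
      using borel_measurable_LIMSEQ_real[of lborel Q P] lim Qm by simp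
    have "integrable lborel (\<lambda>x. indicator (cball 0 (r + 1)) x *\<^sub>R B)"
      by (rule borel_integrable_compact) auto
    then show "integrable lborel (\<lambda>x. indicator (cball 0 (r + 1)) x * B)" by simp
  qed (use Qm lim Qb in auto)
  then have "(LINT x|lborel. P x) = 0" unfolding Qi by (simp add: LIMSEQ_const_iff)
  then show "(LINT x|lborel. indicator C x * pd i f x) = 0" by (simp add: P_def[abs_def])
qed

section \<open>A partition of unity\<close>

lemma Ck_coordinate: "Ck n UNIV (\<lambda>x :: real^'n::finite. x $ i)"
proof (cases n)
  case (Suc m)
  have d: "((\<lambda>x :: real^'n. x $ i) has_derivative (\<lambda>v. v $ i)) (at x)" for x
    by (rule bounded_linear_imp_has_derivative[OF bounded_linear_vec_nth])
  then have "pd j (\<lambda>x :: real^'n. x $ i) = (\<lambda>x. (axis j 1 :: real^'n) $ i)" for j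
    using pd_has_derivative[OF d] by auto
  moreover have "(\<lambda>x :: real^'n. x $ i) differentiable_on UNIV"
    using d by (auto simp: differentiable_on_def differentiable_def)
  ultimately show ?thesis unfolding Suc by simp
qed (auto intro: continuous_intros)

lemma DERIV_max_sq: "((\<lambda>t::real. (max 0 t)\<^sup>2) has_real_derivative 2 * max 0 t) (at t)"
proof -
  consider "t > 0" | "t < 0" | "t = 0" by linarith
  then show ?thesis
  proof cases
    case 1
    have "((\<lambda>t::real. t\<^sup>2) has_real_derivative 2 * max 0 t) (at t)"
      using 1 by (auto intro!: derivative_eq_intros)
    then show ?thesis
      by (rule has_field_derivative_transform_within_open[of _ _ _ "{0<..}"]) (use 1 in auto)
  next
    case 2
    have "((\<lambda>t::real. 0) has_real_derivative 2 * max 0 t) (at t)"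
      using 2 by (auto intro!: derivative_eq_intros)
    then show ?thesis
      by (rule has_field_derivative_transform_within_open[of _ _ _ "{..<0}"]) (use 2 in auto)
  next
    case 3
    have "((\<lambda>h::real. (max 0 h)\<^sup>2 / h) \<longlongrightarrow> 0) (at 0)"
    proof (rule Lim_null_comparison)
      show "\<forall>\<^sub>F h in at 0. norm ((max 0 h)\<^sup>2 / h) \<le> \<bar>h::real\<bar>"
        by (intro always_eventually allI) (auto simp: max_def power2_eq_square)
      show "((\<lambda>h::real. \<bar>h\<bar>) \<longlongrightarrow> 0) (at 0)" using tendsto_rabs_zero[OF tendsto_ident_at] by simp
    qed
    then show ?thesis using 3 by (simp add: DERIV_def)
  qed
qed

text \<open>The sum is the squared distance from the centre \<open>z\<close>, written out as a polynomial to make smoothness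
  evident. Squaring the positive part gives one continuous derivative, which is all that integration by
  parts uses.\<close>

definition bump :: "real^'n \<Rightarrow> real \<Rightarrow> real^'n::finite \<Rightarrow> real" where
  "bump z r x = (max 0 (r\<^sup>2 - (\<Sum>i\<in>UNIV. (x $ i - z $ i) * (x $ i - z $ i))))\<^sup>2"

lemma bump_arg: "(\<Sum>i\<in>UNIV. (x $ i - z $ i) * (x $ i - z $ i)) = (dist x z)\<^sup>2"
  for x z :: "real^'n::finite"
  by (simp add: dist_norm power2_norm_eq_inner inner_vec_def)

lemma bump_pos: "dist x z < r \<Longrightarrow> bump z r x > 0"
  unfolding bump_def bump_arg using power_strict_mono[of "dist x z" r 2] by simp

lemma bump_nonneg: "bump z r x \<ge> 0" by (simp add: bump_def)

lemma bump_zero: "0 < r \<Longrightarrow> r \<le> dist x z \<Longrightarrow> bump z r x = 0"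
  unfolding bump_def bump_arg using power_mono[of r "dist x z" 2] by simp

lemma bump_C1: "Ck (Suc 0) UNIV (bump z r)"
proof -
  let ?q = "\<lambda>x. r\<^sup>2 - (\<Sum>i\<in>UNIV. (x $ i - z $ i) * (x $ i - z $ i))"
  have smooth: "smooth_fun_on UNIV ?q"
    by (intro smooth_diff smooth_sum smooth_mult smooth_const) (auto simp: smooth_iff_Ck Ck_coordinate)
  have dq: "?q differentiable (at x)" for x by (rule smooth_differentiable_at[OF smooth]) auto
  note d = pd_chain_rule_real[OF dq DERIV_max_sq]
  have b: "bump z r = (\<lambda>x. (max 0 (?q x))\<^sup>2)" by (simp add: bump_def fun_eq_iff)
  have "continuous_on UNIV (pd i ?q)" for i by (rule smooth_continuous_on[OF smooth_fun_on_pd[OF smooth]])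
  then have "continuous_on UNIV (\<lambda>x. 2 * max 0 (?q x) * pd i ?q x)" for i
    using smooth_continuous_on[OF smooth] by (intro continuous_intros) auto
  then have "continuous_on UNIV (pd i (bump z r))" for i unfolding b d(2) .
  moreover have "bump z r differentiable_on UNIV"
    unfolding b differentiable_on_def using d(1) by simp
  ultimately show ?thesis by simp
qed

lemma jacobian_nth:
  fixes g :: "real^'n::finite \<Rightarrow> real^'m::finite"
  assumes "g differentiable (at x)"
  shows "jacobian g (at x) $ m $ i = pd i (\<lambda>x. g x $ m) x"
proof -
  have "((\<lambda>x. g x $ m) has_derivative (\<lambda>v. frechet_derivative g (at x) v $ m)) (at x)"
    using has_derivative_compose[OF assms[unfolded frechet_derivative_works] bounded_linear_imp_has_derivative[OF bounded_linear_vec_nth]] .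
  from pd_has_derivative[OF this] show ?thesis by (simp add: jacobian_def matrix_def)
qed

text \<open>Regularity is a local property. This is what allows different arguments near different points.\<close>

lemma C1_local:
  assumes "open S" "\<And>x. x \<in> S \<Longrightarrow> \<exists>N. open N \<and> x \<in> N \<and> N \<subseteq> S \<and> Ck (Suc 0) N f"
  shows "Ck (Suc 0) S f"
proof -
  have "f differentiable (at x) \<and> (\<forall>i. isCont (pd i f) x)" if x: "x \<in> S" for x
  proof -
    obtain N where N: "open N" "x \<in> N" "Ck (Suc 0) N f" using assms(2)[OF x] by blast
    then show ?thesis
      by (auto simp: differentiable_on_eq_differentiable_at continuous_on_eq_continuous_at)
  qed
  then show ?thesis
    using assms(1) by (auto simp: differentiable_on_eq_differentiable_at continuous_on_eq_continuous_at)
qed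

lemma Ck_sum:
  assumes "open S" "\<And>a. a \<in> A \<Longrightarrow> Ck n S (f a)"
  shows "Ck n S (\<lambda>x. \<Sum>a\<in>A. f a x)"
  using assms(2) by (induction A rule: infinite_finite_induct) (auto intro!: Ck_add assms(1))

definition in_chart :: "('m, 'n) chart \<Rightarrow> ('m \<Rightarrow> real) \<Rightarrow> real^'n \<Rightarrow> real" where
  "in_chart c f x = f (inv_into (fst c) (snd c) x)"

definition C1_manifold :: "('m, 'n::finite) chart set \<Rightarrow> ('m \<Rightarrow> real) \<Rightarrow> bool" where
  "C1_manifold \<A> f \<longleftrightarrow> (\<forall>c\<in>\<A>. Ck (Suc 0) (chart_range c) (in_chart c f))"

context
  fixes M :: "'m topology" and \<A> :: "('m, 'n::finite) chart set"
  assumes mf: "oriented_smooth_manifold M \<A>"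
begin

lemma in_chart_apply: "c \<in> \<A> \<Longrightarrow> p \<in> fst c \<Longrightarrow> in_chart c f (snd c p) = f p"
  using chart_properties(3)[OF mf] by (simp add: in_chart_def)

lemma in_chart_transition:
  assumes "c \<in> \<A>" "d \<in> \<A>" "x \<in> overlap c d"
  shows "in_chart c f x = in_chart d f (transition c d x)" "transition c d x \<in> overlap d c"
    "transition c d x \<in> chart_range d"
  using assms by (auto simp: in_chart_apply transition_apply[OF chart_properties(3)[OF mf assms(1,1)]])

lemma pd_in_chart_transform:
  assumes cd: "c \<in> \<A>" "d \<in> \<A>" and x: "x \<in> overlap c d" and f: "Ck (Suc 0) (chart_range d) (in_chart d f)"
  shows "pd i (in_chart c f) x = (\<Sum>m\<in>UNIV. jacobian (transition c d) (at x) $ m $ i * pd m (in_chart d f) (transition c d x))"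
    and "in_chart c f differentiable (at x)"
proof -
  note tr = transition_has_derivative[OF mf cd x]
  have df: "in_chart d f differentiable (at (transition c d x))"
  proof -
    have "in_chart d f differentiable_on chart_range d" using f by simp
    then show ?thesis
      using in_chart_transition(3)[OF cd x] chart_properties(2)[OF mf cd(2,2)]
        differentiable_on_eq_differentiable_at by blast
  qed
  have dt: "transition c d differentiable (at x)" using tr(1) by (auto simp: differentiable_def)
  have eq: "in_chart c f y = in_chart d f (transition c d y)" if "y \<in> overlap c d" for y
    by (rule in_chart_transition(1)[OF cd that])
  show "pd i (in_chart c f) x = (\<Sum>m\<in>UNIV. jacobian (transition c d) (at x) $ m $ i * pd m (in_chart d f) (transition c d x))"
    using pd_cong[OF tr(2) x, of "in_chart c f" "\<lambda>y. in_chart d f (transition c d y)", OF eq] pd_chain_rule(2)[OF df dt] by simp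
  show "in_chart c f differentiable (at x)"
    using differentiable_cong_open[OF tr(2) x, of "in_chart c f" "\<lambda>y. in_chart d f (transition c d y)", OF eq] pd_chain_rule(1)[OF df dt] by simp
qed

lemma C1_transition:
  assumes cd: "c \<in> \<A>" "d \<in> \<A>" and f: "Ck (Suc 0) (chart_range d) (in_chart d f)"
  shows "Ck (Suc 0) (overlap c d) (in_chart c f)"
proof (cases "overlap c d = {}")
  case False
  then obtain x0 where x0: "x0 \<in> overlap c d" by blast
  have op: "open (overlap c d)" by (rule transition_has_derivative(2)[OF mf cd x0])
  have dt: "transition c d differentiable (at x)" if "x \<in> overlap c d" for x
    using transition_has_derivative(1)[OF mf cd that] by (auto simp: differentiable_def)
  have ct: "continuous_on (overlap c d) (transition c d)"
    using dt op differentiable_imp_continuous_within by (metis continuous_at_imp_continuous_on)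
  have "continuous_on (overlap c d) (\<lambda>x. \<Sum>m\<in>UNIV. jacobian (transition c d) (at x) $ m $ i * pd m (in_chart d f) (transition c d x))" for i
  proof (intro continuous_on_sum continuous_on_mult)
    fix m
    have "continuous_on (overlap c d) (pd i (\<lambda>x. transition c d x $ m))"
      by (rule smooth_continuous_on[OF smooth_fun_on_pd[OF chart_properties(6)[OF mf cd]]])
    then show "continuous_on (overlap c d) (\<lambda>x. jacobian (transition c d) (at x) $ m $ i)"
      by (rule continuous_on_eq) (simp add: jacobian_nth[OF dt])
    show "continuous_on (overlap c d) (\<lambda>x. pd m (in_chart d f) (transition c d x))"
      using f by (intro continuous_on_compose2[OF _ ct]) (auto simp: in_chart_transition(3)[OF cd])
  qed
  then have "continuous_on (overlap c d) (pd i (in_chart c f))" for i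
    by (rule continuous_on_eq) (simp add: pd_in_chart_transform(1)[OF cd _ f])
  then show ?thesis
    using pd_in_chart_transform(2)[OF cd _ f] op by (auto simp: differentiable_on_eq_differentiable_at)
qed (simp add: differentiable_on_def)

text \<open>Compact subsets of a Hausdorff space are closed.\<close>

lemma closedin_chart_compact:
  assumes c: "c \<in> \<A>" and K: "compact K" "K \<subseteq> chart_range c"
  shows "closedin M {p \<in> fst c. snd c p \<in> K}"
proof -
  note ch = chart_properties[OF mf c c]
  obtain g where g: "homeomorphic_maps (subtopology M (fst c)) (top_of_set (chart_range c)) (snd c) g"
    using ch(4) homeomorphic_map_maps by blast
  then have cont: "continuous_map (top_of_set (chart_range c)) (subtopology M (fst c)) g"
    and gs: "\<And>p. p \<in> fst c \<Longrightarrow> g (snd c p) = p"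
    using ch(5) by (auto simp: homeomorphic_maps_def)
  have "compactin (top_of_set (chart_range c)) K"
    using K by (simp add: compactin_subtopology)
  from image_compactin[OF this cont] have "compactin M (g ` K)" by (simp add: compactin_subtopology)
  moreover have "g ` K = {p \<in> fst c. snd c p \<in> K}"
    using K(2) gs by (auto simp: image_iff) force
  moreover have "Hausdorff_space M" using mf unfolding oriented_smooth_manifold_def by blast
  ultimately show ?thesis using compactin_imp_closedin by metis
qed

text \<open>The complement of the compact set \<open>K\<close> is open in \<open>M\<close>, so a function supported in \<open>K\<close> vanishes near
  every point outside, including points that the chart \<open>c\<close> does not reach.\<close>

lemma in_chart_zero_near:
  assumes cd: "c \<in> \<A>" "d \<in> \<A>" and K: "compact K" "K \<subseteq> chart_range c"
    and z: "\<And>q. q \<in> topspace M \<Longrightarrow> f q \<noteq> 0 \<Longrightarrow> q \<in> fst c \<and> snd c q \<in> K"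
    and p: "p \<in> fst d" "\<not> (p \<in> fst c \<and> snd c p \<in> K)"
  shows "\<exists>N. open N \<and> snd d p \<in> N \<and> N \<subseteq> chart_range d \<and> (\<forall>y\<in>N. in_chart d f y = 0)"
proof -
  let ?K = "{p \<in> fst c. snd c p \<in> K}"
  have "openin M (topspace M - ?K)" using closedin_chart_compact[OF cd(1) K] by blast
  then have "open (snd d ` ((topspace M - ?K) \<inter> fst d))" by (rule chart_image_open[OF mf cd(2)])
  moreover have "snd d p \<in> snd d ` ((topspace M - ?K) \<inter> fst d)"
    using p chart_properties(5)[OF mf cd(2,2)] by auto
  moreover have "in_chart d f y = 0" if y: "y \<in> snd d ` ((topspace M - ?K) \<inter> fst d)" for y
  proof -
    obtain q where q: "q \<in> topspace M" "q \<notin> ?K" "q \<in> fst d" "y = snd d q" using y by blast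
    then have "f q = 0" using z[of q] by auto
    then show ?thesis using q in_chart_apply[OF cd(2)] by simp
  qed
  ultimately show ?thesis by blast
qed

text \<open>Near a point of the chart \<open>c\<close> the function is a composition with a smooth transition; near any other
  point it is zero.\<close>

lemma C1_manifold_chart_fun:
  assumes c: "c \<in> \<A>" and K: "compact K" "K \<subseteq> chart_range c" and u: "Ck (Suc 0) (chart_range c) u"
    and z: "\<And>x. x \<in> chart_range c \<Longrightarrow> x \<notin> K \<Longrightarrow> u x = 0"
  shows "C1_manifold \<A> (chart_fun c u)"
  unfolding C1_manifold_def
proof
  fix d assume d: "d \<in> \<A>"
  note chd = chart_properties[OF mf d d]
  have uc: "Ck (Suc 0) (chart_range c) (in_chart c (chart_fun c u))"
    by (rule iffD2[OF Ck_cong[OF chart_properties(2)[OF mf c c]] u])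
       (auto simp: in_chart_apply[OF c] chart_fun_def)
  show "Ck (Suc 0) (chart_range d) (in_chart d (chart_fun c u))"
  proof (rule C1_local[OF chd(2)])
    fix y assume "y \<in> chart_range d"
    then obtain p where p: "p \<in> fst d" "y = snd d p" by blast
    show "\<exists>N. open N \<and> y \<in> N \<and> N \<subseteq> chart_range d \<and> Ck (Suc 0) N (in_chart d (chart_fun c u))"
    proof (cases "p \<in> fst c")
      case True
      have y: "y \<in> overlap d c" using p True by auto
      then show ?thesis
        using transition_has_derivative(2)[OF mf d c y] C1_transition[OF d c uc] by blast
    next
      case False
      have "\<exists>N. open N \<and> snd d p \<in> N \<and> N \<subseteq> chart_range d \<and> (\<forall>y\<in>N. in_chart d (chart_fun c u) y = 0)"
        by (rule in_chart_zero_near[OF c d K]) (use z p False in \<open>auto simp: chart_fun_def split: if_splits\<close>)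
      then obtain N where N: "open N" "y \<in> N" "N \<subseteq> chart_range d" "\<And>y. y \<in> N \<Longrightarrow> in_chart d (chart_fun c u) y = 0"
        using p by blast
      have "Ck (Suc 0) N (in_chart d (chart_fun c u))"
        by (rule iffD2[OF Ck_cong[OF N(1), where f="in_chart d (chart_fun c u)" and g="\<lambda>x. 0"]]) (simp_all only: N(4) Ck_const)
      then show ?thesis using N by blast
    qed
  qed
qed

text \<open>By compactness finitely many coordinate balls cover \<open>M\<close>; the bump functions of these balls are divided
  by their sum, which is positive everywhere. An index \<open>t\<close> consists of a chart, a centre and a radius.\<close>

lemma partition_of_unity:
  assumes cpt: "compact_space M"
  obtains I :: "(('m, 'n) chart \<times> (real^'n) \<times> real) set" and \<psi> :: "('m, 'n) chart \<times> (real^'n) \<times> real \<Rightarrow> 'm \<Rightarrow> real"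
  where "finite I" "\<And>t. t \<in> I \<Longrightarrow> fst t \<in> \<A>" "\<And>t. t \<in> I \<Longrightarrow> C1_manifold \<A> (\<psi> t)"
    "\<And>t. t \<in> I \<Longrightarrow> compact (cball (fst (snd t)) (snd (snd t))) \<and> cball (fst (snd t)) (snd (snd t)) \<subseteq> chart_range (fst t)"
    "\<And>t p. t \<in> I \<Longrightarrow> p \<in> topspace M \<Longrightarrow> \<psi> t p \<ge> 0"
    "\<And>t p. t \<in> I \<Longrightarrow> p \<in> topspace M \<Longrightarrow> \<psi> t p \<noteq> 0 \<Longrightarrow> p \<in> fst (fst t) \<and> snd (fst t) p \<in> cball (fst (snd t)) (snd (snd t))"
    "\<And>p. p \<in> topspace M \<Longrightarrow> (\<Sum>t\<in>I. \<psi> t p) = 1"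
proof -
  define good where "good = {t :: ('m, 'n) chart \<times> (real^'n) \<times> real. fst t \<in> \<A> \<and> 0 < snd (snd t) \<and> cball (fst (snd t)) (snd (snd t)) \<subseteq> chart_range (fst t)}"
  define U where "U t = {p \<in> fst (fst t). snd (fst t) p \<in> ball (fst (snd t)) (snd (snd t))}" for t :: "('m, 'n) chart \<times> (real^'n) \<times> real"
  have "\<forall>V\<in>U ` good. openin M V"
  proof
    fix V assume "V \<in> U ` good"
    then obtain t where "V = U t" "fst t \<in> \<A>" by (auto simp: good_def)
    then show "openin M V" unfolding U_def using chart_vimage_open[OF mf _ open_ball] by simp
  qed
  moreover have "topspace M \<subseteq> \<Union>(U ` good)"
  proof
    fix p assume "p \<in> topspace M"
    then obtain c where c: "c \<in> \<A>" "p \<in> fst c" using mf unfolding oriented_smooth_manifold_def by blast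
    then obtain r where "r > 0" "cball (snd c p) r \<subseteq> chart_range c"
      using chart_properties(2)[OF mf c(1,1)] open_contains_cball by blast
    then have "(c, snd c p, r) \<in> good" "p \<in> U (c, snd c p, r)" using c by (auto simp: good_def U_def)
    then show "p \<in> \<Union>(U ` good)" by blast
  qed
  ultimately have "\<exists>\<F>. finite \<F> \<and> \<F> \<subseteq> U ` good \<and> topspace M \<subseteq> \<Union>\<F>"
    using spec[OF conjunct2[OF cpt[unfolded compact_space_def compactin_def]], of "U ` good"] by auto
  then obtain \<F> where \<F>: "finite \<F>" "\<F> \<subseteq> U ` good" "topspace M \<subseteq> \<Union>\<F>" by auto
  obtain I where I: "finite I" "I \<subseteq> good" "\<F> = U ` I" using finite_subset_image[OF \<F>(1,2)] by blast
  define b where "b t = chart_fun (fst t) (bump (fst (snd t)) (snd (snd t)))" for t :: "('m, 'n) chart \<times> (real^'n) \<times> real"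
  define \<psi> where "\<psi> t p = b t p * inverse (\<Sum>s\<in>I. b s p)" for t p
  have tI: "fst t \<in> \<A>" "0 < snd (snd t)" "cball (fst (snd t)) (snd (snd t)) \<subseteq> chart_range (fst t)" if "t \<in> I" for t
    using I(2) that by (auto simp: good_def)
  have b0: "b t p \<ge> 0" for t p by (simp add: b_def chart_fun_def bump_nonneg)
  have bC1: "C1_manifold \<A> (b t)" if t: "t \<in> I" for t
    unfolding b_def
  proof (rule C1_manifold_chart_fun[OF tI(1)[OF t] _ tI(3)[OF t]])
    show "Ck (Suc 0) (chart_range (fst t)) (bump (fst (snd t)) (snd (snd t)))"
      using bump_C1[of "fst (snd t)" "snd (snd t)"] by (auto intro: differentiable_on_subset continuous_on_subset)
    show "bump (fst (snd t)) (snd (snd t)) x = 0" if "x \<notin> cball (fst (snd t)) (snd (snd t))" for x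
      using that by (intro bump_zero tI(2)[OF t]) (simp add: dist_commute)
  qed simp
  have pos: "(\<Sum>s\<in>I. b s p) > 0" if p: "p \<in> topspace M" for p
  proof -
    obtain t where t: "t \<in> I" "p \<in> U t" using \<F>(3) I(3) p by auto
    then have "b t p > 0" by (auto simp: b_def U_def chart_fun_def dist_commute intro!: bump_pos)
    then show ?thesis using t(1) I(1) b0 by (intro sum_pos2) auto
  qed
  show ?thesis
  proof (rule that[of I \<psi>])
    show "C1_manifold \<A> (\<psi> t)" if t: "t \<in> I" for t
      unfolding C1_manifold_def
    proof
      fix c assume c: "c \<in> \<A>"
      note ch = chart_properties[OF mf c c]
      have "(\<Sum>s\<in>I. in_chart c (b s) x) \<noteq> 0" if x: "x \<in> chart_range c" for x
      proof -
        obtain q where q: "q \<in> fst c" "x = snd c q" using x by blast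
        then have "q \<in> topspace M" using ch(5) by blast
        from pos[OF this] show ?thesis using q in_chart_apply[OF c] by simp
      qed
      then have "Ck (Suc 0) (chart_range c) (\<lambda>x. in_chart c (b t) x * inverse (\<Sum>s\<in>I. in_chart c (b s) x))"
        using bC1 t c unfolding C1_manifold_def by (intro Ck_mult Ck_inverse Ck_sum ch(2)) auto
      then show "Ck (Suc 0) (chart_range c) (in_chart c (\<psi> t))" by (simp add: in_chart_def[abs_def] \<psi>_def)
    qed
    show "\<psi> t p \<ge> 0" for t p by (simp add: \<psi>_def b0 sum_nonneg)
    show "p \<in> fst (fst t) \<and> snd (fst t) p \<in> cball (fst (snd t)) (snd (snd t))" if t: "t \<in> I" and "\<psi> t p \<noteq> 0" for t p
    proof -
      have "b t p \<noteq> 0" using that by (simp add: \<psi>_def)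
      then have "p \<in> fst (fst t)" "\<not> snd (snd t) \<le> dist (snd (fst t) p) (fst (snd t))"
        using bump_zero[OF tI(2)[OF t]] by (auto simp: b_def chart_fun_def split: if_splits)
      then show ?thesis by (simp add: dist_commute)
    qed
    show "(\<Sum>t\<in>I. \<psi> t p) = 1" if "p \<in> topspace M" for p
      using pos[OF that] by (simp add: \<psi>_def flip: sum_distrib_right)
  qed (use I tI in auto)
qed

end

section \<open>The integral inequality\<close>

lemma integral_chart_fun_continuous:
  fixes h :: "('m, 'n::finite) tensor_field"
  assumes mf: "oriented_smooth_manifold M \<A>" and h: "riemannian_metric \<A> h" and cpt: "compact_space M"
    and c: "c \<in> \<A>" and K: "compact K" "K \<subseteq> chart_range c"
    and u: "continuous_on (chart_range c) u" and z: "\<And>x. x \<in> chart_range c \<Longrightarrow> x \<notin> K \<Longrightarrow> u x = 0"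
  shows "integrable (riemannian_volume M \<A> h) (chart_fun c u)"
    and "(LINT p|riemannian_volume M \<A> h. chart_fun c u p) =
      (LINT x|lborel. indicator (chart_range c) x * (vol_weight h c x * u x))"
proof -
  note op = chart_properties(2)[OF mf c c]
  let ?u = "\<lambda>x. indicator (chart_range c) x * u x"
  have cf: "chart_fun c ?u = chart_fun c u" by (auto simp: chart_fun_def fun_eq_iff)
  have eq: "(\<lambda>x. indicator (chart_range c) x * (vol_weight h c x * ?u x)) = (\<lambda>x. indicator (chart_range c) x * (vol_weight h c x * u x))"
    by (auto simp: fun_eq_iff indicator_def)
  have m: "?u \<in> borel_measurable borel" by (rule borel_measurable_extend[OF op u])
  have "continuous_on (chart_range c) (\<lambda>x. vol_weight h c x * u x)"
    by (intro continuous_on_mult u smooth_continuous_on[OF vol_weight_smooth[OF h c op]])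
  then have i: "integrable lborel (\<lambda>x. indicator (chart_range c) x * (vol_weight h c x * u x))"
    by (rule integrable_compact_support[OF op K]) (simp add: z)
  show "integrable (riemannian_volume M \<A> h) (chart_fun c u)"
    using integral_chart_fun(1)[OF mf h cpt c m] i unfolding eq cf .
  show "(LINT p|riemannian_volume M \<A> h. chart_fun c u p) =
      (LINT x|lborel. indicator (chart_range c) x * (vol_weight h c x * u x))"
    using integral_chart_fun(2)[OF mf h cpt c m] i unfolding eq cf .
qed

text \<open>The components in two charts are related by \<open>change_basis\<close>, and contractions do not depend on the
  basis, so the value is the same in every chart around the point.\<close>

lemma norm_sq_at_chart:
  fixes h \<omega> :: "('m, 'n::finite) tensor_field"
  assumes mf: "oriented_smooth_manifold M \<A>" and h: "riemannian_metric \<A> h"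
    and \<omega>: "smooth_tensor_field \<A> k \<omega>" and c: "c \<in> \<A>" and p: "p \<in> fst c"
  shows "norm_sq_at \<A> h k \<omega> p = norm_sq (gram (h c (snd c p))) k (\<omega> c (snd c p))"
proof -
  have "norm_sq (gram (h c (snd c p))) k (\<omega> c (snd c p)) = norm_sq (gram (h d (snd d p))) k (\<omega> d (snd d p))"
    if d: "d \<in> \<A>" "p \<in> fst d" for d
  proof -
    let ?x = "snd c p" and ?J = "jacobian (transition c d) (at (snd c p))"
    have x: "?x \<in> overlap c d" using p d by blast
    have tx: "transition c d ?x = snd d p" using transition_apply[OF chart_properties(3)[OF mf c c] p] .
    have "smooth_tensor_field \<A> 2 h" using h unfolding riemannian_metric_def by blast
    from gram_transform[OF this c d(1) x]
    have g: "gram (h c ?x) = transpose ?J ** gram (h d (snd d p)) ** ?J" unfolding tx .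
    have inv: "invertible (gram (h d (snd d p)))"
      using det_gram_pos[OF h d(1), of "snd d p"] d(2) by (simp add: invertible_det_nz)
    have invJ: "invertible ?J"
      using chart_properties(7)[OF mf c d(1) x] by (simp add: invertible_det_nz)
    have "\<omega> c ?x I = change_basis ?J k (\<omega> d (snd d p)) I" if "I \<in> multi_idx k" for I
    proof -
      have "\<forall>x\<in>overlap c d. \<forall>I\<in>multi_idx k. \<omega> c x I = change_basis (jacobian (transition c d) (at x)) k (\<omega> d (transition c d x)) I"
        using \<omega> c d(1) unfolding smooth_tensor_field_def change_basis_def by blast
      from bspec[OF bspec[OF this x] that] show ?thesis unfolding tx .
    qed
    then have "norm_sq (gram (h c ?x)) k (\<omega> c ?x) = contr (gram (h c ?x)) k (change_basis ?J k (\<omega> d (snd d p))) (change_basis ?J k (\<omega> d (snd d p)))"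
      unfolding norm_sq_contr by (intro contr_cong)
    then show ?thesis unfolding g contr_change_basis[OF inv invJ] norm_sq_contr .
  qed
  note eq = this
  show ?thesis
    unfolding norm_sq_at_def
  proof (rule the_equality)
    show "\<forall>d\<in>\<A>. p \<in> fst d \<longrightarrow> norm_sq (gram (h c (snd c p))) k (\<omega> c (snd c p)) = norm_sq (gram (h d (snd d p))) k (\<omega> d (snd d p))"
      using eq by blast
  qed (use c p in blast)
qed

definition grad_pairing :: "('m, 'n::finite) tensor_field \<Rightarrow> ('m, 'n) chart \<Rightarrow> ('m \<Rightarrow> real) \<Rightarrow> ('m \<Rightarrow> real) \<Rightarrow> real^'n \<Rightarrow> real" where
  "grad_pairing h c f u x = (\<Sum>i\<in>UNIV. \<Sum>j\<in>UNIV. matrix_inv (gram (h c x)) $ i $ j * (pd i (in_chart c f) x * pd j (in_chart c u) x))"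

lemma grad_pairing_transform:
  fixes h :: "('m, 'n::finite) tensor_field"
  assumes mf: "oriented_smooth_manifold M \<A>" and h: "riemannian_metric \<A> h"
    and f: "C1_manifold \<A> f" and u: "C1_manifold \<A> u"
    and cd: "c \<in> \<A>" "d \<in> \<A>" and x: "x \<in> overlap c d"
  shows "grad_pairing h c f u x = grad_pairing h d f u (transition c d x)"
proof -
  let ?J = "jacobian (transition c d) (at x)" and ?y = "transition c d x"
  have g: "gram (h c x) = transpose ?J ** gram (h d ?y) ** ?J"
    using gram_transform[OF _ cd x] h unfolding riemannian_metric_def by blast
  have inv: "invertible (gram (h d ?y))"
    using det_gram_pos[OF h cd(2) in_chart_transition(3)[OF mf cd x]] by (simp add: invertible_det_nz)
  have invJ: "invertible ?J"
    using chart_properties(7)[OF mf cd x] by (simp add: invertible_det_nz)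
  have fd: "Ck (Suc 0) (chart_range d) (in_chart d f)" and ud: "Ck (Suc 0) (chart_range d) (in_chart d u)"
    using f u cd unfolding C1_manifold_def by blast+
  have "pd i (in_chart c f) x * pd j (in_chart c u) x =
     (\<Sum>k\<in>UNIV. \<Sum>l\<in>UNIV. ?J $ k $ i * ?J $ l $ j * (pd k (in_chart d f) ?y * pd l (in_chart d u) ?y))" for i j
    unfolding pd_in_chart_transform(1)[OF mf cd x fd] pd_in_chart_transform(1)[OF mf cd x ud] sum_product
    by (simp only: mult_ac)
  then show ?thesis
    unfolding grad_pairing_def g by (simp only: sum_congruent[OF inv invJ])
qed

lemma metric_riemannian_chart:
  assumes mf: "oriented_smooth_manifold M \<A>" and h: "riemannian_metric \<A> h" and c: "c \<in> \<A>"
  shows "riemannian_chart (chart_range c) (h c)"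
proof
  show "open (chart_range c)" by (rule chart_properties(2)[OF mf c c])
  show "smooth_fun_on (chart_range c) (\<lambda>x. h c x [i, j])" for i j
    using gram_smooth[OF h c, of i j] by (simp add: gram_def)
qed (use gram_pos_def[OF h c] in auto)

text \<open>One member of the partition of unity: integrate the Bochner inequality against it and move the
  derivatives over to it.\<close>
lemma local_integral_inequality:
  fixes h \<omega> :: "('m, 'n::finite) tensor_field"
  assumes mf: "oriented_smooth_manifold M \<A>" and cpt: "compact_space M" and h: "riemannian_metric \<A> h"
    and cpf: "coupled_projectively_flat \<A> h (Suc (Suc m)) \<omega> c \<kappa>" and c0: "c < 0"
    and d: "d \<in> \<A>" and K: "compact K" "K \<subseteq> chart_range d"
    and \<psi>: "C1_manifold \<A> \<psi>" "\<And>p. p \<in> topspace M \<Longrightarrow> \<psi> p \<ge> 0"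
      "\<And>p. p \<in> topspace M \<Longrightarrow> \<psi> p \<noteq> 0 \<Longrightarrow> p \<in> fst d \<and> snd d p \<in> K"
  defines "\<phi> \<equiv> norm_sq_at \<A> h (Suc (Suc m)) \<omega>"
    and "F \<equiv> \<lambda>s. s * ((real CARD('n) + real m) / (real CARD('n) * (real CARD('n) - 1)) * \<kappa> + c * Lambda (mat 1 :: real^'n^'n) (Suc (Suc m)) * s)"
  shows "integrable (riemannian_volume M \<A> h) (chart_fun d (in_chart d (\<lambda>p. \<psi> p * F (\<phi> p))))"
    and "integrable (riemannian_volume M \<A> h) (chart_fun d (grad_pairing h d \<psi> \<phi>))"
    and "(LINT p|riemannian_volume M \<A> h. chart_fun d (in_chart d (\<lambda>p. \<psi> p * F (\<phi> p))) p)
      \<le> - (1 / 2) * (LINT p|riemannian_volume M \<A> h. chart_fun d (grad_pairing h d \<psi> \<phi>) p)"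
    and "C1_manifold \<A> \<phi>"
proof -
  let ?k = "Suc (Suc m)"
  have \<omega>: "smooth_tensor_field \<A> ?k \<omega>"
    using cpf unfolding coupled_projectively_flat_def trace_free_codazzi_def by blast
  have in_phi: "in_chart e \<phi> x = norm_sq (gram (h e x)) ?k (\<omega> e x)" if "e \<in> \<A>" "x \<in> chart_range e" for e x
    unfolding \<phi>_def using that in_chart_apply[OF mf that(1)] norm_sq_at_chart[OF mf h \<omega> that(1)] by auto
  have \<omega>_smooth: "riemannian_chart.smooth_field (chart_range e) ?k (\<omega> e)" if "e \<in> \<A>" for e
    unfolding riemannian_chart.smooth_field_def[OF metric_riemannian_chart[OF mf h that]]
    using \<omega> that unfolding smooth_tensor_field_def by blast
  have phi_smooth: "smooth_fun_on (chart_range e) (in_chart e \<phi>)" if e: "e \<in> \<A>" for e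
  proof -
    interpret riemannian_chart "chart_range e" "h e" by (rule metric_riemannian_chart[OF mf h e])
    have "smooth_fun_on (chart_range e) (\<lambda>x. norm_sq (gram (h e x)) ?k (\<omega> e x))"
      unfolding norm_sq_contr by (intro contr_smooth \<omega>_smooth e)
    moreover have "smooth_fun_on (chart_range e) (in_chart e \<phi>) \<longleftrightarrow>
        smooth_fun_on (chart_range e) (\<lambda>x. norm_sq (gram (h e x)) ?k (\<omega> e x))"
      by (rule smooth_cong[OF S]) (rule in_phi[OF e])
    ultimately show ?thesis by blast
  qed
  then show phi_C1: "C1_manifold \<A> \<phi>" unfolding C1_manifold_def smooth_iff_Ck by blast
  interpret riemannian_chart "chart_range d" "h d" by (rule metric_riemannian_chart[OF mf h d])
  let ?C = "chart_range d" and ?w = "vol_weight h d" and ?\<psi> = "in_chart d \<psi>" and ?\<phi> = "in_chart d \<phi>"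
  have psi_C1: "Ck (Suc 0) ?C ?\<psi>" using \<psi>(1) d unfolding C1_manifold_def by blast
  have psi_K: "?\<psi> x = 0" if x: "x \<in> ?C" "x \<notin> K" for x
  proof -
    obtain p where p: "p \<in> fst d" "x = snd d p" using x(1) by blast
    then have "p \<in> topspace M" using chart_properties(5)[OF mf d d] by blast
    then show ?thesis using \<psi>(3)[of p] p x(2) in_chart_apply[OF mf d p(1)] by auto
  qed
  have psi_nonneg: "?\<psi> x \<ge> 0" if x: "x \<in> ?C" for x
  proof -
    obtain p where p: "p \<in> fst d" "x = snd d p" using x by blast
    then have "p \<in> topspace M" using chart_properties(5)[OF mf d d] by blast
    then show ?thesis using \<psi>(2)[of p] p in_chart_apply[OF mf d p(1)] by simp
  qed
  have pd_psi_K: "pd i ?\<psi> x = 0" if "x \<in> ?C" "x \<notin> K" for i x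
    by (rule integral_pd_eq_0(2)[OF S K psi_C1 psi_K that])
  have w_smooth: "smooth_fun_on ?C ?w" by (rule vol_weight_smooth[OF h d S])
  define V where "V j y = contr (H y) ?k (\<lambda>I. D (\<omega> d) y (j # I)) (\<omega> d y)" for j y
  define W where "W i y = ?w y * (\<Sum>j\<in>UNIV. G y $ i $ j * V j y)" for i y
  have V_smooth: "smooth_fun_on ?C (V j)" for j
    unfolding V_def by (intro contr_smooth smooth_field_Cons smooth_field_cov_deriv \<omega>_smooth d)
  have W_smooth: "smooth_fun_on ?C (W i)" for i
    unfolding W_def by (intro smooth_mult smooth_sum S w_smooth G_smooth V_smooth)
  have pd_phi: "pd j ?\<phi> x = 2 * V j x" if "x \<in> ?C" for j x
    using pd_cong[OF S that in_phi[OF d]] pd_norm_sq[OF that \<omega>_smooth[OF d]] by (simp add: V_def)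
  have F_cont: "continuous_on ?C (\<lambda>x. ?\<psi> x * F (?\<phi> x))"
    unfolding F_def using psi_C1[THEN Ck_continuous] smooth_continuous_on[OF phi_smooth[OF d]] by (intro continuous_intros)
  have comp: "in_chart d (\<lambda>p. \<psi> p * F (\<phi> p)) = (\<lambda>x. ?\<psi> x * F (?\<phi> x))" by (simp add: in_chart_def fun_eq_iff)
  have grad_cont: "continuous_on ?C (grad_pairing h d \<psi> \<phi>)"
    unfolding grad_pairing_def using psi_C1
    by (intro continuous_on_sum continuous_on_mult smooth_continuous_on[OF G_smooth] smooth_continuous_on[OF smooth_fun_on_pd[OF phi_smooth[OF d]]]) auto
  note int1 = integral_chart_fun_continuous[OF mf h cpt d K F_cont]
  show "integrable (riemannian_volume M \<A> h) (chart_fun d (in_chart d (\<lambda>p. \<psi> p * F (\<phi> p))))"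
    unfolding comp by (rule int1(1)) (simp add: psi_K)
  have grad_K: "grad_pairing h d \<psi> \<phi> x = 0" if "x \<in> ?C" "x \<notin> K" for x
    by (simp add: grad_pairing_def pd_psi_K[OF that])
  note int2 = integral_chart_fun_continuous[OF mf h cpt d K grad_cont grad_K]
  show "integrable (riemannian_volume M \<A> h) (chart_fun d (grad_pairing h d \<psi> \<phi>))" by (rule int2(1))
  \<comment> \<open>The constants match: \<open>l (n + m)\<close> with \<open>l = \<kappa> / (n (n - 1))\<close> and \<open>m = k - 2\<close>.\<close>
  have bochner: "?w x * F (?\<phi> x) \<le> (\<Sum>i\<in>UNIV. pd i (W i) x)" if x: "x \<in> ?C" for x
  proof -
    let ?l = "\<kappa> / (real CARD('n) * (real CARD('n) - 1))"
    have tfc: "trace_free_codazzi \<A> h ?k \<omega>" using cpf unfolding coupled_projectively_flat_def by blast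
    have "?w x * (?\<phi> x * (?l * (real CARD('n) + real m) + c * Lambda (mat 1 :: real^'n^'n) ?k * ?\<phi> x)) \<le> (\<Sum>i\<in>UNIV. pd i (W i) x)"
      unfolding W_def V_def vol_weight_def in_phi[OF d x]
    proof (rule bochner_inequality[OF x \<omega>_smooth[OF d]])
      fix y assume y: "y \<in> ?C"
      show "symmetric_tensor ?k (\<omega> d y)" "trace_free (H y) ?k (\<omega> d y)"
        using tfc d y unfolding trace_free_codazzi_def by blast+
      show "D (\<omega> d) y (i # j # A) = D (\<omega> d) y (j # i # A)" if "A \<in> multi_idx (Suc m)" for i j A
        using tfc d y that unfolding trace_free_codazzi_def diff_Suc_1 by blast
    next
      fix L :: "'n list" assume "L \<in> multi_idx 4"
      then show "Riem (h d) x L - c * circledast (H x) ?k (\<omega> d x) L = - ?l * circledast (H x) 2 (h d x) L"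
        using cpf d x unfolding coupled_projectively_flat_def by blast
    qed (use c0 in simp)
    then show ?thesis by (simp add: F_def mult_ac)
  qed
  have prod_rule: "pd i (\<lambda>y. ?\<psi> y * W i y) x = pd i ?\<psi> x * W i x + ?\<psi> x * pd i (W i) x" if "x \<in> ?C" for i x
  proof (rule pd_mult[OF _ differentiable_in_chart[OF W_smooth that]])
    have "?\<psi> differentiable_on ?C" using psi_C1 by simp
    then show "?\<psi> differentiable (at x)" using that differentiable_on_eq_differentiable_at[OF S] by blast
  qed
  have psiW_C1: "Ck (Suc 0) ?C (\<lambda>y. ?\<psi> y * W i y)" for i
    using W_smooth[of i] unfolding smooth_iff_Ck by (intro Ck_mult S psi_C1) blast
  have by_parts: "(\<Sum>i\<in>UNIV. LINT x|lborel. indicator ?C x * pd i (\<lambda>y. ?\<psi> y * W i y) x) = 0"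
    by (intro sum.neutral ballI integral_pd_eq_0(1)[OF S K psiW_C1]) (simp add: psi_K)
  let ?A = "\<lambda>x. indicator ?C x * (\<Sum>i\<in>UNIV. pd i ?\<psi> x * W i x)"
  let ?B = "\<lambda>x. indicator ?C x * (\<Sum>i\<in>UNIV. ?\<psi> x * pd i (W i) x)"
  have iA: "integrable lborel ?A"
    by (rule integrable_compact_support[OF S K])
       (use psi_C1 in \<open>auto intro!: continuous_on_sum continuous_on_mult smooth_continuous_on[OF W_smooth] simp: pd_psi_K\<close>)
  have iB: "integrable lborel ?B"
    by (rule integrable_compact_support[OF S K])
       (use psi_C1[THEN Ck_continuous] in \<open>auto intro!: continuous_on_sum continuous_on_mult smooth_continuous_on[OF smooth_fun_on_pd[OF W_smooth]] simp: psi_K\<close>)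
  have ipd: "integrable lborel (\<lambda>x. indicator ?C x * pd i (\<lambda>y. ?\<psi> y * W i y) x)" for i
    by (rule integrable_compact_support[OF S K])
       (use psiW_C1[of i] integral_pd_eq_0(2)[OF S K psiW_C1[of i]] psi_K in auto)
  have "(LINT x|lborel. ?A x) + (LINT x|lborel. ?B x) = (LINT x|lborel. ?A x + ?B x)"
    using iA iB by simp
  also have "(\<lambda>x. ?A x + ?B x) = (\<lambda>x. \<Sum>i\<in>UNIV. indicator ?C x * pd i (\<lambda>y. ?\<psi> y * W i y) x)"
  proof
    fix x show "?A x + ?B x = (\<Sum>i\<in>UNIV. indicator ?C x * pd i (\<lambda>y. ?\<psi> y * W i y) x)"
      by (cases "x \<in> ?C") (simp_all add: prod_rule sum.distrib)
  qed
  also have "(LINT x|lborel. (\<Sum>i\<in>UNIV. indicator ?C x * pd i (\<lambda>y. ?\<psi> y * W i y) x)) = 0"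
    by (subst Bochner_Integration.integral_sum[OF ipd]) (rule by_parts)
  finally have AB: "(LINT x|lborel. ?B x) = - (LINT x|lborel. ?A x)" by simp
  have "(LINT p|riemannian_volume M \<A> h. chart_fun d (in_chart d (\<lambda>p. \<psi> p * F (\<phi> p))) p)
     = (LINT x|lborel. indicator ?C x * (?w x * (?\<psi> x * F (?\<phi> x))))"
    unfolding comp by (rule int1(2)) (simp add: psi_K)
  also have "\<dots> \<le> (LINT x|lborel. ?B x)"
  proof (rule integral_mono)
    show "integrable lborel (\<lambda>x. indicator ?C x * (?w x * (?\<psi> x * F (?\<phi> x))))"
      by (rule integrable_compact_support[OF S K])
         (auto intro!: continuous_on_mult[OF smooth_continuous_on[OF w_smooth] F_cont] simp: psi_K)
    show "integrable lborel ?B" by (rule iB)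
    fix x
    show "indicator ?C x * (?w x * (?\<psi> x * F (?\<phi> x))) \<le> ?B x"
    proof (cases "x \<in> ?C")
      case True
      have "?\<psi> x * (?w x * F (?\<phi> x)) \<le> ?\<psi> x * (\<Sum>i\<in>UNIV. pd i (W i) x)"
        by (rule mult_left_mono[OF bochner[OF True] psi_nonneg[OF True]])
      then show ?thesis using True by (simp add: sum_distrib_left mult_ac)
    qed simp
  qed
  also have "\<dots> = - (LINT x|lborel. ?A x)" by (rule AB)
  also have "(LINT x|lborel. ?A x) = (LINT x|lborel. (1 / 2) * (indicator ?C x * (?w x * grad_pairing h d \<psi> \<phi> x)))"
  proof (rule Bochner_Integration.integral_cong[OF refl])
    fix x
    show "?A x = (1 / 2) * (indicator ?C x * (?w x * grad_pairing h d \<psi> \<phi> x))"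
    proof (cases "x \<in> ?C")
      case True
      have "(\<Sum>i\<in>UNIV. pd i ?\<psi> x * W i x) = (1 / 2) * (?w x * grad_pairing h d \<psi> \<phi> x)"
        unfolding W_def grad_pairing_def pd_phi[OF True] sum_distrib_left by (intro sum.cong refl) simp
      then show ?thesis using True by simp
    qed simp
  qed
  also have "\<dots> = (1 / 2) * (LINT p|riemannian_volume M \<A> h. chart_fun d (grad_pairing h d \<psi> \<phi>) p)"
    using int2(2) by simp
  finally show "(LINT p|riemannian_volume M \<A> h. chart_fun d (in_chart d (\<lambda>p. \<psi> p * F (\<phi> p))) p)
      \<le> - (1 / 2) * (LINT p|riemannian_volume M \<A> h. chart_fun d (grad_pairing h d \<psi> \<phi>) p)" by simp
qed

theorem theorem5p5:
  fixes M :: "'m topology"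
    and \<A> :: "('m, 'n::finite) chart set"
    and h \<omega> :: "('m, 'n) tensor_field"
    and k :: nat and c \<kappa> :: real
  assumes "oriented_smooth_manifold M \<A>" and "compact_space M"
    and "CARD('n) \<ge> 3" and "k \<ge> 2"
    and "riemannian_metric \<A> h"
    and "coupled_projectively_flat \<A> h k \<omega> c \<kappa>"
    and "c < 0"
  shows "0 \<ge> (LINT p | riemannian_volume M \<A> h.
      norm_sq_at \<A> h k \<omega> p *
        ((real CARD('n) + real k - 2) / (real CARD('n) * (real CARD('n) - 1)) * \<kappa>
          + c * Lambda (mat 1 :: real^'n^'n) k * norm_sq_at \<A> h k \<omega> p))"
proof -
  note mf = assms(1) and cpt = assms(2) and h = assms(5) and c0 = assms(7)
  obtain m where m: "k = Suc (Suc m)" using assms(4) by (metis add_2_eq_Suc le_Suc_ex)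
  note cpf = assms(6)[unfolded m]
  define \<phi> where "\<phi> = norm_sq_at \<A> h k \<omega>"
  define F where "F s = s * ((real CARD('n) + real m) / (real CARD('n) * (real CARD('n) - 1)) * \<kappa> + c * Lambda (mat 1 :: real^'n^'n) k * s)" for s
  let ?V = "riemannian_volume M \<A> h"
  have sp: "space ?V = topspace M" using is_volume_riemannian_volume[OF mf h cpt] unfolding is_volume_def by blast
  obtain I :: "(('m, 'n) chart \<times> (real^'n) \<times> real) set" and \<psi>
    where I: "finite I" "\<And>t. t \<in> I \<Longrightarrow> fst t \<in> \<A>" "\<And>t. t \<in> I \<Longrightarrow> C1_manifold \<A> (\<psi> t)"
    and K: "\<And>t. t \<in> I \<Longrightarrow> compact (cball (fst (snd t)) (snd (snd t))) \<and> cball (fst (snd t)) (snd (snd t)) \<subseteq> chart_range (fst t)"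
    and pos: "\<And>t p. t \<in> I \<Longrightarrow> p \<in> topspace M \<Longrightarrow> \<psi> t p \<ge> 0"
    and supp: "\<And>t p. t \<in> I \<Longrightarrow> p \<in> topspace M \<Longrightarrow> \<psi> t p \<noteq> 0 \<Longrightarrow> p \<in> fst (fst t) \<and> snd (fst t) p \<in> cball (fst (snd t)) (snd (snd t))"
    and one: "\<And>p. p \<in> topspace M \<Longrightarrow> (\<Sum>t\<in>I. \<psi> t p) = 1"
    using partition_of_unity[OF mf cpt] by blast
  note loc = local_integral_inequality[OF mf cpt h cpf c0 I(2) conjunct1[OF K] conjunct2[OF K] I(3) pos supp,
    folded m, folded \<phi>_def, folded F_def]
  have phi_C1: "C1_manifold \<A> \<phi>" if "t \<in> I" for t by (rule loc(4)[OF that that that that]) (use that in auto)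
  let ?f = "\<lambda>t. chart_fun (fst t) (in_chart (fst t) (\<lambda>p. \<psi> t p * F (\<phi> p)))"
  let ?g = "\<lambda>t. chart_fun (fst t) (grad_pairing h (fst t) (\<psi> t) \<phi>)"
  have f_sum: "(\<Sum>t\<in>I. ?f t p) = F (\<phi> p)" if p: "p \<in> topspace M" for p
  proof -
    have "?f t p = \<psi> t p * F (\<phi> p)" if t: "t \<in> I" for t
      using supp[OF t p] in_chart_apply[OF mf I(2)[OF t]] by (auto simp: chart_fun_def)
    then show ?thesis using one[OF p] by (simp flip: sum_distrib_right)
  qed
  \<comment> \<open>At each point all pairings are computed in one chart \<open>d\<close>, where the differentials of the \<open>\<psi>\<^sub>t\<close> add up to the differential of a constant.\<close>
  have g_sum: "(\<Sum>t\<in>I. ?g t p) = 0" if p: "p \<in> topspace M" for p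
  proof -
    obtain d where d: "d \<in> \<A>" "p \<in> fst d" using mf p unfolding oriented_smooth_manifold_def by blast
    note chd = chart_properties[OF mf d(1,1)]
    let ?y = "snd d p"
    have y: "?y \<in> chart_range d" using d by blast
    have g: "?g t p = grad_pairing h d (\<psi> t) \<phi> ?y" if t: "t \<in> I" for t
    proof (cases "p \<in> fst (fst t)")
      case True
      have x: "snd (fst t) p \<in> overlap (fst t) d" using True d by blast
      show ?thesis
        using grad_pairing_transform[OF mf h I(3)[OF t] phi_C1[OF t] I(2)[OF t] d(1) x] True
          transition_apply[OF chart_properties(3)[OF mf I(2)[OF t] I(2)[OF t]] True]
        by (simp add: chart_fun_def)
    next
      case False
      have "\<exists>N. open N \<and> ?y \<in> N \<and> N \<subseteq> chart_range d \<and> (\<forall>y\<in>N. in_chart d (\<psi> t) y = 0)"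
        by (rule in_chart_zero_near[OF mf I(2)[OF t] d(1) conjunct1[OF K[OF t]] conjunct2[OF K[OF t]] supp[OF t]])
           (use False d in auto)
      then obtain N where N: "open N" "?y \<in> N" "\<And>y. y \<in> N \<Longrightarrow> in_chart d (\<psi> t) y = 0" by blast
      have "pd i (in_chart d (\<psi> t)) ?y = 0" for i
        using pd_cong[OF N(1,2), of "in_chart d (\<psi> t)" "\<lambda>x. 0"] N(3) by simp
      then show ?thesis using False by (simp add: chart_fun_def grad_pairing_def)
    qed
    have diff: "in_chart d (\<psi> t) differentiable (at ?y)" if "t \<in> I" for t
    proof -
      have "in_chart d (\<psi> t) differentiable_on chart_range d"
        using I(3)[OF that] d(1) unfolding C1_manifold_def by simp
      then show ?thesis using y differentiable_on_eq_differentiable_at[OF chd(2)] by blast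
    qed
    have "(\<Sum>t\<in>I. pd i (in_chart d (\<psi> t)) ?y) = 0" for i
    proof -
      have "(\<Sum>t\<in>I. pd i (in_chart d (\<psi> t)) ?y) = pd i (\<lambda>x. \<Sum>t\<in>I. in_chart d (\<psi> t) x) ?y"
        by (rule pd_sum[OF diff, symmetric])
      also have "\<dots> = pd i (\<lambda>x. 1) ?y"
      proof (rule pd_cong[OF chd(2) y])
        fix x assume "x \<in> chart_range d"
        then obtain q where q: "q \<in> fst d" "x = snd d q" by blast
        then have "q \<in> topspace M" using chd(5) by blast
        then show "(\<Sum>t\<in>I. in_chart d (\<psi> t) x) = 1" using one q in_chart_apply[OF mf d(1)] by simp
      qed
      finally show ?thesis by simp
    qed
    note zero = this
    have "(\<Sum>t\<in>I. ?g t p) = (\<Sum>t\<in>I. grad_pairing h d (\<psi> t) \<phi> ?y)" by (intro sum.cong refl g)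
    also have "\<dots> = (\<Sum>i\<in>UNIV. \<Sum>j\<in>UNIV. matrix_inv (gram (h d ?y)) $ i $ j * ((\<Sum>t\<in>I. pd i (in_chart d (\<psi> t)) ?y) * pd j (in_chart d \<phi>) ?y))"
      unfolding grad_pairing_def sum_distrib_left sum_distrib_right by (rule sum_rot3[symmetric])
    also have "\<dots> = 0" by (simp add: zero)
    finally show ?thesis .
  qed
  have "(LINT p|?V. F (\<phi> p)) = (LINT p|?V. (\<Sum>t\<in>I. ?f t p))"
    by (rule Bochner_Integration.integral_cong) (simp_all add: f_sum sp)
  also have "\<dots> = (\<Sum>t\<in>I. LINT p|?V. ?f t p)"
    by (rule Bochner_Integration.integral_sum) (rule loc(1))
  also have "\<dots> \<le> (\<Sum>t\<in>I. - (1 / 2) * (LINT p|?V. ?g t p))"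
    by (rule sum_mono) (rule loc(3))
  also have "\<dots> = - (1 / 2) * (LINT p|?V. (\<Sum>t\<in>I. ?g t p))"
    unfolding sum_distrib_left[symmetric] by (subst Bochner_Integration.integral_sum) (auto intro: loc(2))
  also have "(LINT p|?V. (\<Sum>t\<in>I. ?g t p)) = (LINT p|?V. 0)"
    by (rule Bochner_Integration.integral_cong) (simp_all add: g_sum sp)
  finally have "(LINT p|?V. F (\<phi> p)) \<le> 0" by simp
  then show ?thesis by (simp add: F_def \<phi>_def m algebra_simps)
qed

end
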